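(* Let $k$ be an algebraically closed field of characteristic $p$ with $p=0$ or $p\ge 5$. Let $H$ be any non-hyperelliptic Howe curve of genus five over $k$ associated with two genus-$1$ curves $$C_1: y_1^2=(x-\alpha_1)(x-\alpha_2)(x-\alpha_3)(x-\alpha_4),\qquad C_2: y_2^2=(x-\beta_1)(x-\beta_2)(x-\beta_3)(x-\beta_4)$$ with $\alpha_i,\beta_j\in k$. Then $H$ is birational to a plane sextic singular curve $C: f(x,y)=0$ defined by $$\begin{aligned} f={}&(c_{60}x^6+c_{42}x^4y^2)+(c_{50}x^5+c_{32}x^3y^2)+(c_{40}x^4+c_{22}x^2y^2+c_{04}y^4)\\ &+(c_{30}x^3+c_{12}xy^2)+(c_{20}x^2+c_{02}y^2)+c_{10}x+c_{00},\end{aligned}$$ where the $c_{ij}$ are the explicit polynomials in $\alpha_1,\alpha_2,\alpha_3,\alpha_4,\beta_1,\beta_2,\beta_3,\beta_4$ given in the context. Moreover, once $\alpha_1,\dots,\alpha_4,\beta_1,\dots,\beta_4$ are given, all the $13$ coefficients $c_{ij}$ can be computed with arithmetic operations in any field to which all the $\alpha_i$ and $\beta_j$ belong, and the number of required operations in that field is bounded by a constant not depending on the characteristic $p$ of $k$.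
   Context: A curve over $k$ is a (possibly singular) projective variety of dimension one over $k$; affine equations stand for the corresponding curves up to birational equivalence. "Hyperelliptic curve of genus $g\geq 1$" means a non-singular double cover of $\mathbb{P}^1$ of genus $g$ (genus $1$ allowed). Given hyperelliptic curves $C_1,C_2$ over $k$ of genera $0<g_1\le g_2$ with double covers $\psi_i:C_i\to\mathbb{P}^1$ such that there is no isomorphism $\varphi:C_1\to C_2$ with $\psi_2\circ\varphi=\psi_1$, the (generalized) Howe curve $H$ associated with $C_1,C_2$ is the desingularization of the fiber product $C_1\times_{\mathbb{P}^1}C_2$ over $\psi_1,\psi_2$. Its genus is $2(g_1+g_2)+1-r$, where $r$ is the number of ramification points in $\mathbb{P}^1$ common to $C_1$ and $C_2$. Here $\psi_1,\psi_2$ are the $x$-coordinate maps, and genus $5$ with $g_1=g_2=1$ means $r=0$, i.e. the eight elements $\alpha_1,\dots,\alpha_4,\beta_1,\dots,\beta_4$ are pairwise distinct. For $1\le i\le 4$ let $\sigma_i$ and $\tau_i$ be the $i$-th elementary symmetric polynomials in $\alpha_1,\dots,\alpha_4$ and in $\beta_1,\dots,\beta_4$ respectively. The coefficients are $c_{42}=-4$, $c_{04}=1$, $c_{60}=(\sigma_1-\tau_1)^2$, $c_{50}=-2(\sigma_1-\tau_1)(\sigma_2-\tau_2)$, $c_{32}=2(\sigma_1+\tau_1)$, $c_{40}=2(\sigma_1-\tau_1)(\sigma_3-\tau_3)+(\sigma_2-\tau_2)^2$, $c_{22}=-2(\sigma_2+\tau_2)$, $c_{30}=-2(\sigma_1-\tau_1)(\sigma_4-\tau_4)-2(\sigma_2-\tau_2)(\sigma_3-\tau_3)$,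 $c_{12}=2(\sigma_3+\tau_3)$, $c_{20}=(\sigma_3-\tau_3)^2+2(\sigma_4-\tau_4)(\sigma_2-\tau_2)$, $c_{02}=-2(\sigma_4+\tau_4)$, $c_{10}=-2(\sigma_4-\tau_4)(\sigma_3-\tau_3)$, $c_{00}=(\sigma_4-\tau_4)^2$. Equivalently, $f=y^4-2(\phi_1+\phi_2)y^2+(\phi_1-\phi_2)^2$ with $\phi_1=\prod_{i=1}^4(x-\alpha_i)$ and $\phi_2=\prod_{j=1}^4(x-\beta_j)$. *)

theory Defs
  imports
    "HOL-Algebra.Embedded_Algebras"
    "HOL-Algebra.Generated_Fields"
    "HOL-Library.Poly_Mapping"
    "HOL-Library.Function_Algebras"
    "HOL-Computational_Algebra.Computational_Algebra"
begin

section \<open>Multivariate polynomials and forms\<close>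

type_synonym 'k mpoly = "(nat \<Rightarrow>\<^sub>0 nat) \<Rightarrow>\<^sub>0 'k"

definition mono_deg :: "(nat \<Rightarrow>\<^sub>0 nat) \<Rightarrow> nat" where
  "mono_deg m = (\<Sum>i\<in>Poly_Mapping.keys m. Poly_Mapping.lookup m i)"

definition peval :: "'k::field mpoly \<Rightarrow> (nat \<Rightarrow> 'k) \<Rightarrow> 'k" where
  "peval F v = (\<Sum>m\<in>Poly_Mapping.keys F. Poly_Mapping.lookup F m * (\<Prod>i\<in>Poly_Mapping.keys m. v i ^ Poly_Mapping.lookup m i))"

definition mvar :: "nat \<Rightarrow> 'k::field mpoly" where
  "mvar i = Poly_Mapping.single (Poly_Mapping.single i 1) 1"

definition mconst :: "'k::field \<Rightarrow> 'k mpoly" where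
  "mconst c = Poly_Mapping.single 0 c"

definition partial_deriv :: "nat \<Rightarrow> 'k::field mpoly \<Rightarrow> 'k mpoly" where
  "partial_deriv i F =
     (\<Sum>m\<in>Poly_Mapping.keys F. Poly_Mapping.single (m - Poly_Mapping.single i 1) (of_nat (Poly_Mapping.lookup m i) * Poly_Mapping.lookup F m))"

text \<open>Forms of degree \<open>d\<close> in the \<open>n + 1\<close> variables \<open>0, \<dots>, n\<close>; the zero polynomial is a form of
  every degree.\<close>

definition is_form :: "nat \<Rightarrow> nat \<Rightarrow> 'k::field mpoly \<Rightarrow> bool" where
  "is_form n d F \<longleftrightarrow> (\<forall>m\<in>Poly_Mapping.keys F. Poly_Mapping.keys m \<subseteq> {..n} \<and> mono_deg m = d)"


section \<open>Projective varieties\<close>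

text \<open>Subsets of the projective space of dimension \<open>n\<close> are given by the set of all homogeneous
  coordinate vectors of their points. The coordinates are indexed by \<open>0, \<dots>, n\<close>, and the entries
  with index greater than \<open>n\<close> are zero. The base field is meant to be algebraically closed.\<close>

definition proj_space :: "nat \<Rightarrow> (nat \<Rightarrow> 'k::field) set" where
  "proj_space n = {v. (\<exists>i. v i \<noteq> 0) \<and> (\<forall>i>n. v i = 0)}"

definition same_point :: "(nat \<Rightarrow> 'k::field) \<Rightarrow> (nat \<Rightarrow> 'k) \<Rightarrow> bool" where
  "same_point v w \<longleftrightarrow> (\<exists>c. c \<noteq> 0 \<and> w = (\<lambda>i. c * v i))"

definition proj_closed :: "nat \<Rightarrow> (nat \<Rightarrow> 'k::field) set \<Rightarrow> bool" where
  "proj_closed n V \<longleftrightarrow>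
     (\<exists>S. (\<forall>F\<in>S. \<exists>d. is_form n d F) \<and> V = {v \<in> proj_space n. \<forall>F\<in>S. peval F v = 0})"

definition projective_variety :: "nat \<Rightarrow> (nat \<Rightarrow> 'k::field) set \<Rightarrow> bool" where
  "projective_variety n V \<longleftrightarrow> proj_closed n V \<and> V \<noteq> {} \<and>
     (\<forall>A B. proj_closed n A \<and> proj_closed n B \<and> V \<subseteq> A \<union> B \<longrightarrow> V \<subseteq> A \<or> V \<subseteq> B)"

definition variety_chain :: "nat \<Rightarrow> (nat \<Rightarrow> 'k::field) set \<Rightarrow> nat \<Rightarrow> bool" where
  "variety_chain n V d \<longleftrightarrow>
     (\<exists>Z. (\<forall>i\<le>d. projective_variety n (Z i) \<and> Z i \<subseteq> V) \<and> (\<forall>i<d. Z i \<subset> Z (Suc i)))"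

definition has_dimension :: "nat \<Rightarrow> (nat \<Rightarrow> 'k::field) set \<Rightarrow> nat \<Rightarrow> bool" where
  "has_dimension n V d \<longleftrightarrow> variety_chain n V d \<and> (\<forall>e. variety_chain n V e \<longrightarrow> e \<le> d)"

definition projective_curve :: "nat \<Rightarrow> (nat \<Rightarrow> 'k::field) set \<Rightarrow> bool" where
  "projective_curve n C \<longleftrightarrow> projective_variety n C \<and> has_dimension n C 1"

text \<open>Jacobian criterion on the affine cone: the tangent space to the cone has one dimension more
  than the projective tangent space, so it is two-dimensional at the nonsingular points of a curve.\<close>

definition cone_tangent :: "nat \<Rightarrow> (nat \<Rightarrow> 'k::field) set \<Rightarrow> (nat \<Rightarrow> 'k) \<Rightarrow> (nat \<Rightarrow> 'k) set" where
  "cone_tangent n V v = {w. (\<forall>i>n. w i = 0) \<and>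
     (\<forall>F d. is_form n d F \<and> (\<forall>u\<in>V. peval F u = 0) \<longrightarrow> (\<Sum>i\<le>n. peval (partial_deriv i F) v * w i) = 0)}"

definition curve_nonsingular_at :: "nat \<Rightarrow> (nat \<Rightarrow> 'k::field) set \<Rightarrow> (nat \<Rightarrow> 'k) \<Rightarrow> bool" where
  "curve_nonsingular_at n C v \<longleftrightarrow>
     vector_space.dim (\<lambda>c w i. c * w i) (cone_tangent n C v) = 2"

definition nonsingular_curve :: "nat \<Rightarrow> (nat \<Rightarrow> 'k::field) set \<Rightarrow> bool" where
  "nonsingular_curve n C \<longleftrightarrow> projective_curve n C \<and> (\<forall>v\<in>C. curve_nonsingular_at n C v)"

definition singular_curve :: "nat \<Rightarrow> (nat \<Rightarrow> 'k::field) set \<Rightarrow> bool" where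
  "singular_curve n C \<longleftrightarrow> projective_curve n C \<and> (\<exists>v\<in>C. \<not> curve_nonsingular_at n C v)"

text \<open>For a nonsingular curve the genus is the arithmetic genus, read off from the Hilbert
  polynomial \<open>D * d + 1 - g\<close>. The degree \<open>d\<close> part of the homogeneous coordinate ring is
  realised as the space of functions that the forms of degree \<open>d\<close> induce on the affine cone.\<close>

definition hilbert_function :: "nat \<Rightarrow> (nat \<Rightarrow> 'k::field) set \<Rightarrow> nat \<Rightarrow> nat" where
  "hilbert_function n V d = vector_space.dim (\<lambda>(c::'k) (f::(nat \<Rightarrow> 'k) \<Rightarrow> 'k) v. c * f v)
     ((\<lambda>F v. if v \<in> V then peval F v else 0) ` {F. is_form n d F})"

definition has_genus :: "nat \<Rightarrow> (nat \<Rightarrow> 'k::field) set \<Rightarrow> nat \<Rightarrow> bool" where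
  "has_genus n C g \<longleftrightarrow>
     (\<exists>D N. \<forall>d\<ge>N. int (hilbert_function n C d) = D * int d + 1 - int g)"


section \<open>Rational maps and morphisms\<close>

text \<open>A rational map is represented by a tuple of forms of a common degree; it is defined by the
  tuple where the forms do not vanish simultaneously.\<close>

definition form_tuple :: "nat \<Rightarrow> nat \<Rightarrow> (nat \<Rightarrow> 'k::field mpoly) \<Rightarrow> bool" where
  "form_tuple n m F \<longleftrightarrow> (\<exists>d. \<forall>i\<le>m. is_form n d (F i))"

definition tuple_eval :: "nat \<Rightarrow> (nat \<Rightarrow> 'k::field mpoly) \<Rightarrow> (nat \<Rightarrow> 'k) \<Rightarrow> (nat \<Rightarrow> 'k)" where
  "tuple_eval m F v = (\<lambda>i. if i \<le> m then peval (F i) v else 0)"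

definition rational_map ::
  "nat \<Rightarrow> (nat \<Rightarrow> 'k::field) set \<Rightarrow> nat \<Rightarrow> (nat \<Rightarrow> 'k) set \<Rightarrow> (nat \<Rightarrow> 'k mpoly) \<Rightarrow> bool" where
  "rational_map n V m W F \<longleftrightarrow> projective_variety n V \<and> projective_variety m W \<and> form_tuple n m F \<and>
     (\<exists>v\<in>V. tuple_eval m F v \<in> proj_space m) \<and>
     (\<forall>v\<in>V. tuple_eval m F v \<in> proj_space m \<longrightarrow> tuple_eval m F v \<in> W)"

text \<open>The composite of \<open>F\<close> with \<open>G\<close> is the identity of \<open>V\<close> as a rational map.\<close>

definition rational_left_inverse ::
  "nat \<Rightarrow> (nat \<Rightarrow> 'k::field) set \<Rightarrow> nat \<Rightarrow> (nat \<Rightarrow> 'k mpoly) \<Rightarrow> (nat \<Rightarrow> 'k mpoly) \<Rightarrow> bool" where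
  "rational_left_inverse n V m F G \<longleftrightarrow>
     (let dom = {v \<in> V. tuple_eval m F v \<in> proj_space m \<and>
                        tuple_eval n G (tuple_eval m F v) \<in> proj_space n}
      in dom \<noteq> {} \<and> (\<forall>v\<in>dom. same_point v (tuple_eval n G (tuple_eval m F v))))"

definition birational_pair ::
  "nat \<Rightarrow> (nat \<Rightarrow> 'k::field) set \<Rightarrow> nat \<Rightarrow> (nat \<Rightarrow> 'k) set \<Rightarrow> (nat \<Rightarrow> 'k mpoly) \<Rightarrow> (nat \<Rightarrow> 'k mpoly) \<Rightarrow> bool"
  where
  "birational_pair n V m W F G \<longleftrightarrow> rational_map n V m W F \<and> rational_map m W n V G \<and>
     rational_left_inverse n V m F G \<and> rational_left_inverse m W n G F"

definition birational :: "nat \<Rightarrow> (nat \<Rightarrow> 'k::field) set \<Rightarrow> nat \<Rightarrow> (nat \<Rightarrow> 'k) set \<Rightarrow> bool" where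
  "birational n V m W \<longleftrightarrow> (\<exists>F G. birational_pair n V m W F G)"

text \<open>\<open>u\<close> represents the value at \<open>v\<close> of the rational map \<open>F\<close>. The value may have to be computed
  with another tuple \<open>F'\<close> that represents the same rational map.\<close>

definition map_value ::
  "nat \<Rightarrow> (nat \<Rightarrow> 'k::field) set \<Rightarrow> nat \<Rightarrow> (nat \<Rightarrow> 'k mpoly) \<Rightarrow> (nat \<Rightarrow> 'k) \<Rightarrow> (nat \<Rightarrow> 'k) \<Rightarrow> bool" where
  "map_value n V m F v u \<longleftrightarrow> (\<exists>F'. form_tuple n m F' \<and>
     (\<forall>w\<in>V. \<forall>i\<le>m. \<forall>j\<le>m. peval (F i) w * peval (F' j) w = peval (F j) w * peval (F' i) w) \<and>
     u = tuple_eval m F' v \<and> u \<in> proj_space m)"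

definition morphism ::
  "nat \<Rightarrow> (nat \<Rightarrow> 'k::field) set \<Rightarrow> nat \<Rightarrow> (nat \<Rightarrow> 'k) set \<Rightarrow> (nat \<Rightarrow> 'k mpoly) \<Rightarrow> bool" where
  "morphism n V m W F \<longleftrightarrow> rational_map n V m W F \<and> (\<forall>v\<in>V. \<exists>u\<in>W. map_value n V m F v u)"

definition isomorphism_pair ::
  "nat \<Rightarrow> (nat \<Rightarrow> 'k::field) set \<Rightarrow> nat \<Rightarrow> (nat \<Rightarrow> 'k) set \<Rightarrow> (nat \<Rightarrow> 'k mpoly) \<Rightarrow> (nat \<Rightarrow> 'k mpoly) \<Rightarrow> bool"
  where
  "isomorphism_pair n V m W F G \<longleftrightarrow>
     morphism n V m W F \<and> morphism m W n V G \<and> birational_pair n V m W F G"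

definition desingularization ::
  "nat \<Rightarrow> (nat \<Rightarrow> 'k::field) set \<Rightarrow> nat \<Rightarrow> (nat \<Rightarrow> 'k) set \<Rightarrow> bool" where
  "desingularization n H m X \<longleftrightarrow> nonsingular_curve n H \<and>
     (\<exists>F G. morphism n H m X F \<and> birational_pair n H m X F G)"


section \<open>Function fields and double covers of the projective line\<close>

definition fractions :: "nat \<Rightarrow> (nat \<Rightarrow> 'k::field) set \<Rightarrow> ('k mpoly \<times> 'k mpoly) set" where
  "fractions n V = {(a, b). (\<exists>d. is_form n d a \<and> is_form n d b) \<and> (\<exists>v\<in>V. peval b v \<noteq> 0)}"

definition fraction_rel ::
  "nat \<Rightarrow> (nat \<Rightarrow> 'k::field) set \<Rightarrow> (('k mpoly \<times> 'k mpoly) \<times> ('k mpoly \<times> 'k mpoly)) set" where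
  "fraction_rel n V = {((a, b), (c, d)). (a, b) \<in> fractions n V \<and> (c, d) \<in> fractions n V \<and>
     (\<forall>v\<in>V. peval a v * peval d v = peval c v * peval b v)}"

definition frac ::
  "nat \<Rightarrow> (nat \<Rightarrow> 'k::field) set \<Rightarrow> 'k mpoly \<Rightarrow> 'k mpoly \<Rightarrow> ('k mpoly \<times> 'k mpoly) set" where
  "frac n V a b = fraction_rel n V `` {(a, b)}"

definition function_field ::
  "nat \<Rightarrow> (nat \<Rightarrow> 'k::field) set \<Rightarrow> ('k mpoly \<times> 'k mpoly) set ring" where
  "function_field n V =
     \<lparr> carrier = fractions n V // fraction_rel n V,
       monoid.mult = (\<lambda>A B. \<Union>(a, b)\<in>A. \<Union>(c, d)\<in>B. frac n V (a * c) (b * d)),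
       one = frac n V 1 1,
       zero = frac n V 0 1,
       add = (\<lambda>A B. \<Union>(a, b)\<in>A. \<Union>(c, d)\<in>B. frac n V (a * d + c * b) (b * d)) \<rparr>"

text \<open>The pullback of the rational function field of the projective line under the map with
  homogeneous components \<open>(\<psi> 0 : \<psi> 1)\<close>, whose affine coordinate is \<open>\<psi> 1 / \<psi> 0\<close>.\<close>

definition pullback_subfield ::
  "nat \<Rightarrow> (nat \<Rightarrow> 'k::field) set \<Rightarrow> (nat \<Rightarrow> 'k mpoly) \<Rightarrow> ('k mpoly \<times> 'k mpoly) set set" where
  "pullback_subfield n V \<psi> = generate_field (function_field n V)
     (insert (frac n V (\<psi> 1) (\<psi> 0)) (range (\<lambda>c. frac n V (mconst c) 1)))"

definition double_cover :: "nat \<Rightarrow> (nat \<Rightarrow> 'k::field) set \<Rightarrow> (nat \<Rightarrow> 'k mpoly) \<Rightarrow> bool" where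
  "double_cover n C \<psi> \<longleftrightarrow> morphism n C 1 (proj_space 1) \<psi> \<and> (\<exists>v\<in>C. peval (\<psi> 0) v \<noteq> 0) \<and>
     ring.dimension (function_field n C) 2 (pullback_subfield n C \<psi>) (carrier (function_field n C))"

definition hyperelliptic_curve ::
  "nat \<Rightarrow> (nat \<Rightarrow> 'k::field) set \<Rightarrow> (nat \<Rightarrow> 'k mpoly) \<Rightarrow> nat \<Rightarrow> bool" where
  "hyperelliptic_curve n C \<psi> g \<longleftrightarrow>
     nonsingular_curve n C \<and> has_genus n C g \<and> 1 \<le> g \<and> double_cover n C \<psi>"

definition is_hyperelliptic :: "nat \<Rightarrow> (nat \<Rightarrow> 'k::field) set \<Rightarrow> bool" where
  "is_hyperelliptic n C \<longleftrightarrow> (\<exists>\<psi> g. hyperelliptic_curve n C \<psi> g)"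


section \<open>Howe curves\<close>

text \<open>Homogeneous coordinates in the Segre embedding; its target has dimension
  \<open>(n1 + 1) * (n2 + 1) - 1 = n1 * n2 + n1 + n2\<close>.\<close>

definition segre :: "nat \<Rightarrow> nat \<Rightarrow> (nat \<Rightarrow> 'k::field) \<Rightarrow> (nat \<Rightarrow> 'k) \<Rightarrow> (nat \<Rightarrow> 'k)" where
  "segre n1 n2 P Q =
     (\<lambda>k. if k < (n1 + 1) * (n2 + 1) then P (k div (n2 + 1)) * Q (k mod (n2 + 1)) else 0)"

definition fiber_product ::
  "nat \<Rightarrow> (nat \<Rightarrow> 'k::field) set \<Rightarrow> (nat \<Rightarrow> 'k mpoly) \<Rightarrow>
   nat \<Rightarrow> (nat \<Rightarrow> 'k) set \<Rightarrow> (nat \<Rightarrow> 'k mpoly) \<Rightarrow> (nat \<Rightarrow> 'k) set" where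
  "fiber_product n1 C1 \<psi>1 n2 C2 \<psi>2 =
     {segre n1 n2 P Q |P Q. P \<in> C1 \<and> Q \<in> C2 \<and>
        (\<exists>u w. map_value n1 C1 1 \<psi>1 P u \<and> map_value n2 C2 1 \<psi>2 Q w \<and> same_point u w)}"

text \<open>\<open>\<psi>2\<close> composed with \<open>F\<close> is \<open>\<psi>1\<close>; by density it suffices to compare where all tuples of forms
  are nonzero.\<close>

definition compatible_with_covers ::
  "(nat \<Rightarrow> 'k::field) set \<Rightarrow> (nat \<Rightarrow> 'k mpoly) \<Rightarrow> nat \<Rightarrow> (nat \<Rightarrow> 'k mpoly) \<Rightarrow> (nat \<Rightarrow> 'k mpoly) \<Rightarrow> bool" where
  "compatible_with_covers C1 \<psi>1 n2 \<psi>2 F \<longleftrightarrow>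
     (\<forall>v\<in>C1. tuple_eval n2 F v \<in> proj_space n2 \<and> tuple_eval 1 \<psi>1 v \<in> proj_space 1 \<and>
              tuple_eval 1 \<psi>2 (tuple_eval n2 F v) \<in> proj_space 1 \<longrightarrow>
            same_point (tuple_eval 1 \<psi>1 v) (tuple_eval 1 \<psi>2 (tuple_eval n2 F v)))"

definition howe_curve ::
  "nat \<Rightarrow> (nat \<Rightarrow> 'k::field) set \<Rightarrow>
   nat \<Rightarrow> (nat \<Rightarrow> 'k) set \<Rightarrow> (nat \<Rightarrow> 'k mpoly) \<Rightarrow> nat \<Rightarrow>
   nat \<Rightarrow> (nat \<Rightarrow> 'k) set \<Rightarrow> (nat \<Rightarrow> 'k mpoly) \<Rightarrow> nat \<Rightarrow> bool" where
  "howe_curve n H n1 C1 \<psi>1 g1 n2 C2 \<psi>2 g2 \<longleftrightarrow>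
     0 < g1 \<and> g1 \<le> g2 \<and>
     hyperelliptic_curve n1 C1 \<psi>1 g1 \<and> hyperelliptic_curve n2 C2 \<psi>2 g2 \<and>
     \<not> (\<exists>F G. isomorphism_pair n1 C1 n2 C2 F G \<and> compatible_with_covers C1 \<psi>1 n2 \<psi>2 F) \<and>
     desingularization n H (n1 * n2 + n1 + n2) (fiber_product n1 C1 \<psi>1 n2 C2 \<psi>2)"


section \<open>The curve \<open>y\<^sup>2 = (x - \<alpha>\<^sub>1)(x - \<alpha>\<^sub>2)(x - \<alpha>\<^sub>3)(x - \<alpha>\<^sub>4)\<close>\<close>

definition esym :: "(nat \<Rightarrow> 'k::comm_ring_1) \<Rightarrow> nat \<Rightarrow> 'k" where
  "esym \<alpha> i = (\<Sum>S | S \<subseteq> {1..4} \<and> card S = i. \<Prod>j\<in>S. \<alpha> j)"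

text \<open>The plane closure of the affine curve is singular at infinity. The model used here is the
  closure in three-dimensional space of the image of the affine curve under
  \<open>(x, y) \<mapsto> (1 : x : x\<^sup>2 : y)\<close>; in characteristic other than 2 it is nonsingular if
  \<open>\<alpha> 1, \<dots>, \<alpha> 4\<close> are distinct, and is the usual model glued from the two charts with coordinates \<open>(x, y)\<close> and \<open>(1/x, y/x\<^sup>2)\<close>.\<close>

definition quartic_curve :: "(nat \<Rightarrow> 'k::field) \<Rightarrow> (nat \<Rightarrow> 'k) set" where
  "quartic_curve \<alpha> = {v \<in> proj_space 3. v 0 * v 2 = v 1 ^ 2 \<and>
     v 3 ^ 2 = v 2 ^ 2 - esym \<alpha> 1 * (v 1 * v 2) + esym \<alpha> 2 * v 1 ^ 2
               - esym \<alpha> 3 * (v 0 * v 1) + esym \<alpha> 4 * v 0 ^ 2}"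

text \<open>The \<open>x\<close>-coordinate \<open>(1 : x)\<close>.\<close>

definition x_map :: "nat \<Rightarrow> 'k::field mpoly" where
  "x_map i = mvar i"

lemma esym_4:
  fixes \<alpha> :: "nat \<Rightarrow> 'k::comm_ring_1"
  shows "esym \<alpha> 1 = \<alpha> 1 + \<alpha> 2 + \<alpha> 3 + \<alpha> 4"
    and "esym \<alpha> 2 = \<alpha> 1 * \<alpha> 2 + \<alpha> 1 * \<alpha> 3 + \<alpha> 1 * \<alpha> 4 + \<alpha> 2 * \<alpha> 3 + \<alpha> 2 * \<alpha> 4 + \<alpha> 3 * \<alpha> 4"
    and "esym \<alpha> 3 = \<alpha> 1 * \<alpha> 2 * \<alpha> 3 + \<alpha> 1 * \<alpha> 2 * \<alpha> 4 + \<alpha> 1 * \<alpha> 3 * \<alpha> 4 + \<alpha> 2 * \<alpha> 3 * \<alpha> 4"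
    and "esym \<alpha> 4 = \<alpha> 1 * \<alpha> 2 * \<alpha> 3 * \<alpha> 4"
proof -
  define E where "E A k = (\<Sum>S | S \<subseteq> A \<and> card S = k. \<Prod>j\<in>S. \<alpha> j)" for A :: "nat set" and k
  have E_0: "E A 0 = 1" if "finite A" for A
  proof -
    have "{S. S \<subseteq> A \<and> card S = 0} = {{}}"
      using that by (auto dest: finite_subset)
    then show ?thesis unfolding E_def by simp
  qed
  have E_empty: "E {} (Suc k) = 0" for k
    unfolding E_def by (intro sum.neutral) auto
  have E_insert: "E (insert x A) (Suc k) = E A (Suc k) + \<alpha> x * E A k" if "finite A" "x \<notin> A" for x A k
  proof -
    let ?B = "\<lambda>k. {S. S \<subseteq> A \<and> card S = k}"
    have fin: "finite S" "x \<notin> S" if "S \<subseteq> A" for S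
      using \<open>finite A\<close> \<open>x \<notin> A\<close> that by (auto dest: finite_subset)
    have fB: "finite (?B k)" for k
      using \<open>finite A\<close> by simp
    have split: "{S. S \<subseteq> insert x A \<and> card S = Suc k} = ?B (Suc k) \<union> insert x ` ?B k"
    proof (intro equalityI subsetI)
      fix S assume S: "S \<in> {S. S \<subseteq> insert x A \<and> card S = Suc k}"
      show "S \<in> ?B (Suc k) \<union> insert x ` ?B k"
      proof (cases "x \<in> S")
        case True
        then have "S = insert x (S - {x})" "S - {x} \<in> ?B k"
          using S by auto
        then show ?thesis by blast
      qed (use S in auto)
    qed (use fin in auto)
    have inj: "inj_on (insert x) (?B k)"
      using fin(2) by (intro inj_onI) (metis (no_types, lifting) insert_ident mem_Collect_eq)
    have "E (insert x A) (Suc k) = E A (Suc k) + (\<Sum>S\<in>insert x ` ?B k. \<Prod>j\<in>S. \<alpha> j)"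
      unfolding E_def split using \<open>x \<notin> A\<close> fB by (intro sum.union_disjoint) auto
    also have "(\<Sum>S\<in>insert x ` ?B k. \<Prod>j\<in>S. \<alpha> j) = (\<Sum>S\<in>?B k. \<alpha> x * (\<Prod>j\<in>S. \<alpha> j))"
      unfolding sum.reindex[OF inj] comp_def using fin by (intro sum.cong) auto
    finally show ?thesis unfolding E_def by (simp add: sum_distrib_left)
  qed
  have esym: "esym \<alpha> k = E {1, 2, 3, 4} k" for k
  proof -
    have "{1..4} = {1, 2, 3, 4 :: nat}" by auto
    then show ?thesis unfolding esym_def E_def by simp
  qed
  note rules = esym E_0 E_empty E_insert eval_nat_numeral algebra_simps
  show "esym \<alpha> 1 = \<alpha> 1 + \<alpha> 2 + \<alpha> 3 + \<alpha> 4"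
    by (simp add: rules)
  show "esym \<alpha> 2 = \<alpha> 1 * \<alpha> 2 + \<alpha> 1 * \<alpha> 3 + \<alpha> 1 * \<alpha> 4 + \<alpha> 2 * \<alpha> 3 + \<alpha> 2 * \<alpha> 4 + \<alpha> 3 * \<alpha> 4"
    by (simp add: rules)
  show "esym \<alpha> 3 = \<alpha> 1 * \<alpha> 2 * \<alpha> 3 + \<alpha> 1 * \<alpha> 2 * \<alpha> 4 + \<alpha> 1 * \<alpha> 3 * \<alpha> 4 + \<alpha> 2 * \<alpha> 3 * \<alpha> 4"
    by (simp add: rules)
  show "esym \<alpha> 4 = \<alpha> 1 * \<alpha> 2 * \<alpha> 3 * \<alpha> 4"
    by (simp add: rules)
qed

lemma affine_part_quartic_curve:
  fixes \<alpha> :: "nat \<Rightarrow> 'k::field"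
  assumes "v \<in> proj_space 3" and "v 0 = 1"
  shows "v \<in> quartic_curve \<alpha> \<longleftrightarrow> v 2 = v 1 ^ 2 \<and> v 3 ^ 2 = (\<Prod>i=1..4. v 1 - \<alpha> i)"
proof -
  have A: "{1..4} = {1, 2, 3, 4 :: nat}" by auto
  show ?thesis
    unfolding quartic_curve_def A using assms
    by (auto simp: esym_4[unfolded One_nat_def] algebra_simps power2_eq_square)
qed


section \<open>Plane curves and the sextic\<close>

text \<open>A bivariate polynomial in \<open>x\<close> and \<open>y\<close> is a polynomial in \<open>y\<close> over the polynomials in \<open>x\<close>.\<close>

definition bimonom :: "'k::field \<Rightarrow> nat \<Rightarrow> nat \<Rightarrow> 'k poly poly" where
  "bimonom c i j = Polynomial.monom (Polynomial.monom c i) j"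

definition total_degree :: "'k::field poly poly \<Rightarrow> nat" where
  "total_degree f = Max {i + j |i j. poly.coeff (poly.coeff f j) i \<noteq> 0}"

text \<open>Homogenization with the variables \<open>0\<close> for the homogenizing variable, \<open>1\<close> for \<open>x\<close> and \<open>2\<close> for \<open>y\<close>.\<close>

definition homogenization :: "'k::field poly poly \<Rightarrow> 'k mpoly" where
  "homogenization f = (\<Sum>j\<le>Polynomial.degree f. \<Sum>i\<le>Polynomial.degree (poly.coeff f j).
     mconst (poly.coeff (poly.coeff f j) i) * mvar 0 ^ (total_degree f - (i + j)) * mvar 1 ^ i * mvar 2 ^ j)"

definition plane_curve :: "'k::field poly poly \<Rightarrow> (nat \<Rightarrow> 'k) set" where
  "plane_curve f = {v \<in> proj_space 2. peval (homogenization f) v = 0}"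

definition howe_coeffs :: "(nat \<Rightarrow> 'k::field) \<Rightarrow> (nat \<Rightarrow> 'k) \<Rightarrow> ((nat \<times> nat) \<times> 'k) list" where
  "howe_coeffs \<alpha> \<beta> = (let \<sigma> = esym \<alpha>; \<tau> = esym \<beta> in
    [((6, 0), (\<sigma> 1 - \<tau> 1) ^ 2),
     ((4, 2), - 4),
     ((5, 0), - 2 * (\<sigma> 1 - \<tau> 1) * (\<sigma> 2 - \<tau> 2)),
     ((3, 2), 2 * (\<sigma> 1 + \<tau> 1)),
     ((4, 0), 2 * (\<sigma> 1 - \<tau> 1) * (\<sigma> 3 - \<tau> 3) + (\<sigma> 2 - \<tau> 2) ^ 2),
     ((2, 2), - 2 * (\<sigma> 2 + \<tau> 2)),
     ((0, 4), 1),
     ((3, 0), - 2 * (\<sigma> 1 - \<tau> 1) * (\<sigma> 4 - \<tau> 4) - 2 * (\<sigma> 2 - \<tau> 2) * (\<sigma> 3 - \<tau> 3)),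
     ((1, 2), 2 * (\<sigma> 3 + \<tau> 3)),
     ((2, 0), (\<sigma> 3 - \<tau> 3) ^ 2 + 2 * (\<sigma> 4 - \<tau> 4) * (\<sigma> 2 - \<tau> 2)),
     ((0, 2), - 2 * (\<sigma> 4 + \<tau> 4)),
     ((1, 0), - 2 * (\<sigma> 4 - \<tau> 4) * (\<sigma> 3 - \<tau> 3)),
     ((0, 0), (\<sigma> 4 - \<tau> 4) ^ 2)])"

definition howe_sextic :: "(nat \<Rightarrow> 'k::field) \<Rightarrow> (nat \<Rightarrow> 'k) \<Rightarrow> 'k poly poly" where
  "howe_sextic \<alpha> \<beta> = (\<Sum>((i, j), c)\<leftarrow>howe_coeffs \<alpha> \<beta>. bimonom c i j)"

lemma howe_sextic_eval:
  fixes \<alpha> \<beta> :: "nat \<Rightarrow> 'k::field" and x y :: 'k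
  defines "p \<equiv> \<Prod>i=1..4. x - \<alpha> i" and "q \<equiv> \<Prod>i=1..4. x - \<beta> i"
  shows "poly (poly (howe_sextic \<alpha> \<beta>) [:y:]) x = y ^ 4 - 2 * (p + q) * y ^ 2 + (p - q) ^ 2"
proof -
  have A: "{1..4} = {1, 2, 3, 4 :: nat}" by auto
  define s t where "s = esym \<alpha>" and "t = esym \<beta>"
  have p: "p = x ^ 4 - s 1 * x ^ 3 + s 2 * x ^ 2 - s 3 * x + s 4"
    unfolding p_def A s_def esym_4 by (simp add: algebra_simps power_numeral_reduce)
  have q: "q = x ^ 4 - t 1 * x ^ 3 + t 2 * x ^ 2 - t 3 * x + t 4"
    unfolding q_def A t_def esym_4 by (simp add: algebra_simps power_numeral_reduce)
  have ev: "poly (poly (bimonom c i j) [:y:]) x = c * x ^ i * y ^ j" for c :: 'k and i j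
    by (simp add: bimonom_def poly_monom)
  show ?thesis
    unfolding howe_sextic_def howe_coeffs_def s_def[symmetric] t_def[symmetric] Let_def p q
    by (simp add: ev algebra_simps power_numeral_reduce)
qed


section \<open>Straight-line programs\<close>

text \<open>An instruction appends one value to the list of registers. The operands are register indices.
  Execution fails on an invalid index and on division by zero. Every instruction, including the
  creation of a constant, counts as one operation, so the cost of a program is its length.\<close>

datatype arith_instr =
  Zero | One | Add nat nat | Sub nat nat | Mul nat nat | Div nat nat

fun exec_instr :: "arith_instr \<Rightarrow> 'k::field list \<Rightarrow> 'k option" where
  "exec_instr Zero rs = Some 0"
| "exec_instr One rs = Some 1"
| "exec_instr (Add i j) rs = (if i < length rs \<and> j < length rs then Some (rs ! i + rs ! j) else None)"
| "exec_instr (Sub i j) rs = (if i < length rs \<and> j < length rs then Some (rs ! i - rs ! j) else None)"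
| "exec_instr (Mul i j) rs = (if i < length rs \<and> j < length rs then Some (rs ! i * rs ! j) else None)"
| "exec_instr (Div i j) rs =
     (if i < length rs \<and> j < length rs \<and> rs ! j \<noteq> 0 then Some (rs ! i / rs ! j) else None)"

fun exec_program :: "arith_instr list \<Rightarrow> 'k::field list \<Rightarrow> 'k list option" where
  "exec_program [] rs = Some rs"
| "exec_program (a # as) rs =
     (case exec_instr a rs of None \<Rightarrow> None | Some r \<Rightarrow> exec_program as (rs @ [r]))"

definition is_subfield :: "'k::field set \<Rightarrow> bool" where
  "is_subfield F \<longleftrightarrow> 0 \<in> F \<and> 1 \<in> F \<and> (\<forall>a\<in>F. \<forall>b\<in>F. a + b \<in> F \<and> a - b \<in> F \<and> a * b \<in> F \<and> a / b \<in> F)"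

text \<open>Started with \<open>ins\<close>, the program takes place entirely in \<open>F\<close> and leaves the values \<open>vals\<close> in the
  registers listed in \<open>outs\<close>.\<close>

definition computes_in ::
  "'k::field set \<Rightarrow> arith_instr list \<Rightarrow> 'k list \<Rightarrow> nat list \<Rightarrow> 'k list \<Rightarrow> bool" where
  "computes_in F prog ins outs vals \<longleftrightarrow> (\<exists>rs. exec_program prog ins = Some rs \<and> set rs \<subseteq> F \<and>
     (\<forall>r\<in>set outs. r < length rs) \<and> map (\<lambda>r. rs ! r) outs = vals)"

end

theory Submission
  imports Defs
begin

text \<open>Let \<open>\<phi>\<^sub>1, \<phi>\<^sub>2\<close> be the two quartics. On the fiber product \<open>a\<^sup>2 = \<phi>\<^sub>1(x)\<close>, \<open>b\<^sup>2 = \<phi>\<^sub>2(x)\<close> the function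
  \<open>y = a + b\<close> satisfies \<open>f(x, y) = 0\<close>, since the roots of \<open>f(x, -)\<close> are the four numbers
  \<open>\<plusminus>a \<plusminus> b\<close>, and \<open>a, b = (y\<^sup>2 \<plusminus> (\<phi>\<^sub>1 - \<phi>\<^sub>2)) / 2y\<close> gives the inverse map.

  As \<open>H\<close> is birational to the fiber product, the latter is irreducible. For infinitely many \<open>x\<close> the
  four roots are distinct and \<open>f\<close> is monic in \<open>y\<close>, so a polynomial vanishing on the affine sextic is a
  multiple of \<open>f\<close>. Hence irreducibility of the fiber product, which projects onto the affine
  sextic, makes \<open>f\<close> a prime element, and from this follow irreducibility and dimension of the plane
  curve. A form vanishing on the curve is \<open>f\<close> times a form, so it has multiplicity at least 2 at
  \<open>(0 : 0 : 1)\<close>: the degree of \<open>f\<close> in \<open>y\<close> is only 4.\<close>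

section \<open>Functions given by forms\<close>

text \<open>Irreducibility is given for a subset of 15-dimensional projective space, whereas
  divisibility by \<open>f\<close> concerns the affine plane. The bridge is the pullback of a
  homogenized polynomial along \<open>plane_projection\<close>, multiplied by the coordinate
  \<open>z 0\<close>: this factor makes the points over infinity impose no condition, so that only
  pairs of square roots enter. Irreducibility also yields
  \<open>\<phi>\<^sub>1 \<noteq> \<phi>\<^sub>2\<close>, since otherwise the fiber product would
  split into \<open>b = a\<close> and \<open>b = - a\<close>; this inequality makes the four roots
  distinct for almost all x and \<open>y = a + b\<close> nonzero somewhere. The degree 6 arises
  because both quartics are monic: their difference has degree at most 3, so its square has degree
  at most 6, while \<open>x\<^sup>4 y\<^sup>2\<close> always occurs with coefficient -4, nonzero in
  characteristic other than 2. A further obstacle is that a rational map is a bare tuple of forms: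
  composing such maps requires points at which all forms involved are nonzero, and these come from
  the irreducibility of the variety in the middle.\<close>

definition mono_eval :: "(nat \<Rightarrow> 'k::field) \<Rightarrow> (nat \<Rightarrow>\<^sub>0 nat) \<Rightarrow> 'k" where
  "mono_eval v m = (\<Prod>i\<in>Poly_Mapping.keys m. v i ^ Poly_Mapping.lookup m i)"

lemma mono_eval_superset:
  assumes "finite A" "Poly_Mapping.keys m \<subseteq> A"
  shows "mono_eval v m = (\<Prod>i\<in>A. v i ^ Poly_Mapping.lookup m i)"
  unfolding mono_eval_def using assms by (intro prod.mono_neutral_left) (auto simp: in_keys_iff)

lemma mono_deg_superset:
  assumes "finite A" "Poly_Mapping.keys m \<subseteq> A"
  shows "mono_deg m = (\<Sum>i\<in>A. Poly_Mapping.lookup m i)"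
  unfolding mono_deg_def using assms by (intro sum.mono_neutral_left) (auto simp: in_keys_iff)

lemma mono_eval_add: "mono_eval v (a + b) = mono_eval v a * mono_eval v b"
proof -
  let ?A = "Poly_Mapping.keys a \<union> Poly_Mapping.keys b"
  have "Poly_Mapping.keys (a + b) \<subseteq> ?A" by (rule keys_add)
  then show ?thesis
    by (simp add: mono_eval_superset[of ?A] lookup_add power_add prod.distrib)
qed

lemma mono_deg_add: "mono_deg (a + b) = mono_deg a + mono_deg b"
proof -
  let ?A = "Poly_Mapping.keys a \<union> Poly_Mapping.keys b"
  have "Poly_Mapping.keys (a + b) \<subseteq> ?A" by (rule keys_add)
  then show ?thesis
    by (simp add: mono_deg_superset[of ?A] lookup_add sum.distrib)
qed

lemma peval_superset:
  assumes "finite A" "Poly_Mapping.keys F \<subseteq> A"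
  shows "peval F v = (\<Sum>m\<in>A. Poly_Mapping.lookup F m * mono_eval v m)"
  unfolding peval_def mono_eval_def using assms
  by (intro sum.mono_neutral_left) (auto simp: in_keys_iff)

lemma peval_altdef: "peval F v = (\<Sum>m\<in>Poly_Mapping.keys F. Poly_Mapping.lookup F m * mono_eval v m)"
  by (rule peval_superset) auto

lemma peval_single [simp]: "peval (Poly_Mapping.single m c) v = c * mono_eval v m"
  by (subst peval_superset[of "{m}"]) auto

lemma peval_0 [simp]: "peval 0 v = 0"
  by (simp add: peval_def)

lemma peval_add: "peval (F + G) v = peval F v + peval G v"
proof -
  let ?A = "Poly_Mapping.keys F \<union> Poly_Mapping.keys G"
  have "Poly_Mapping.keys (F + G) \<subseteq> ?A" by (rule keys_add)
  then show ?thesis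
    by (simp add: peval_superset[of ?A] lookup_add algebra_simps sum.distrib)
qed

lemma peval_sum: "peval (sum F A) v = (\<Sum>x\<in>A. peval (F x) v)"
  by (induction A rule: infinite_finite_induct) (auto simp: peval_add)

lemma poly_mapping_eq_sum_single:
  "F = (\<Sum>m\<in>Poly_Mapping.keys F. Poly_Mapping.single m (Poly_Mapping.lookup F m))"
  by (rule poly_mapping_eqI)
     (auto simp: lookup_sum lookup_single when_def in_keys_iff)

lemma peval_mult: "peval (F * G) v = peval F v * peval G v"
proof -
  let ?s = "\<lambda>F m. Poly_Mapping.single m (Poly_Mapping.lookup F m)"
  have "F * G = (\<Sum>a\<in>Poly_Mapping.keys F. ?s F a) * (\<Sum>b\<in>Poly_Mapping.keys G. ?s G b)"
    using poly_mapping_eq_sum_single[of F] poly_mapping_eq_sum_single[of G] by metis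
  also have "\<dots> = (\<Sum>a\<in>Poly_Mapping.keys F. \<Sum>b\<in>Poly_Mapping.keys G. Poly_Mapping.single (a + b)
       (Poly_Mapping.lookup F a * Poly_Mapping.lookup G b))"
    by (simp add: sum_product mult_single)
  finally have "peval (F * G) v = (\<Sum>a\<in>Poly_Mapping.keys F. \<Sum>b\<in>Poly_Mapping.keys G.
       Poly_Mapping.lookup F a * Poly_Mapping.lookup G b * (mono_eval v a * mono_eval v b))"
    by (simp add: peval_sum mono_eval_add)
  then show ?thesis
    unfolding peval_altdef[of F] peval_altdef[of G] by (simp add: sum_product mult_ac)
qed

lemma mono_eval_0 [simp]: "mono_eval v 0 = 1"
  by (simp add: mono_eval_def)

lemma mono_eval_single [simp]: "mono_eval v (Poly_Mapping.single i n) = v i ^ n"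
  by (subst mono_eval_superset[of "{i}"]) auto

lemma mono_deg_single [simp]: "mono_deg (Poly_Mapping.single i n) = n"
  by (subst mono_deg_superset[of "{i}"]) auto

lemma peval_mconst [simp]: "peval (mconst c) v = c"
  by (simp add: mconst_def)

lemma peval_mvar [simp]: "peval (mvar i) v = v i"
  by (simp add: mvar_def)

lemma peval_1 [simp]: "peval 1 v = 1"
  using peval_mconst[of 1 v] by (simp add: mconst_def)

lemma peval_power: "peval (F ^ n) v = peval F v ^ n"
  by (induction n) (auto simp: peval_mult)

lemma is_form_mult:
  assumes "is_form n d F" "is_form n e G"
  shows "is_form n (d + e) (F * G)"
  unfolding is_form_def
proof
  fix m assume "m \<in> Poly_Mapping.keys (F * G)"
  then obtain a b where ab: "m = a + b" "a \<in> Poly_Mapping.keys F" "b \<in> Poly_Mapping.keys G"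
    using keys_mult[of F G] by auto
  have "Poly_Mapping.keys (a + b) \<subseteq> Poly_Mapping.keys a \<union> Poly_Mapping.keys b"
    by (rule keys_add)
  then show "Poly_Mapping.keys m \<subseteq> {..n} \<and> mono_deg m = d + e"
    using ab assms unfolding is_form_def by (auto simp: mono_deg_add)
qed

lemma is_form_add:
  assumes "is_form n d F" "is_form n d G"
  shows "is_form n d (F + G)"
  using assms keys_add[of F G] unfolding is_form_def by blast

text \<open>Forms are handled from here on through the functions they induce: closure rules for
  functions replace computations with \<open>mpoly\<close>. The degree is an annotation that need
  not be unique, since the zero function has every degree.\<close>

definition form_function :: "nat \<Rightarrow> nat \<Rightarrow> ((nat \<Rightarrow> 'k::field) \<Rightarrow> 'k) \<Rightarrow> bool" where
  "form_function n d \<phi> \<longleftrightarrow> (\<exists>F. is_form n d F \<and> \<phi> = peval F)"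

lemma form_functionI: "is_form n d F \<Longrightarrow> form_function n d (peval F)"
  unfolding form_function_def by blast

lemma form_function_const: "form_function n 0 (\<lambda>v. c)"
  unfolding form_function_def
  by (intro exI[of _ "mconst c"]) (auto simp: is_form_def mconst_def mono_deg_def split: if_splits)

lemma form_function_zero: "form_function n d (\<lambda>v. 0)"
  unfolding form_function_def by (intro exI[of _ 0]) (auto simp: is_form_def)

lemma form_function_var: "i \<le> n \<Longrightarrow> form_function n 1 (\<lambda>v. v i)"
  unfolding form_function_def
  by (intro exI[of _ "mvar i"]) (auto simp: is_form_def mvar_def split: if_splits)

lemma form_function_add:
  "form_function n d \<phi> \<Longrightarrow> form_function n d \<psi> \<Longrightarrow> form_function n d (\<lambda>v. \<phi> v + \<psi> v)"
proof -
  assume "form_function n d \<phi>" "form_function n d \<psi>"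
  then obtain F G where "is_form n d F" "\<phi> = peval F" "is_form n d G" "\<psi> = peval G"
    unfolding form_function_def by blast
  then show ?thesis
    unfolding form_function_def by (intro exI[of _ "F + G"]) (simp add: fun_eq_iff is_form_add peval_add)
qed

lemma form_function_mult:
  "form_function n d \<phi> \<Longrightarrow> form_function n e \<psi> \<Longrightarrow> form_function n (d + e) (\<lambda>v. \<phi> v * \<psi> v)"
proof -
  assume "form_function n d \<phi>" "form_function n e \<psi>"
  then obtain F G where "is_form n d F" "\<phi> = peval F" "is_form n e G" "\<psi> = peval G"
    unfolding form_function_def by blast
  then show ?thesis
    unfolding form_function_def by (intro exI[of _ "F * G"]) (simp add: fun_eq_iff is_form_mult peval_mult)
qed

lemma form_function_cmult:
  "form_function n d \<phi> \<Longrightarrow> form_function n d (\<lambda>v. c * \<phi> v)"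
  using form_function_mult[OF form_function_const[of n c]] by auto

lemma form_function_diff:
  assumes "form_function n d \<phi>" "form_function n d \<psi>"
  shows "form_function n d (\<lambda>v. \<phi> v - \<psi> v)"
  using form_function_add[OF assms(1) form_function_cmult[OF assms(2), of "-1"]] by simp

lemma form_function_sum:
  "(\<And>x. x \<in> A \<Longrightarrow> form_function n d (f x)) \<Longrightarrow> form_function n d (\<lambda>v. \<Sum>x\<in>A. f x v)"
  by (induction A rule: infinite_finite_induct) (auto simp: form_function_zero form_function_add)

lemma form_function_prod:
  "finite A \<Longrightarrow> (\<And>x. x \<in> A \<Longrightarrow> form_function n (e x) (f x)) \<Longrightarrow>
    form_function n (sum e A) (\<lambda>v. \<Prod>x\<in>A. f x v)"
  by (induction A rule: finite_induct) (auto simp: form_function_const form_function_mult)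

lemma form_function_power:
  "form_function n d \<phi> \<Longrightarrow> form_function n (k * d) (\<lambda>v. \<phi> v ^ k)"
  by (induction k) (auto simp: form_function_const form_function_mult)

text \<open>Each monomial of degree \<open>d\<close> becomes a product of \<open>d\<close> forms of
  degree \<open>e\<close>. This serves for pullbacks along the projection and for composing rational
  maps.\<close>

lemma form_function_compose:
  assumes \<phi>: "form_function m d \<phi>" and T: "\<And>i. i \<le> m \<Longrightarrow> form_function n e (\<lambda>v. T v i)"
  shows "form_function n (d * e) (\<lambda>v. \<phi> (T v))"
proof -
  obtain F where F: "is_form m d F" "\<phi> = peval F"
    using \<phi> unfolding form_function_def by blast
  have "form_function n (d * e) (\<lambda>v. Poly_Mapping.lookup F a * mono_eval (T v) a)"
    if "a \<in> Poly_Mapping.keys F" for a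
  proof -
    have *: "Poly_Mapping.keys a \<subseteq> {..m}" "mono_deg a = d"
      using F that by (auto simp: is_form_def)
    have "form_function n (\<Sum>i\<in>Poly_Mapping.keys a. Poly_Mapping.lookup a i * e)
            (\<lambda>v. \<Prod>i\<in>Poly_Mapping.keys a. T v i ^ Poly_Mapping.lookup a i)"
      using * by (intro form_function_prod form_function_power T) auto
    moreover have "(\<Sum>i\<in>Poly_Mapping.keys a. Poly_Mapping.lookup a i * e) = d * e"
      using * by (simp add: mono_deg_def flip: sum_distrib_right)
    ultimately show ?thesis
      by (simp add: form_function_cmult mono_eval_def)
  qed
  then show ?thesis
    unfolding F peval_altdef by (intro form_function_sum)
qed

lemma form_function_scale:
  assumes "form_function n d \<phi>"
  shows "\<phi> (\<lambda>i. c * v i) = c ^ d * \<phi> v"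
proof -
  obtain F where F: "is_form n d F" "\<phi> = peval F"
    using assms unfolding form_function_def by blast
  have "mono_eval (\<lambda>i. c * v i) m = c ^ d * mono_eval v m" if "m \<in> Poly_Mapping.keys F" for m
    using F that unfolding mono_eval_def is_form_def
    by (auto simp: power_mult_distrib prod.distrib mono_deg_def power_sum)
  then show ?thesis
    unfolding F peval_altdef by (simp add: sum_distrib_left mult_ac)
qed

section \<open>Closed sets and irreducibility\<close>

lemma proj_closed_zeros:
  assumes "form_function n d \<phi>"
  shows "proj_closed n {v \<in> proj_space n. \<phi> v = 0}"
proof -
  obtain F where "is_form n d F" "\<phi> = peval F"
    using assms unfolding form_function_def by blast
  then show ?thesis
    unfolding proj_closed_def by (intro exI[of _ "{F}"]) auto
qed

text \<open>A closed set may be cut out by an arbitrary family of forms, but a point off it is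
  already detected by one member.\<close>

lemma proj_closed_form:
  assumes "proj_closed n A" "v \<in> proj_space n" "v \<notin> A"
  obtains d \<phi> where "form_function n d \<phi>" "\<And>u. u \<in> A \<Longrightarrow> \<phi> u = 0" "\<phi> v \<noteq> 0"
proof -
  obtain S where S: "\<forall>F\<in>S. \<exists>d. is_form n d F" "A = {v \<in> proj_space n. \<forall>F\<in>S. peval F v = 0}"
    using assms(1) unfolding proj_closed_def by blast
  then obtain F where "F \<in> S" "peval F v \<noteq> 0"
    using assms by blast
  moreover from this S obtain d where "is_form n d F" by blast
  ultimately show ?thesis
    using that[of d "peval F"] S form_functionI by blast
qed

lemma proj_closed_subset: "proj_closed n A \<Longrightarrow> A \<subseteq> proj_space n"
  by (auto simp: proj_closed_def)

lemma projective_variety_closed: "projective_variety n V \<Longrightarrow> proj_closed n V"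
  by (simp add: projective_variety_def)

lemma projective_variety_subset: "projective_variety n V \<Longrightarrow> V \<subseteq> proj_space n"
  by (simp add: projective_variety_def proj_closed_subset)

text \<open>The zero sets of the two forms are closed and together cover \<open>V\<close>. In
  algebraic terms, the homogeneous ideal of \<open>V\<close> is prime.\<close>

lemma projective_variety_mult_eq_0:
  assumes "projective_variety n V" "form_function n d \<phi>" "form_function n e \<psi>"
    and "\<And>v. v \<in> V \<Longrightarrow> \<phi> v * \<psi> v = 0"
  shows "(\<forall>v\<in>V. \<phi> v = 0) \<or> (\<forall>v\<in>V. \<psi> v = 0)"
proof -
  have "V \<subseteq> {v \<in> proj_space n. \<phi> v = 0} \<union> {v \<in> proj_space n. \<psi> v = 0}"
    using assms(4) projective_variety_subset[OF assms(1)] by auto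
  then show ?thesis
    using assms(1) proj_closed_zeros[OF assms(2)] proj_closed_zeros[OF assms(3)]
    unfolding projective_variety_def by blast
qed

lemma projective_variety_nonzero:
  assumes "projective_variety n V" "form_function n d \<phi>" "form_function n e \<psi>"
    and "v \<in> V" "\<phi> v \<noteq> 0" "w \<in> V" "\<psi> w \<noteq> 0"
  shows "\<exists>u\<in>V. \<phi> u \<noteq> 0 \<and> \<psi> u \<noteq> 0"
  using projective_variety_mult_eq_0[OF assms(1-3)] assms(4-) by auto

text \<open>Converse of \<open>projective_variety_mult_eq_0\<close>: if neither closed set contained
  \<open>V\<close>, forms separating a point of \<open>V\<close> from each of them would have a
  product vanishing on \<open>V\<close>, though neither vanishes there.\<close>

lemma projective_varietyI:
  assumes "proj_closed n V" "V \<noteq> {}"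
    and "\<And>d e \<phi> \<psi>. form_function n d \<phi> \<Longrightarrow> form_function n e \<psi> \<Longrightarrow>
           (\<And>v. v \<in> V \<Longrightarrow> \<phi> v * \<psi> v = 0) \<Longrightarrow> (\<forall>v\<in>V. \<phi> v = 0) \<or> (\<forall>v\<in>V. \<psi> v = 0)"
  shows "projective_variety n V"
  unfolding projective_variety_def
proof (intro conjI allI impI)
  fix A B assume AB: "proj_closed n A \<and> proj_closed n B \<and> V \<subseteq> A \<union> B"
  have sub: "V \<subseteq> proj_space n" using assms(1) by (rule proj_closed_subset)
  show "V \<subseteq> A \<or> V \<subseteq> B"
  proof (rule ccontr)
    assume "\<not> (V \<subseteq> A \<or> V \<subseteq> B)"
    then obtain a b where ab: "a \<in> V" "a \<notin> A" "b \<in> V" "b \<notin> B" by blast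
    obtain d \<phi> where \<phi>: "form_function n d \<phi>" "\<And>u. u \<in> A \<Longrightarrow> \<phi> u = 0" "\<phi> a \<noteq> 0"
      using proj_closed_form[of n A a] AB ab sub by blast
    obtain e \<psi> where \<psi>: "form_function n e \<psi>" "\<And>u. u \<in> B \<Longrightarrow> \<psi> u = 0" "\<psi> b \<noteq> 0"
      using proj_closed_form[of n B b] AB ab sub by blast
    show False
      using assms(3)[OF \<phi>(1) \<psi>(1)] AB ab \<phi> \<psi> by fastforce
  qed
qed (use assms in auto)

lemma proj_closed_scale:
  assumes "proj_closed n A" "v \<in> A" "c \<noteq> 0"
  shows "(\<lambda>i. c * v i) \<in> A"
proof (rule ccontr)
  assume "(\<lambda>i. c * v i) \<notin> A"
  moreover have "(\<lambda>i. c * v i) \<in> proj_space n"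
    using proj_closed_subset[OF assms(1)] assms by (auto simp: proj_space_def)
  ultimately obtain d \<phi> where "form_function n d \<phi>" "\<And>u. u \<in> A \<Longrightarrow> \<phi> u = 0" "\<phi> (\<lambda>i. c * v i) \<noteq> 0"
    using proj_closed_form[OF assms(1)] by metis
  then show False
    using form_function_scale assms by fastforce
qed

lemma proj_closed_Un:
  assumes "proj_closed n A" "proj_closed n B"
  shows "proj_closed n (A \<union> B)"
proof -
  obtain S where S: "\<forall>F\<in>S. \<exists>d. is_form n d F" "A = {v \<in> proj_space n. \<forall>F\<in>S. peval F v = 0}"
    using assms(1) unfolding proj_closed_def by blast
  obtain T where T: "\<forall>F\<in>T. \<exists>d. is_form n d F" "B = {v \<in> proj_space n. \<forall>F\<in>T. peval F v = 0}"
    using assms(2) unfolding proj_closed_def by blast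
  let ?U = "{F * G |F G. F \<in> S \<and> G \<in> T}"
  have "\<forall>F\<in>?U. \<exists>d. is_form n d F"
    using S(1) T(1) is_form_mult by fast
  moreover have "A \<union> B = {v \<in> proj_space n. \<forall>F\<in>?U. peval F v = 0}" (is "_ = ?R")
  proof (intro equalityI subsetI)
    fix v assume "v \<in> A \<union> B"
    then show "v \<in> ?R" unfolding S T by (auto simp: peval_mult)
  next
    fix v assume v: "v \<in> ?R"
    show "v \<in> A \<union> B"
    proof (rule ccontr)
      assume "v \<notin> A \<union> B"
      with v S T obtain F G where "F \<in> S" "peval F v \<noteq> 0" "G \<in> T" "peval G v \<noteq> 0" by blast
      with v have "peval (F * G) v = 0" by blast
      then show False using \<open>peval F v \<noteq> 0\<close> \<open>peval G v \<noteq> 0\<close> by (simp add: peval_mult)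
    qed
  qed
  ultimately show ?thesis
    unfolding proj_closed_def by blast
qed

lemma projective_variety_subset_Union:
  assumes "projective_variety n V" "finite \<A>" "\<And>A. A \<in> \<A> \<Longrightarrow> proj_closed n A" "V \<subseteq> \<Union>\<A>"
  shows "\<exists>A\<in>\<A>. V \<subseteq> A"
proof -
  \<comment> \<open>Base of the finite union below: the zero set of the constant form 1.\<close>
  have empty: "proj_closed n ({} :: (nat \<Rightarrow> 'a) set)"
    using proj_closed_zeros[OF form_function_const[of n 1]] by simp
  have cl: "proj_closed n (\<Union>\<B>)" if "finite \<B>" "\<And>A. A \<in> \<B> \<Longrightarrow> proj_closed n A"
    for \<B> :: "(nat \<Rightarrow> 'a) set set"
    using that by (induction \<B> rule: finite_induct) (auto simp: empty proj_closed_Un)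
  show ?thesis
    using assms(2-4)
  proof (induction \<A> rule: finite_induct)
    case empty
    then show ?case using assms(1) by (auto simp: projective_variety_def)
  next
    case (insert A \<A>)
    have "proj_closed n A" "proj_closed n (\<Union>\<A>)" "V \<subseteq> A \<union> \<Union>\<A>"
      using insert cl[of \<A>] by auto
    then have "V \<subseteq> A \<or> V \<subseteq> \<Union>\<A>"
      using assms(1) unfolding projective_variety_def by blast
    then show ?case
      using insert by auto
  qed
qed

section \<open>Points as the smallest closed sets\<close>

definition point_of :: "(nat \<Rightarrow> 'k::field) \<Rightarrow> (nat \<Rightarrow> 'k) set" where
  "point_of p = {v. same_point p v}"

text \<open>The equations are the 2 x 2 minors of the matrix with rows \<open>p\<close> and
  \<open>v\<close>; together they express proportionality.\<close>

lemma proj_closed_point: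
  assumes "p \<in> proj_space n"
  shows "proj_closed n (point_of p)"
proof -
  let ?F = "\<lambda>i j. mconst (p j) * mvar i + mconst (- p i) * mvar j"
  let ?S = "{?F i j |i j. i \<le> n \<and> j \<le> n}"
  have form: "is_form n 1 (?F i j)" if "i \<le> n" "j \<le> n" for i j
  proof -
    have "is_form n 1 (mvar k :: 'a mpoly)" if "k \<le> n" for k
      using that by (auto simp: is_form_def mvar_def split: if_splits)
    moreover have "is_form n 0 (mconst c :: 'a mpoly)" for c
      by (auto simp: is_form_def mconst_def mono_deg_def split: if_splits)
    ultimately show ?thesis
      using that is_form_mult[of n 0 "mconst (p j)" 1 "mvar i"]
        is_form_mult[of n 0 "mconst (- p i)" 1 "mvar j"] by (intro is_form_add) simp_all
  qed
  have "point_of p = {v \<in> proj_space n. \<forall>F\<in>?S. peval F v = 0}" (is "_ = ?R")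
  proof (intro equalityI subsetI)
    fix v assume "v \<in> point_of p"
    then obtain c where "c \<noteq> 0" "v = (\<lambda>i. c * p i)" by (auto simp: point_of_def same_point_def)
    then show "v \<in> ?R"
      using assms by (auto simp: proj_space_def peval_add peval_mult)
  next
    fix v assume v: "v \<in> ?R"
    have eq: "p j * v i = p i * v j" if "i \<le> n" "j \<le> n" for i j
    proof -
      have "?F i j \<in> ?S" using that by blast
      with v have "peval (?F i j) v = 0" by blast
      then show ?thesis by (simp add: peval_add peval_mult)
    qed
    from assms obtain j where j: "p j \<noteq> 0" "j \<le> n"
      by (auto simp: proj_space_def) (meson linorder_not_le)
    have veq: "v i = (v j / p j) * p i" for i
    proof (cases "i \<le> n")
      case True
      then have "p j * v i = p i * v j" using eq j by blast
      then show ?thesis using j(1) by (metis mult.commute nonzero_eq_divide_eq times_divide_eq_left)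
    next
      case False
      then show ?thesis using v assms by (auto simp: proj_space_def)
    qed
    moreover have "v j / p j \<noteq> 0"
    proof
      assume "v j / p j = 0"
      then have "v i = 0" for i using veq[of i] by (metis mult_zero_left)
      then show False using v by (auto simp: proj_space_def)
    qed
    ultimately show "v \<in> point_of p"
      unfolding point_of_def same_point_def by blast
  qed
  moreover have "\<forall>F\<in>?S. \<exists>d. is_form n d F" using form by blast
  ultimately show ?thesis unfolding proj_closed_def by blast
qed

lemma projective_variety_point:
  assumes "p \<in> proj_space n"
  shows "projective_variety n (point_of p)"
proof (rule projective_varietyI)
  show "proj_closed n (point_of p)" using assms by (rule proj_closed_point)
  have p: "p \<in> point_of p" by (auto simp: point_of_def same_point_def intro: exI[of _ 1])
  then show "point_of p \<noteq> {}" by blast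
  fix d e \<phi> \<psi>
  assume *: "form_function n d \<phi>" "form_function n e \<psi>" "\<And>v. v \<in> point_of p \<Longrightarrow> \<phi> v * \<psi> v = 0"
  from *(3)[OF p] show "(\<forall>v\<in>point_of p. \<phi> v = 0) \<or> (\<forall>v\<in>point_of p. \<psi> v = 0)"
    using form_function_scale[OF *(1)] form_function_scale[OF *(2)]
    by (auto simp: point_of_def same_point_def)
qed

text \<open>A single representative in \<open>Z\<close> forces all its nonzero multiples into
  \<open>Z\<close>. Hence no variety lies strictly inside a point, which stops descending
  chains.\<close>

lemma point_of_subset_closed:
  assumes "proj_closed n Z" "Z \<noteq> {}" "Z \<subseteq> point_of p"
  shows "point_of p \<subseteq> Z"
proof
  fix v assume "v \<in> point_of p"
  then obtain c where c: "c \<noteq> 0" "v = (\<lambda>i. c * p i)" by (auto simp: point_of_def same_point_def)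
  from assms obtain z where "z \<in> Z" "z \<in> point_of p" by blast
  then obtain b where b: "b \<noteq> 0" "z = (\<lambda>i. b * p i)" by (auto simp: point_of_def same_point_def)
  have "v = (\<lambda>i. (c / b) * z i)" using b c by auto
  then show "v \<in> Z" using proj_closed_scale[OF assms(1) \<open>z \<in> Z\<close>, of "c / b"] b c by auto
qed

section \<open>Bivariate polynomials and ternary forms\<close>

text \<open>Otherwise 1 plus the product of all X - a would be a nonconstant polynomial taking the
  value 1 everywhere.\<close>

lemma infinite_UNIV_alg_closed: "infinite (UNIV :: 'k::alg_closed_field set)"
proof
  assume fin: "finite (UNIV :: 'k set)"
  define P where "P = (\<Prod>a\<in>(UNIV :: 'k set). [:-a, 1:])"
  have "degree P = card (UNIV :: 'k set)"
    unfolding P_def by (subst degree_prod_eq_sum_degree) auto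
  then have "degree (P + 1) > 0"
    using fin by (subst degree_add_eq_left) (auto simp: card_gt_0_iff)
  then obtain x where "poly (P + 1) x = 0"
    using alg_closed_imp_poly_has_root by blast
  moreover have "poly P x = 0"
    using fin by (simp add: P_def poly_prod prod_zero_iff)
  ultimately show False by simp
qed

lemma poly_eq_0_if_zero_everywhere:
  fixes p :: "'k::alg_closed_field poly"
  assumes "\<And>x. poly p x = 0"
  shows "p = 0"
  using poly_roots_finite[of p] infinite_UNIV_alg_closed assms by auto

lemma poly_eq_sum_atMost:
  fixes p :: "'a::comm_semiring_1 poly"
  assumes "degree p \<le> n"
  shows "poly p x = (\<Sum>i\<le>n. poly.coeff p i * x ^ i)"
  unfolding poly_altdef using assms
  by (intro sum.mono_neutral_left) (auto simp: coeff_eq_0)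

definition bipoly :: "'k::field poly poly \<Rightarrow> 'k \<Rightarrow> 'k \<Rightarrow> 'k" where
  "bipoly g x y = poly (poly g [:y:]) x"

lemma bipoly_mult: "bipoly (g * h) x y = bipoly g x y * bipoly h x y"
  and bipoly_add: "bipoly (g + h) x y = bipoly g x y + bipoly h x y"
  by (simp_all add: bipoly_def)

lemma bipoly_eq_sum:
  assumes "degree g \<le> n"
  shows "bipoly g x y = (\<Sum>j\<le>n. poly (poly.coeff g j) x * y ^ j)"
proof -
  have "poly ([:y:] ^ j) x = y ^ j" for j
    by (simp add: poly_power)
  then show ?thesis
    unfolding bipoly_def poly_eq_sum_atMost[OF assms] by (simp add: poly_sum)
qed

definition total_degree_le :: "nat \<Rightarrow> 'k::field poly poly \<Rightarrow> bool" where
  "total_degree_le d g \<longleftrightarrow> (\<forall>i j. poly.coeff (poly.coeff g j) i \<noteq> 0 \<longrightarrow> i + j \<le> d)"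

lemma total_degree_leD:
  assumes "total_degree_le d g"
  shows "degree g \<le> d" and "degree (poly.coeff g j) \<le> d - j"
proof -
  show "degree g \<le> d"
  proof (rule degree_le, intro allI impI)
    fix j assume "d < j"
    then show "poly.coeff g j = 0"
      using assms unfolding total_degree_le_def by (intro poly_eqI) force
  qed
  show "degree (poly.coeff g j) \<le> d - j"
    using assms unfolding total_degree_le_def
    by (intro degree_le) (metis diff_le_mono diff_add_inverse2 leD)
qed

lemma bipoly_eq_double_sum:
  assumes "total_degree_le d g"
  shows "bipoly g x y = (\<Sum>j\<le>d. \<Sum>i\<le>d-j. poly.coeff (poly.coeff g j) i * x ^ i * y ^ j)"
  unfolding bipoly_eq_sum[OF total_degree_leD(1)[OF assms]]
    poly_eq_sum_atMost[OF total_degree_leD(2)[OF assms]]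
  by (simp add: sum_distrib_right)

text \<open>The degree is a parameter because a form may be divisible by \<open>v 0\<close>;
  homogenizing with the exact total degree would lose that power. Under
  \<open>total_degree_le d g\<close> no term of \<open>g\<close> is cut off.\<close>

definition homog :: "nat \<Rightarrow> 'k::field poly poly \<Rightarrow> (nat \<Rightarrow> 'k) \<Rightarrow> 'k" where
  "homog d g v = (\<Sum>j\<le>d. \<Sum>i\<le>d-j. poly.coeff (poly.coeff g j) i * v 0 ^ (d - (i + j)) * v 1 ^ i * v 2 ^ j)"

lemma form_function_homog: "form_function 2 d (homog d g)"
proof -
  have A: "form_function 2 (((0 + (d - (i + j)) * 1) + i * 1) + j * 1)
    (\<lambda>v. poly.coeff (poly.coeff g j) i * v 0 ^ (d - (i + j)) * v 1 ^ i * v 2 ^ j)" for i j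
    by (intro form_function_mult form_function_const form_function_power form_function_var) auto
  have E: "((0 + (d - (i + j)) * 1) + i * 1) + j * 1 = d" if "j \<le> d" "i \<le> d - j" for i j
    using that by simp
  have "form_function 2 d
    (\<lambda>v. poly.coeff (poly.coeff g j) i * v 0 ^ (d - (i + j)) * v 1 ^ i * v 2 ^ j)"
    if "j \<le> d" "i \<le> d - j" for i j
    by (rule A[of i j, unfolded E[OF that]])
  then show ?thesis
    unfolding homog_def[abs_def] by (intro form_function_sum) auto
qed

lemma homog_affine:
  assumes "total_degree_le d g" "v 0 \<noteq> 0"
  shows "homog d g v = v 0 ^ d * bipoly g (v 1 / v 0) (v 2 / v 0)"
proof -
  have *: "v 0 ^ (d - (i + j)) = v 0 ^ d * ((1 / v 0) ^ i * (1 / v 0) ^ j)" if "i + j \<le> d" for i j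
    using that assms(2) by (simp add: power_diff power_add field_simps)
  show ?thesis
    unfolding homog_def bipoly_eq_double_sum[OF assms(1)] sum_distrib_left
    by (intro sum.cong refl) (simp add: * power_divide)
qed

text \<open>Polynomial dependence on \<open>v 0\<close> alone allows identities proved for
  \<open>v 0 \<noteq> 0\<close> to be extended to the line at infinity.\<close>

lemma homog_fun_upd_eq_poly: "\<exists>p. \<forall>z. homog d g (v(0 := z)) = poly p z"
proof (intro exI allI)
  fix z
  show "homog d g (v(0 := z)) = poly (\<Sum>j\<le>d. \<Sum>i\<le>d-j.
    Polynomial.monom (poly.coeff (poly.coeff g j) i * v 1 ^ i * v 2 ^ j) (d - (i + j))) z"
    by (simp add: homog_def poly_sum poly_monom mult_ac)
qed

lemma coeff_coeff_mult:
  "poly.coeff (poly.coeff (g * h) j) i =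
    (\<Sum>b\<le>j. \<Sum>a\<le>i. poly.coeff (poly.coeff g b) a * poly.coeff (poly.coeff h (j - b)) (i - a))"
  by (simp add: coeff_mult coeff_sum)

lemma total_degree_le_mult:
  assumes "total_degree_le d g" "total_degree_le e h"
  shows "total_degree_le (d + e) (g * h)"
  unfolding total_degree_le_def
proof (intro allI impI)
  fix i j assume "poly.coeff (poly.coeff (g * h) j) i \<noteq> 0"
  then obtain b a where ba: "b \<le> j" "a \<le> i"
      "poly.coeff (poly.coeff g b) a * poly.coeff (poly.coeff h (j - b)) (i - a) \<noteq> 0"
    unfolding coeff_coeff_mult by (metis (no_types, lifting) atMost_iff sum.neutral)
  then have "a + b \<le> d" "(i - a) + (j - b) \<le> e"
    using assms unfolding total_degree_le_def by (metis mult_zero_left, metis mult_zero_right)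
  then show "i + j \<le> d + e" using ba by simp
qed

lemma homog_mult:
  fixes g h :: "'k::alg_closed_field poly poly"
  assumes "total_degree_le d g" "total_degree_le e h"
  shows "homog (d + e) (g * h) v = homog d g v * homog e h v"
proof -
  obtain p where p: "\<And>z. homog (d + e) (g * h) (v(0 := z)) = poly p z"
    using homog_fun_upd_eq_poly by metis
  obtain q where q: "\<And>z. homog d g (v(0 := z)) = poly q z"
    using homog_fun_upd_eq_poly by metis
  obtain r where r: "\<And>z. homog e h (v(0 := z)) = poly r z"
    using homog_fun_upd_eq_poly by metis
  have "poly p z = poly q z * poly r z" if "z \<noteq> 0" for z
    unfolding p[symmetric] q[symmetric] r[symmetric] using that assms
    by (simp add: homog_affine total_degree_le_mult bipoly_mult power_add)
  \<comment> \<open>At 0 nothing is known yet; the factor X makes the product vanish there too, and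
    it can be cancelled afterwards.\<close>
  then have "poly ((p - q * r) * [:0, 1:]) z = 0" for z
    by (cases "z = 0") auto
  then have "p = q * r"
    using poly_eq_0_if_zero_everywhere[of "(p - q * r) * [:0, 1:]"] by auto
  then show ?thesis
    using p[of "v 0"] q[of "v 0"] r[of "v 0"] by simp
qed

lemma total_degree_le_exists: "\<exists>d. total_degree_le d g"
proof (intro exI)
  let ?d = "\<lambda>j. degree (poly.coeff g j)"
  show "total_degree_le (degree g + (\<Sum>j\<le>degree g. ?d j)) g"
    unfolding total_degree_le_def
  proof (intro allI impI)
    fix i j assume nz: "poly.coeff (poly.coeff g j) i \<noteq> 0"
    have j: "j \<le> degree g" using nz by (intro le_degree) auto
    moreover from j have "?d j \<le> (\<Sum>j\<le>degree g. ?d j)"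
      by (intro member_le_sum) auto
    moreover have "i \<le> ?d j" using nz by (rule le_degree)
    ultimately show "i + j \<le> degree g + (\<Sum>j\<le>degree g. ?d j)" by linarith
  qed
qed

text \<open>The top-degree parts multiply to a nonzero form: among the monomials of top degree, those with
  the largest power of \<open>y\<close> cannot cancel.\<close>

lemma total_degree_mult_ge:
  assumes f: "total_degree_le n f" "poly.coeff (poly.coeff f j0) i0 \<noteq> 0" "i0 + j0 = n"
    and fq: "total_degree_le d (f * q)" and q: "poly.coeff (poly.coeff q j) i \<noteq> 0"
  shows "i + j + n \<le> d"
proof -
  let ?f = "\<lambda>i j. poly.coeff (poly.coeff f j) i" and ?q = "\<lambda>i j. poly.coeff (poly.coeff q j) i"
  \<comment> \<open>D is the total degree of \<open>q\<close>; J and K below are the largest powers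
    of y in the top-degree parts of \<open>f\<close> and of \<open>q\<close>.\<close>
  define D where "D = (GREATEST D. \<exists>i j. ?q i j \<noteq> 0 \<and> D = i + j)"
  obtain B where "total_degree_le B q" using total_degree_le_exists by blast
  then have bnd: "\<And>y. \<exists>i j. ?q i j \<noteq> 0 \<and> y = i + j \<Longrightarrow> y \<le> B"
    unfolding total_degree_le_def by blast
  have D: "\<exists>i j. ?q i j \<noteq> 0 \<and> D = i + j"
    unfolding D_def by (rule GreatestI_nat[of _ "i + j"]) (use q bnd in blast)+
  have D_max: "i + j \<le> D" if "?q i j \<noteq> 0" for i j
    unfolding D_def by (rule Greatest_le_nat[of _ _ B]) (use that bnd in blast)+
  define J where "J = (GREATEST j. ?f (n - j) j \<noteq> 0 \<and> j \<le> n)"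
  have J: "?f (n - J) J \<noteq> 0 \<and> J \<le> n"
    unfolding J_def by (rule GreatestI_nat[of _ j0 n]) (use f in auto)
  have J_max: "j \<le> J" if "?f i j \<noteq> 0" "i + j = n" for i j
    unfolding J_def by (rule Greatest_le_nat[of _ _ n]) (use that in auto)
  define K where "K = (GREATEST j. ?q (D - j) j \<noteq> 0 \<and> j \<le> D)"
  have K: "?q (D - K) K \<noteq> 0 \<and> K \<le> D"
  proof -
    obtain i j where "?q i j \<noteq> 0" "D = i + j" using D by blast
    then show ?thesis
      unfolding K_def by - (rule GreatestI_nat[of _ j D], auto)
  qed
  have K_max: "j \<le> K" if "?q i j \<noteq> 0" "i + j = D" for i j
    unfolding K_def by (rule Greatest_le_nat[of _ _ D]) (use that in auto)
  let ?I = "(n - J) + (D - K)"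
  let ?t = "\<lambda>b a. ?f a b * ?q (?I - a) (J + K - b)"
  \<comment> \<open>In a nonzero term the degree bounds leave no slack, so both factors belong to
    the top-degree parts; maximality of J and of K then gives \<open>b \<le> J\<close> and
    \<open>b \<ge> J\<close>.\<close>
  have zero: "?t b a = 0" if "b \<le> J + K" "a \<le> ?I" "(b, a) \<noteq> (J, n - J)" for a b
  proof (rule ccontr)
    assume "?t b a \<noteq> 0"
    then have nz: "?f a b \<noteq> 0" "?q (?I - a) (J + K - b) \<noteq> 0" by auto
    then have "a + b \<le> n" "(?I - a) + (J + K - b) \<le> D"
      using f(1) D_max unfolding total_degree_le_def by blast+
    then have eq: "a + b = n" "(?I - a) + (J + K - b) = D"
      using that J K by linarith+
    then have "b \<le> J" "J + K - b \<le> K"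
      using J_max K_max nz by blast+
    then show False using that eq by auto
  qed
  have "poly.coeff (poly.coeff (f * q) (J + K)) ?I = (\<Sum>b\<le>J + K. \<Sum>a\<le>?I. ?t b a)"
    by (rule coeff_coeff_mult)
  also have "\<dots> = (\<Sum>b\<in>{J}. \<Sum>a\<le>?I. ?t b a)"
    using zero by (intro sum.mono_neutral_right ballI sum.neutral) auto
  also have "\<dots> = (\<Sum>a\<le>?I. ?t J a)"
    by simp
  also have "\<dots> = (\<Sum>a\<in>{n - J}. ?t J a)"
    by (intro sum.mono_neutral_right ballI zero) auto
  also have "\<dots> \<noteq> 0"
    using J K by simp
  finally have "?I + (J + K) \<le> d"
    using fq unfolding total_degree_le_def by blast
  then show ?thesis
    using J K D_max[OF q] by linarith
qed

section \<open>Ternary forms as homogenized bivariate polynomials\<close>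

definition ternary_monom :: "nat \<Rightarrow> nat \<Rightarrow> nat \<Rightarrow> (nat \<Rightarrow>\<^sub>0 nat)" where
  "ternary_monom d i j =
     Poly_Mapping.single 0 (d - (i + j)) + Poly_Mapping.single 1 i + Poly_Mapping.single 2 j"

lemma lookup_ternary_monom:
  "Poly_Mapping.lookup (ternary_monom d i j) k =
    (if k = 0 then d - (i + j) else if k = 1 then i else if k = 2 then j else 0)"
  by (auto simp: ternary_monom_def lookup_add lookup_single)

lemma mono_eval_ternary_monom:
  "mono_eval v (ternary_monom d i j) = v 0 ^ (d - (i + j)) * v 1 ^ i * v 2 ^ j"
  by (simp add: ternary_monom_def mono_eval_add)

lemma ternary_monomI:
  assumes "Poly_Mapping.keys m \<subseteq> {..2}" "mono_deg m = d"
  shows "m = ternary_monom d (Poly_Mapping.lookup m 1) (Poly_Mapping.lookup m 2)"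
    and "Poly_Mapping.lookup m 1 + Poly_Mapping.lookup m 2 \<le> d"
proof -
  have A: "{..2} = {0, 1, 2 :: nat}" by auto
  have d: "d = Poly_Mapping.lookup m 0 + Poly_Mapping.lookup m 1 + Poly_Mapping.lookup m 2"
    using mono_deg_superset[of "{..2}" m] assms by (simp add: A)
  then show "Poly_Mapping.lookup m 1 + Poly_Mapping.lookup m 2 \<le> d" by simp
  have "Poly_Mapping.lookup m k = 0" if "k > 2" for k
    using that assms(1) by (force simp: in_keys_iff)
  then show "m = ternary_monom d (Poly_Mapping.lookup m 1) (Poly_Mapping.lookup m 2)"
    using d by (intro poly_mapping_eqI) (auto simp: lookup_ternary_monom)
qed

text \<open>Dehomogenization. The clause on coefficients is kept because
  \<open>partial_deriv\<close> acts on the formal polynomial and not on its function.\<close>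

lemma is_form_2_eq_homog:
  assumes "is_form 2 d G"
  obtains g where "total_degree_le d g" "peval G = homog d g"
    "\<And>i j. i + j \<le> d \<Longrightarrow> poly.coeff (poly.coeff g j) i = Poly_Mapping.lookup G (ternary_monom d i j)"
proof -
  define c where "c i j = (if i + j \<le> d then Poly_Mapping.lookup G (ternary_monom d i j) else 0)" for i j
  define g where "g = (\<Sum>j\<le>d. Polynomial.monom (\<Sum>i\<le>d. Polynomial.monom (c i j) i) j)"
  have g: "poly.coeff (poly.coeff g j) i = c i j" for i j
  proof -
    have "poly.coeff g j = (\<Sum>k\<le>d. if k = j then \<Sum>i\<le>d. Polynomial.monom (c i k) i else 0)"
      by (simp add: g_def coeff_sum)
    also have "\<dots> = (if j \<le> d then \<Sum>i\<le>d. Polynomial.monom (c i j) i else 0)"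
      by (simp add: sum.delta)
    finally show ?thesis
      by (auto simp: coeff_sum sum.delta c_def)
  qed
  have tot: "total_degree_le d g"
    by (auto simp: total_degree_le_def g c_def)
  let ?A = "Sigma {..d} (\<lambda>j. {..d - j})"
  let ?h = "\<lambda>(j, i). ternary_monom d i j"
  have inj: "inj_on ?h ?A"
  proof (rule inj_onI)
    fix p q assume "?h p = ?h q"
    then have "Poly_Mapping.lookup (?h p) 1 = Poly_Mapping.lookup (?h q) 1"
      "Poly_Mapping.lookup (?h p) 2 = Poly_Mapping.lookup (?h q) 2" by simp_all
    then show "p = q" by (cases p; cases q) (simp add: lookup_ternary_monom)
  qed
  have keys: "Poly_Mapping.keys G \<subseteq> ?h ` ?A"
  proof
    fix m assume "m \<in> Poly_Mapping.keys G"
    then have m: "Poly_Mapping.keys m \<subseteq> {..2}" "mono_deg m = d"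
      using assms by (auto simp: is_form_def)
    then show "m \<in> ?h ` ?A"
      using ternary_monomI[OF m]
      by (intro image_eqI[of _ _ "(Poly_Mapping.lookup m 2, Poly_Mapping.lookup m 1)"]) auto
  qed
  have "peval G v = homog d g v" for v
  proof -
    have "peval G v = (\<Sum>m\<in>?h ` ?A. Poly_Mapping.lookup G m * mono_eval v m)"
      using keys by (intro peval_superset) auto
    also have "\<dots> = (\<Sum>(j, i)\<in>?A. Poly_Mapping.lookup G (ternary_monom d i j) *
        (v 0 ^ (d - (i + j)) * v 1 ^ i * v 2 ^ j))"
      by (subst sum.reindex[OF inj]) (simp add: case_prod_unfold mono_eval_ternary_monom)
    also have "\<dots> = (\<Sum>j\<le>d. \<Sum>i\<le>d-j. Poly_Mapping.lookup G (ternary_monom d i j) *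
        (v 0 ^ (d - (i + j)) * v 1 ^ i * v 2 ^ j))"
      by (subst sum.Sigma) auto
    also have "\<dots> = homog d g v"
      unfolding homog_def by (intro sum.cong refl) (auto simp: g c_def mult_ac)
    finally show ?thesis .
  qed
  then show ?thesis
    using tot by (intro that[of g]) (auto simp: g c_def)
qed

lemma form_function_2_eq_homog:
  assumes "form_function 2 d \<phi>"
  obtains g where "total_degree_le d g" "\<phi> = homog d g"
proof -
  obtain G where "is_form 2 d G" "\<phi> = peval G"
    using assms unfolding form_function_def by blast
  then show ?thesis using that is_form_2_eq_homog by metis
qed

lemma peval_homogenization:
  assumes "total_degree_le d f" "total_degree f = d"
  shows "peval (homogenization f) v = homog d f v"
proof -
  have "peval (homogenization f) v = (\<Sum>j\<le>degree f. \<Sum>i\<le>degree (poly.coeff f j).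
     poly.coeff (poly.coeff f j) i * v 0 ^ (d - (i + j)) * v 1 ^ i * v 2 ^ j)"
    by (simp add: homogenization_def assms(2) peval_sum peval_mult peval_power)
  also have "\<dots> = (\<Sum>j\<le>degree f. \<Sum>i\<le>d-j.
     poly.coeff (poly.coeff f j) i * v 0 ^ (d - (i + j)) * v 1 ^ i * v 2 ^ j)"
    using total_degree_leD[OF assms(1)]
    by (intro sum.cong sum.mono_neutral_left) (auto simp: coeff_eq_0)
  also have "\<dots> = homog d f v"
    unfolding homog_def using total_degree_leD[OF assms(1)]
    by (intro sum.mono_neutral_left) (auto simp: coeff_eq_0)
  finally show ?thesis .
qed

text \<open>The partial derivatives of a form at \<open>(0 : 0 : 1)\<close> only see its coefficients at
  \<open>Y\<^sup>d\<close>, \<open>X Y\<^sup>d\<^sup>-\<^sup>1\<close> and \<open>Z Y\<^sup>d\<^sup>-\<^sup>1\<close>.\<close>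

lemma partial_deriv_at_infinity_eq_0:
  assumes "is_form 2 d G" and v: "v 0 = 0" "v 1 = 0" and "i \<le> 2"
    and zero: "\<And>i j. i \<le> 1 \<Longrightarrow> d \<le> j + 1 \<Longrightarrow> i + j \<le> d \<Longrightarrow> Poly_Mapping.lookup G (ternary_monom d i j) = 0"
  shows "peval (partial_deriv i G) v = 0"
proof -
  have "of_nat (Poly_Mapping.lookup m i) * Poly_Mapping.lookup G m *
      mono_eval v (m - Poly_Mapping.single i 1) = 0"
    if m: "m \<in> Poly_Mapping.keys G" for m
  proof (rule ccontr)
    assume nz: "\<not> ?thesis"
    let ?m = "m - Poly_Mapping.single i 1"
    let ?a = "Poly_Mapping.lookup m"
    have "Poly_Mapping.keys m \<subseteq> {..2}" "mono_deg m = d"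
      using assms(1) m by (auto simp: is_form_def)
    then have m_eq: "m = ternary_monom d (?a 1) (?a 2)" and le: "?a 1 + ?a 2 \<le> d"
      by (rule ternary_monomI)+
    have a0: "?a 0 = d - (?a 1 + ?a 2)"
      by (subst m_eq) (simp add: lookup_ternary_monom)
    have ai: "?a i > 0"
      using nz by (cases "?a i") auto
    \<comment> \<open>Variables 0 and 1 vanish at the point, so a derived monomial with nonzero
      value is a power of variable 2.\<close>
    have low: "Poly_Mapping.lookup ?m k = 0" if "k < 2" for k
    proof (rule ccontr)
      assume "Poly_Mapping.lookup ?m k \<noteq> 0"
      moreover have "v k = 0" using that v by (cases k) (auto simp: less_2_cases_iff)
      ultimately have "mono_eval v ?m = 0"
        unfolding mono_eval_def by (auto simp: in_keys_iff intro!: prod_zero bexI[of _ k])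
      then show False using nz by simp
    qed
    have "?a 0 \<le> (if i = 0 then 1 else 0)" "?a 1 \<le> (if i = 1 then 1 else 0)"
      using low[of 0] low[of 1] by (auto simp: lookup_minus lookup_single when_def split: if_splits)
    then have "?a 1 \<le> 1" "d \<le> ?a 2 + 1"
      using le a0 ai by (auto split: if_splits)
    then have "Poly_Mapping.lookup G (ternary_monom d (?a 1) (?a 2)) = 0"
      using le by (intro zero)
    then show False using m m_eq by (metis in_keys_iff)
  qed
  then show ?thesis
    unfolding partial_deriv_def peval_sum peval_single by (intro sum.neutral ballI)
qed

section \<open>The sextic\<close>

text \<open>Fixing x gives a polynomial in y over a field, so that roots can be counted.\<close>

definition slice :: "'k::field \<Rightarrow> 'k poly poly \<Rightarrow> 'k poly" where
  "slice x g = map_poly (\<lambda>p. poly p x) g"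

lemma coeff_slice: "poly.coeff (slice x g) j = poly (poly.coeff g j) x"
  by (simp add: slice_def coeff_map_poly)

lemma degree_slice: "degree (slice x g) \<le> degree g"
  by (rule degree_le) (simp add: coeff_slice coeff_eq_0)

lemma poly_slice: "poly (slice x g) y = bipoly g x y"
  by (simp add: bipoly_eq_sum[of g "degree g"] poly_eq_sum_atMost[OF degree_slice] coeff_slice)

lemma bipoly_eqI:
  fixes g h :: "'k::alg_closed_field poly poly"
  assumes "\<And>x y. bipoly g x y = bipoly h x y"
  shows "g = h"
proof (rule poly_eqI)
  fix j
  have "slice x g - slice x h = 0" for x
    using assms by (intro poly_eq_0_if_zero_everywhere) (simp add: poly_slice)
  then have "poly.coeff (slice x g) j = poly.coeff (slice x h) j" for x
    by simp
  then have "poly.coeff g j - poly.coeff h j = 0"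
    by (intro poly_eq_0_if_zero_everywhere) (simp add: coeff_slice)
  then show "poly.coeff g j = poly.coeff h j" by simp
qed

definition quartic :: "(nat \<Rightarrow> 'k::field) \<Rightarrow> 'k poly" where
  "quartic \<gamma> = (\<Prod>i=1..4. [:- \<gamma> i, 1:])"

lemma poly_quartic: "poly (quartic \<gamma>) x = (\<Prod>i=1..4. x - \<gamma> i)"
  by (simp add: quartic_def poly_prod)

lemma degree_quartic: "degree (quartic \<gamma>) = 4"
  unfolding quartic_def by (subst degree_prod_eq_sum_degree) auto

lemma coeff_quartic_4: "poly.coeff (quartic \<gamma>) 4 = 1"
proof -
  have "lead_coeff (quartic \<gamma>) = 1"
    unfolding quartic_def by (simp add: lead_coeff_prod)
  then show ?thesis by (simp add: degree_quartic)
qed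

lemma quartic_nonzero: "quartic \<gamma> \<noteq> 0"
  using degree_quartic[of \<gamma>] by auto

text \<open>The leading terms cancel since both quartics are monic. This is what keeps the part of
  \<open>f\<close> free of y at degree at most 6.\<close>

lemma degree_quartic_diff: "degree (quartic \<gamma> - quartic \<delta>) \<le> 3"
proof (rule degree_le, intro allI impI)
  fix i :: nat assume "3 < i"
  then consider "i = 4" | "i > 4" by linarith
  then show "poly.coeff (quartic \<gamma> - quartic \<delta>) i = 0"
    by cases (auto simp: coeff_quartic_4 coeff_eq_0 degree_quartic)
qed

lemma bipoly_howe_sextic:
  "bipoly (howe_sextic \<alpha> \<beta>) x y =
    y ^ 4 - 2 * (poly (quartic \<alpha>) x + poly (quartic \<beta>) x) * y ^ 2 + (poly (quartic \<alpha>) x - poly (quartic \<beta>) x) ^ 2"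
  unfolding bipoly_def howe_sextic_eval poly_quartic by simp

text \<open>Comparing values avoids expanding the thirteen coefficients. From here on the sextic is
  a monic biquadratic in y with coefficients in \<open>k[x]\<close>.\<close>

lemma howe_sextic_eq:
  fixes \<alpha> \<beta> :: "nat \<Rightarrow> 'k::alg_closed_field"
  shows "howe_sextic \<alpha> \<beta> =
    [:(quartic \<alpha> - quartic \<beta>) ^ 2, 0, smult (- 2) (quartic \<alpha> + quartic \<beta>), 0, 1:]"
proof (rule bipoly_eqI)
  fix x y
  show "bipoly (howe_sextic \<alpha> \<beta>) x y = bipoly [:(quartic \<alpha> - quartic \<beta>) ^ 2, 0,
      smult (- 2) (quartic \<alpha> + quartic \<beta>), 0, 1:] x y"
    unfolding bipoly_howe_sextic by (simp add: bipoly_def poly_power algebra_simps power_numeral_reduce)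
qed

lemma bipoly_howe_sextic_factor:
  assumes "a ^ 2 = poly (quartic \<alpha>) x" "b ^ 2 = poly (quartic \<beta>) x"
  shows "bipoly (howe_sextic \<alpha> \<beta>) x y = (y - (a + b)) * (y - (a - b)) * (y + (a - b)) * (y + (a + b))"
  unfolding bipoly_howe_sextic assms[symmetric] by (simp add: algebra_simps power_numeral_reduce)

lemma howe_sextic_degree: "degree (howe_sextic \<alpha> \<beta>) = 4" "lead_coeff (howe_sextic \<alpha> \<beta>) = 1"
  for \<alpha> \<beta> :: "nat \<Rightarrow> 'k::alg_closed_field"
  by (simp_all add: howe_sextic_eq)

text \<open>The powers 0, 2 and 4 of y carry coefficients of degree at most 2 * 3, 4 and 0 in
  x.\<close>

lemma total_degree_le_howe_sextic:
  fixes \<alpha> \<beta> :: "nat \<Rightarrow> 'k::alg_closed_field"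
  shows "total_degree_le 6 (howe_sextic \<alpha> \<beta>)"
  unfolding total_degree_le_def
proof (intro allI impI)
  fix i j assume nz: "poly.coeff (poly.coeff (howe_sextic \<alpha> \<beta>) j) i \<noteq> 0"
  then have "poly.coeff (howe_sextic \<alpha> \<beta>) j \<noteq> 0" by auto
  then have "j \<le> 4" using le_degree howe_sextic_degree(1) by metis
  then consider "j = 0" | "j = 1" | "j = 2" | "j = 3" | "j = 4" by linarith
  then show "i + j \<le> 6"
  proof cases
    case 1
    have "degree ((quartic \<alpha> - quartic \<beta>) ^ 2) \<le> degree (quartic \<alpha> - quartic \<beta>) * 2"
      by (rule degree_power_le)
    with 1 nz degree_quartic_diff[of \<alpha> \<beta>] show ?thesis
      by (auto simp: howe_sextic_eq dest!: le_degree)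
  next
    case 3
    have "degree (quartic \<alpha> + quartic \<beta>) \<le> 4"
      by (rule degree_add_le) (simp_all add: degree_quartic)
    moreover have "degree (smult (- 2) (quartic \<alpha> + quartic \<beta>)) \<le> degree (quartic \<alpha> + quartic \<beta>)"
      by (rule degree_smult_le)
    ultimately show ?thesis
      using 3 nz le_degree[of "smult (- 2) (quartic \<alpha> + quartic \<beta>)" i]
      by (simp add: howe_sextic_eq numeral_2_eq_2)
  qed (use nz in \<open>auto simp: howe_sextic_eq eval_nat_numeral\<close>)
qed

lemma coeff_howe_sextic_4_2:
  "poly.coeff (poly.coeff (howe_sextic \<alpha> \<beta>) 2) 4 = - 4" for \<alpha> \<beta> :: "nat \<Rightarrow> 'k::alg_closed_field"
  by (simp add: howe_sextic_eq numeral_2_eq_2 coeff_quartic_4)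

lemma coeff_howe_sextic_top:
  "j \<ge> 5 \<Longrightarrow> poly.coeff (howe_sextic \<alpha> \<beta>) j = 0" for \<alpha> \<beta> :: "nat \<Rightarrow> 'k::alg_closed_field"
  by (rule coeff_eq_0) (simp add: howe_sextic_degree)

lemma homog_howe_sextic_at_infinity:
  fixes \<alpha> \<beta> :: "nat \<Rightarrow> 'k::alg_closed_field"
  assumes "v 0 = 0"
  shows "homog 6 (howe_sextic \<alpha> \<beta>) v = poly.coeff (poly.coeff (howe_sextic \<alpha> \<beta>) 0) 6 * v 1 ^ 6 - 4 * v 1 ^ 4 * v 2 ^ 2"
proof -
  let ?c = "\<lambda>i j. poly.coeff (poly.coeff (howe_sextic \<alpha> \<beta>) j) i"
  \<comment> \<open>Since \<open>0 ^ 0 = 1\<close>, setting \<open>v 0 = 0\<close> keeps exactly the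
    terms of degree 6.\<close>
  have "homog 6 (howe_sextic \<alpha> \<beta>) v = (\<Sum>j\<le>6. \<Sum>i\<in>{6-j}. ?c i j * v 0 ^ (6 - (i + j)) * v 1 ^ i * v 2 ^ j)"
    unfolding homog_def using assms by (intro sum.cong refl sum.mono_neutral_right) auto
  also have "\<dots> = (\<Sum>j\<le>6. ?c (6 - j) j * v 1 ^ (6 - j) * v 2 ^ j)"
    by (intro sum.cong refl) simp
  also have "\<dots> = (\<Sum>j\<in>{0, 2}. ?c (6 - j) j * v 1 ^ (6 - j) * v 2 ^ j)"
  proof (intro sum.mono_neutral_right ballI)
    fix j :: nat assume "j \<in> {..6} - {0, 2}"
    then consider "j = 1" | "j = 3" | "j = 4" | "j \<ge> 5" by fastforce
    then show "?c (6 - j) j * v 1 ^ (6 - j) * v 2 ^ j = 0"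
      by cases (simp_all add: coeff_howe_sextic_top, simp_all add: howe_sextic_eq eval_nat_numeral)
  qed auto
  finally show ?thesis
    by (simp add: coeff_howe_sextic_4_2)
qed

text \<open>These conditions make the four roots distinct at almost all x. Irreducibility stays
  outside the locale, because the divisibility test proved here is what primality of
  \<open>f\<close> is derived from.\<close>

locale howe_pair =
  fixes \<alpha> \<beta> :: "nat \<Rightarrow> 'k::alg_closed_field"
  assumes two: "(2::'k) \<noteq> 0" and quartics_distinct: "quartic \<alpha> \<noteq> quartic \<beta>"
begin

abbreviation "f \<equiv> howe_sextic \<alpha> \<beta>"
abbreviation "C \<equiv> plane_curve (howe_sextic \<alpha> \<beta>)"

lemma four: "(4::'k) \<noteq> 0"
proof -
  have "(4::'k) = 2 * 2" by simp
  then show ?thesis using two by (metis mult_eq_0_iff)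
qed

lemma total_degree_howe_sextic: "total_degree f = 6"
proof -
  let ?S = "{i + j |i j. poly.coeff (poly.coeff f j) i \<noteq> 0}"
  have le: "?S \<subseteq> {..6}"
    using total_degree_le_howe_sextic unfolding total_degree_le_def by auto
  have "poly.coeff (poly.coeff f 2) 4 \<noteq> 0"
    using four by (simp add: coeff_howe_sextic_4_2)
  then have "4 + 2 \<in> ?S" by blast
  then show ?thesis
    unfolding total_degree_def using le
    by (intro Max_eqI) (auto intro: finite_subset)
qed

lemma plane_curve_eq: "C = {v \<in> proj_space 2. homog 6 f v = 0}"
  unfolding plane_curve_def
  by (simp add: peval_homogenization[OF total_degree_le_howe_sextic total_degree_howe_sextic])

lemma dvd_if_vanishes:
  assumes "\<And>x y. bipoly f x y = 0 \<Longrightarrow> bipoly g x y = 0"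
  shows "f dvd g"
proof -
  \<comment> \<open>As \<open>f\<close> is monic in y, pseudo-division is ordinary division over
    \<open>k[x]\<close>.\<close>
  obtain q r where qr: "pseudo_divmod g f = (q, r)" by force
  have "f \<noteq> 0" by (simp add: howe_sextic_eq)
  from pseudo_divmod[OF this qr] have g: "g = f * q + r" and r: "r = 0 \<or> degree r < 4"
    using howe_sextic_degree(2)[of \<alpha> \<beta>] by (simp_all add: howe_sextic_degree(1))
  have r_zero: "bipoly r x y = 0" if "bipoly f x y = 0" for x y
    using assms[OF that] that unfolding g bipoly_add bipoly_mult by simp
  \<comment> \<open>Outside the zeros of this polynomial a, b and \<open>a^2 - b^2\<close> are
    nonzero, which is what keeps the roots \<open>\<plusminus>a \<plusminus> b\<close> apart.
    Multiplying by it covers the finitely many other x.\<close>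
  let ?p = "quartic \<alpha> * quartic \<beta> * (quartic \<alpha> - quartic \<beta>)"
  have "poly (poly.coeff r j * ?p) x = 0" for j x
  proof (cases "poly ?p x = 0")
    case False
    obtain a where a: "a ^ 2 = poly (quartic \<alpha>) x" using nth_root_exists[of 2] by auto
    obtain b where b: "b ^ 2 = poly (quartic \<beta>) x" using nth_root_exists[of 2] by auto
    have nz: "a \<noteq> 0" "b \<noteq> 0" "a ^ 2 \<noteq> b ^ 2"
      using False by (auto simp: a[symmetric] b[symmetric])
    then have ab: "a \<noteq> b" "a \<noteq> - b" by auto
    let ?Y = "{a + b, a - b, - (a - b), - (a + b)}"
    have dbl: "z + z \<noteq> 0" if "z \<noteq> 0" for z :: 'k
      using that two by (metis mult_2 mult_eq_0_iff)
    have d: "a + b \<noteq> a - b" "a + b \<noteq> - (a - b)" "a + b \<noteq> - (a + b)"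
        "a - b \<noteq> - (a - b)" "a - b \<noteq> - (a + b)" "- (a - b) \<noteq> - (a + b)"
      using dbl[OF nz(1)] dbl[OF nz(2)] dbl[of "a + b"] dbl[of "a - b"] ab
      by (auto simp: algebra_simps eq_neg_iff_add_eq_0)
    have card: "card ?Y = 4" using d by auto
    have "poly (slice x r) y = 0" if "y \<in> ?Y" for y
      unfolding poly_slice using that
      by (intro r_zero) (auto simp: bipoly_howe_sextic_factor[OF a b])
    then have sub: "?Y \<subseteq> {y. poly (slice x r) y = 0}" by blast
    have "slice x r = 0"
    proof (rule ccontr)
      assume ne: "slice x r \<noteq> 0"
      then have "card ?Y \<le> card {y. poly (slice x r) y = 0}"
        using sub by (intro card_mono poly_roots_finite)
      also have "\<dots> \<le> degree (slice x r)"
        using ne by (rule card_poly_roots_bound)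
      also have "\<dots> \<le> degree r" by (rule degree_slice)
      finally have "r = 0" using card r by simp
      then show False using ne by (simp add: slice_def)
    qed
    then show ?thesis
      using coeff_slice[of x r j] by simp
  qed simp
  then have "poly.coeff r j * ?p = 0" for j
    by (rule poly_eq_0_if_zero_everywhere)
  then have "r = 0"
    using quartics_distinct quartic_nonzero[of \<alpha>] quartic_nonzero[of \<beta>] by (intro poly_eqI) auto
  then show ?thesis using g by simp
qed

text \<open>Total degrees add under multiplication; that \<open>f\<close> reaches degree 6 is
  witnessed by its term \<open>- 4 x^4 y^2\<close>.\<close>

lemma quotient_total_degree:
  assumes "total_degree_le d (f * q)" "q \<noteq> 0"
  shows "6 \<le> d" and "total_degree_le (d - 6) q"
proof -
  have *: "i + j + 6 \<le> d" if "poly.coeff (poly.coeff q j) i \<noteq> 0" for i j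
    by (rule total_degree_mult_ge[OF total_degree_le_howe_sextic _ _ assms(1) that, of 2 4])
       (auto simp: coeff_howe_sextic_4_2 four)
  obtain i j where "poly.coeff (poly.coeff q j) i \<noteq> 0"
    using assms(2) by (metis leading_coeff_0_iff)
  then show "6 \<le> d" using * by fastforce
  show "total_degree_le (d - 6) q"
    unfolding total_degree_le_def using * by fastforce
qed

lemma affine_point:
  "\<exists>v\<in>proj_space 2. v 0 = 1 \<and> v 1 = x \<and> v 2 = (y :: 'k)"
  by (intro bexI[of _ "\<lambda>i. if i = 0 then 1 else if i = 1 then x else if i = 2 then y else 0"])
     (auto simp: proj_space_def intro: exI[of _ 0])

text \<open>The homogeneous ideal of the curve is generated by \<open>f\<close>. The affine part
  decides: the cofactor has degree at most \<open>d - 6\<close>, so \<open>homog d g\<close> is a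
  multiple of \<open>homog 6 f\<close>, which also takes care of the points at infinity.\<close>

lemma form_vanishes_iff_dvd:
  assumes "total_degree_le d g"
  shows "(\<forall>v\<in>C. v 0 \<noteq> 0 \<longrightarrow> homog d g v = 0) \<longleftrightarrow> f dvd g"
    and "f dvd g \<Longrightarrow> v \<in> C \<Longrightarrow> homog d g v = 0"
proof -
  show vanish: "homog d g v = 0" if "f dvd g" "v \<in> C" for v
  proof -
    from \<open>f dvd g\<close> obtain q where q: "g = f * q" by (rule dvdE)
    show ?thesis
    proof (cases "q = 0")
      case True
      then show ?thesis by (simp add: q homog_def)
    next
      case False
      have "total_degree_le d (f * q)" using assms q by simp
      note quo = quotient_total_degree[OF this False]
      have "homog d g v = homog 6 f v * homog (d - 6) q v"
        using homog_mult[OF total_degree_le_howe_sextic quo(2), of \<alpha> \<beta> v] quo(1) by (simp add: q)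
      then show ?thesis using that(2) by (simp add: plane_curve_eq)
    qed
  qed
  show "(\<forall>v\<in>C. v 0 \<noteq> 0 \<longrightarrow> homog d g v = 0) \<longleftrightarrow> f dvd g"
  proof
    assume *: "\<forall>v\<in>C. v 0 \<noteq> 0 \<longrightarrow> homog d g v = 0"
    show "f dvd g"
    proof (rule dvd_if_vanishes)
      fix x y assume xy: "bipoly f x y = 0"
      obtain v where v: "v \<in> proj_space 2" "v 0 = 1" "v 1 = x" "v 2 = y"
        using affine_point[of x y] by blast
      then have "homog 6 f v = 0"
        using homog_affine[OF total_degree_le_howe_sextic, of v] xy by simp
      then have "homog d g v = 0" using * v by (simp add: plane_curve_eq)
      then show "bipoly g x y = 0"
        using homog_affine[OF assms, of v] v by simp
    qed
  qed (use vanish in blast)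
qed

lemma proj_closed_plane_curve: "proj_closed 2 C"
  unfolding plane_curve_eq by (rule proj_closed_zeros[OF form_function_homog])

text \<open>On the line at infinity the sextic becomes \<open>x^4 (c60 x^2 - 4 y^2)\<close>, so the
  line meets the curve with multiplicity 4 at this point.\<close>

definition infinity :: "nat \<Rightarrow> 'k" where
  "infinity = (\<lambda>i. if i = 2 then 1 else 0)"

lemma infinity_in_curve: "infinity \<in> proj_space 2" "infinity \<in> C"
  by (auto simp: plane_curve_eq proj_space_def infinity_def homog_howe_sextic_at_infinity)

lemma affine_point_in_curve: "\<exists>v\<in>C. v 0 \<noteq> 0 \<and> v 1 = v 0 * x"
proof -
  obtain a where a: "a ^ 2 = poly (quartic \<alpha>) x" using nth_root_exists[of 2] by auto
  obtain b where b: "b ^ 2 = poly (quartic \<beta>) x" using nth_root_exists[of 2] by auto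
  obtain v where v: "v \<in> proj_space 2" "v 0 = 1" "v 1 = x" "v 2 = a + b"
    using affine_point[of x "a + b"] by blast
  then have "homog 6 f v = 0"
    using homog_affine[OF total_degree_le_howe_sextic, of v] by (simp add: bipoly_howe_sextic_factor[OF a b])
  then show ?thesis using v by (auto simp: plane_curve_eq intro!: bexI[of _ v])
qed

lemma singular_at_infinity: "\<not> curve_nonsingular_at 2 C infinity"
proof -
  have deriv: "peval (partial_deriv i G) infinity = 0"
    if G: "is_form 2 d G" "\<forall>u\<in>C. peval G u = 0" and i: "i \<le> 2" for G d i
  proof (rule partial_deriv_at_infinity_eq_0[OF G(1) _ _ i])
    fix i j :: nat assume ij: "i \<le> 1" "d \<le> j + 1" "i + j \<le> d"
    obtain g where g: "total_degree_le d g" "peval G = homog d g"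
      "\<And>i j. i + j \<le> d \<Longrightarrow> poly.coeff (poly.coeff g j) i = Poly_Mapping.lookup G (ternary_monom d i j)"
      using is_form_2_eq_homog[OF G(1)] by metis
    have "f dvd g"
      using G(2) form_vanishes_iff_dvd(1)[OF g(1)] g(2) by simp
    then obtain q where q: "g = f * q" by blast
    have "poly.coeff (poly.coeff g j) i = 0"
    proof (cases "q = 0")
      case False
      have "total_degree_le d (f * q)" using g(1) q by simp
      note quo = quotient_total_degree[OF this False]
      \<comment> \<open>The degree of \<open>g\<close> in y is at most
        \<open>4 + (d - 6) = d - 2\<close>, whereas \<open>j \<ge> d - 1\<close>.\<close>
      have "degree g \<le> degree f + degree q"
        unfolding q by (rule degree_mult_le)
      also have "\<dots> \<le> 4 + (d - 6)"
        using total_degree_leD(1)[OF quo(2)] by (simp add: howe_sextic_degree)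
      finally have "degree g < j" using quo(1) ij by linarith
      then show ?thesis by (simp add: coeff_eq_0)
    qed (simp add: q)
    then show "Poly_Mapping.lookup G (ternary_monom d i j) = 0"
      using g(3) ij by simp
  qed (simp_all add: infinity_def)
  \<comment> \<open>No condition on tangent vectors remains, so the space has dimension 3 instead of
    the 2 of a nonsingular point.\<close>
  have tangent: "cone_tangent 2 C infinity = {w. \<forall>i>2. w i = 0}"
    unfolding cone_tangent_def using deriv by auto
  interpret V: vector_space "\<lambda>(c::'k) (w::nat \<Rightarrow> 'k) i. c * w i"
    by unfold_locales (auto simp: fun_eq_iff algebra_simps)
  define e :: "nat \<Rightarrow> nat \<Rightarrow> 'k" where "e k = (\<lambda>i. if i = k then 1 else 0)" for k
  have inj: "inj_on e {0, 1, 2}"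
    by (rule inj_onI) (metis e_def zero_neq_one)
  have "V.dim {w :: nat \<Rightarrow> 'k. \<forall>i>2. w i = 0} = 3"
  proof (rule V.dim_unique)
    show "e ` {0, 1, 2} \<subseteq> {w. \<forall>i>2. w i = 0}"
      by (auto simp: e_def)
    show "card (e ` {0, 1, 2}) = 3"
      using inj by (subst card_image) auto
    show "{w. \<forall>i>2. w i = 0} \<subseteq> V.span (e ` {0, 1, 2})"
    proof
      fix w :: "nat \<Rightarrow> 'k" assume w: "w \<in> {w. \<forall>i>2. w i = 0}"
      have "w = (\<lambda>i. w 0 * e 0 i) + (\<lambda>i. w 1 * e 1 i) + (\<lambda>i. w 2 * e 2 i)"
      proof
        fix i :: nat
        consider "i = 0" | "i = 1" | "i = 2" | "i > 2" by linarith
        then show "w i = ((\<lambda>i. w 0 * e 0 i) + (\<lambda>i. w 1 * e 1 i) + (\<lambda>i. w 2 * e 2 i)) i"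
          using w by cases (auto simp: e_def)
      qed
      also have "\<dots> \<in> V.span (e ` {0, 1, 2})"
        by (intro V.span_add V.span_scale V.span_base) auto
      finally show "w \<in> V.span (e ` {0, 1, 2})" .
    qed
    show "V.independent (e ` {0, 1, 2})"
    proof (rule V.independent_if_scalars_zero)
      fix c x assume c: "(\<Sum>x\<in>e ` {0, 1, 2}. (\<lambda>i. c x * x i)) = 0" and x: "x \<in> e ` {0, 1, 2}"
      from c have "(\<Sum>k\<in>{0, 1, 2}. (\<lambda>i. c (e k) * e k i)) = 0"
        by (subst (asm) sum.reindex[OF inj]) (simp add: o_def)
      then have *: "(\<lambda>i. c (e 0) * e 0 i) + ((\<lambda>i. c (e 1) * e 1 i) + (\<lambda>i. c (e 2) * e 2 i)) = 0"
        by simp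
      show "c x = 0"
        using x fun_cong[OF *, of 0] fun_cong[OF *, of 1] fun_cong[OF *, of 2]
        by (auto simp: e_def)
    qed auto
  qed
  then show ?thesis
    unfolding curve_nonsingular_at_def tangent by simp
qed

end

section \<open>The plane curve as a variety\<close>

text \<open>An element of least degree in the ideal \<open>(f, g)\<close> divides constant multiples of both \<open>f\<close> and \<open>g\<close>,
  so it is constant.\<close>

lemma prime_elem_poly_elimination:
  fixes f g :: "'a::idom poly"
  assumes f: "prime_elem f" "degree f > 0" and g: "\<not> f dvd g"
  obtains c a b where "c \<noteq> 0" "[:c:] = a * f + b * g"
proof -
  define I where "I = {a * f + b * g |a b. True}"
  have I_f: "f \<in> I" unfolding I_def by (auto intro: exI[of _ 1] exI[of _ 0])
  have I_g: "g \<in> I" unfolding I_def by (auto intro: exI[of _ 1] exI[of _ 0])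
  have I_comb: "p * h - q * r \<in> I" if hr: "h \<in> I" "r \<in> I" for p q h r
  proof -
    obtain a b a' b' where "h = a * f + b * g" "r = a' * f + b' * g"
      using hr unfolding I_def by blast
    then have "p * h - q * r = (p * a - q * a') * f + (p * b - q * b') * g"
      by (simp add: algebra_simps)
    then show ?thesis unfolding I_def by blast
  qed
  have "f \<in> I \<and> f \<noteq> 0" using I_f f by auto
  then obtain r where r: "r \<in> I" "r \<noteq> 0" and min: "\<And>s. s \<in> I \<Longrightarrow> s \<noteq> 0 \<Longrightarrow> degree r \<le> degree s"
    using ex_has_least_nat[of "\<lambda>r. r \<in> I \<and> r \<noteq> 0" f degree] by blast
  have reduce: "\<exists>c q. c \<noteq> 0 \<and> smult c h = r * q" if "h \<in> I" for h
  proof -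
    obtain c q where cq: "c \<noteq> 0" "smult c h = r * q + pseudo_mod h r"
      using pseudo_mod(1)[OF r(2)] by blast
    then have "pseudo_mod h r = [:c:] * h - q * r" by (simp add: algebra_simps)
    then have "pseudo_mod h r \<in> I" using I_comb[OF that r(1)] by metis
    then have "pseudo_mod h r = 0"
      using pseudo_mod(2)[OF r(2)] min leD by blast
    then show ?thesis using cq by auto
  qed
  have "degree r = 0"
  proof (rule ccontr)
    assume deg: "degree r \<noteq> 0"
    obtain c q where q: "c \<noteq> 0" "smult c f = r * q" using reduce[OF I_f] by blast
    obtain c' q' where q': "c' \<noteq> 0" "smult c' g = r * q'" using reduce[OF I_g] by blast
    have "f dvd r * q" unfolding q(2)[symmetric] by (rule dvd_smult) simp
    \<comment> \<open>If \<open>f\<close> divides \<open>r\<close>, it divides \<open>c' g\<close>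
      and hence the constant \<open>c'\<close>. If it divides \<open>q\<close>, cancelling
      \<open>f\<close> makes \<open>r\<close> a factor of a nonzero constant. Both contradict
      positive degrees.\<close>
    then consider "f dvd r" | "f dvd q"
      using f(1) by (auto simp: prime_elem_dvd_mult_iff)
    then show False
    proof cases
      case 1
      then have "f dvd [:c':] * g" using q'(2) by simp
      then have "f dvd [:c':]"
        using f(1) g by (auto simp: prime_elem_dvd_mult_iff simp del: mult_pCons_left)
      then have "degree f \<le> degree [:c':]"
        using q' by (intro dvd_imp_degree_le) auto
      then show False using f by simp
    next
      case 2
      then obtain u where u: "q = f * u" by blast
      have "f * ([:c:] - r * u) = 0"
        using q(2) by (simp add: u algebra_simps)
      then have ru: "r * u = [:c:]" using f by auto
      then have "degree (r * u) = 0" "r * u \<noteq> 0" using q(1) by simp_all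
      then show False using deg by (auto simp: degree_mult_eq)
    qed
  qed
  then obtain c where "r = [:c:]" by (rule degree_eq_zeroE)
  then show ?thesis
    using r that unfolding I_def by auto
qed

definition plane_point :: "'k::field \<Rightarrow> 'k \<Rightarrow> 'k \<Rightarrow> (nat \<Rightarrow> 'k)" where
  "plane_point a b c = (\<lambda>i. if i = 0 then a else if i = 1 then b else if i = 2 then c else 0)"

lemma in_point_of_plane_point:
  assumes "v \<in> proj_space 2" "c \<noteq> 0"
  shows "v \<in> point_of (plane_point (v 0 / c) (v 1 / c) (v 2 / c))"
  unfolding point_of_def same_point_def
proof (intro CollectI exI[of _ c] conjI ext)
  fix i :: nat
  consider "i = 0" | "i = 1" | "i = 2" | "i > 2" by linarith
  then show "v i = c * plane_point (v 0 / c) (v 1 / c) (v 2 / c) i"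
    using assms by cases (auto simp: plane_point_def proj_space_def)
qed (rule assms)

context howe_pair
begin

lemma projective_variety_plane_curve:
  assumes "prime_elem f"
  shows "projective_variety 2 C"
proof (rule projective_varietyI)
  fix d e \<phi> \<psi>
  assume \<phi>: "form_function 2 d \<phi>" and \<psi>: "form_function 2 e \<psi>"
    and zero: "\<And>v. v \<in> C \<Longrightarrow> \<phi> v * \<psi> v = 0"
  obtain g where g: "total_degree_le d g" "\<phi> = homog d g"
    using form_function_2_eq_homog[OF \<phi>] by blast
  obtain h where h: "total_degree_le e h" "\<psi> = homog e h"
    using form_function_2_eq_homog[OF \<psi>] by blast
  have "f dvd g * h"
    using zero form_vanishes_iff_dvd(1)[OF total_degree_le_mult[OF g(1) h(1)]]
    by (simp add: homog_mult[OF g(1) h(1)] g h)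
  then have "f dvd g \<or> f dvd h" using assms by (simp add: prime_elem_dvd_mult_iff)
  then show "(\<forall>v\<in>C. \<phi> v = 0) \<or> (\<forall>v\<in>C. \<psi> v = 0)"
    using form_vanishes_iff_dvd(2)[OF g(1)] form_vanishes_iff_dvd(2)[OF h(1)] g h by blast
qed (use proj_closed_plane_curve infinity_in_curve in auto)

text \<open>A form that vanishes on \<open>Z\<close> but not on the whole curve is no multiple of
  \<open>f\<close>. Eliminating y leaves a nonzero polynomial in x, so \<open>Z\<close> has finitely
  many affine points, and the curve has finitely many points at infinity. An irreducible set covered
  by finitely many points lies in one of them.\<close>

lemma proper_subvariety_is_point:
  assumes "prime_elem f" and Z: "projective_variety 2 Z" "Z \<subset> C"
  shows "\<exists>p. Z \<subseteq> point_of p"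
proof -
  obtain c where c: "c \<in> C" "c \<notin> Z" using Z by blast
  obtain d \<phi> where \<phi>: "form_function 2 d \<phi>" "\<And>u. u \<in> Z \<Longrightarrow> \<phi> u = 0" "\<phi> c \<noteq> 0"
    using proj_closed_form[OF projective_variety_closed[OF Z(1)] _ c(2)] c
      proj_closed_subset[OF proj_closed_plane_curve] by blast
  obtain g where g: "total_degree_le d g" "\<phi> = homog d g"
    using form_function_2_eq_homog[OF \<phi>(1)] by blast
  have "\<not> f dvd g" using form_vanishes_iff_dvd(2)[OF g(1)] \<phi> g c by blast
  then obtain N a b where N: "N \<noteq> 0" "[:N:] = a * f + b * g"
    using prime_elem_poly_elimination[OF assms(1)] howe_sextic_degree(1)[of \<alpha> \<beta>] by (metis zero_less_numeral)
  \<comment> \<open>Affine candidates: x is a root of the eliminant, y a root of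
    \<open>f(x, -)\<close>, which is nonzero because \<open>f\<close> is monic in y.\<close>
  define A where "A = (\<lambda>(x, y). plane_point 1 x y) `
    (SIGMA x:{x. poly N x = 0}. {y. poly (slice x f) y = 0})"
  \<comment> \<open>Candidates (0 : 1 : y) at infinity, where \<open>c60 = 4 y^2\<close>.\<close>
  define B where "B = (\<lambda>y. plane_point 0 1 y) `
    {y. poly [:poly.coeff (poly.coeff f 0) 6, 0, - 4:] y = 0}"
  have slice: "slice x f \<noteq> 0" for x
  proof -
    have "poly.coeff (slice x f) 4 = 1"
      using howe_sextic_degree[of \<alpha> \<beta>] by (simp add: coeff_slice)
    then show ?thesis by auto
  qed
  have fin: "finite A" "finite B"
    unfolding A_def B_def using N(1) slice four
    by (auto intro!: finite_imageI finite_SigmaI poly_roots_finite simp del: poly_pCons)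
  have cover: "\<exists>p\<in>insert infinity (A \<union> B). v \<in> point_of p" if v: "v \<in> Z" for v
  proof -
    have vC: "v \<in> proj_space 2" "homog 6 f v = 0" "homog d g v = 0"
      using Z(2) v \<phi>(2)[OF v] by (auto simp: g plane_curve_eq)
    consider "v 0 \<noteq> 0" | "v 0 = 0" "v 1 \<noteq> 0" | "v 0 = 0" "v 1 = 0" by blast
    then show ?thesis
    proof cases
      case 1
      let ?x = "v 1 / v 0" and ?y = "v 2 / v 0"
      have fg: "bipoly f ?x ?y = 0" "bipoly g ?x ?y = 0"
        using vC 1 by (simp_all add: homog_affine[OF total_degree_le_howe_sextic] homog_affine[OF g(1)])
      have "bipoly [:N:] ?x ?y = 0"
        unfolding N(2) bipoly_add bipoly_mult fg by simp
      then have "poly N ?x = 0" by (simp add: bipoly_def)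
      then have "plane_point 1 ?x ?y \<in> A"
        unfolding A_def using fg(1) by (intro image_eqI[of _ _ "(?x, ?y)"]) (auto simp: poly_slice)
      moreover have "v \<in> point_of (plane_point 1 ?x ?y)"
        using in_point_of_plane_point[OF vC(1) 1] 1 by simp
      ultimately show ?thesis by blast
    next
      case 2
      let ?y = "v 2 / v 1"
      have eq: "poly.coeff (poly.coeff f 0) 6 * v 1 ^ 6 - 4 * v 1 ^ 4 * v 2 ^ 2 =
          v 1 ^ 6 * (poly.coeff (poly.coeff f 0) 6 - 4 * ?y ^ 2)"
        using 2 by (simp add: field_simps power_numeral_reduce)
      have "poly.coeff (poly.coeff f 0) 6 - 4 * ?y ^ 2 = 0"
        using vC(2) 2 unfolding homog_howe_sextic_at_infinity[of v, OF 2(1)] eq by simp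
      then have "poly [:poly.coeff (poly.coeff f 0) 6, 0, - 4:] ?y = 0"
        by (simp add: power2_eq_square algebra_simps)
      then have "plane_point 0 1 ?y \<in> B" unfolding B_def by blast
      moreover have "v \<in> point_of (plane_point 0 1 ?y)"
        using in_point_of_plane_point[OF vC(1) 2(2)] 2 by simp
      ultimately show ?thesis by blast
    next
      case 3
      then have "v 2 \<noteq> 0"
        using vC(1) by (auto simp: proj_space_def) (metis One_nat_def less_2_cases linorder_neqE_nat)
      moreover have "plane_point 0 0 1 = infinity"
        by (auto simp: plane_point_def infinity_def)
      ultimately have "v \<in> point_of infinity"
        using in_point_of_plane_point[OF vC(1), of "v 2"] 3 by simp
      then show ?thesis by blast
    qed
  qed
  have "A \<union> B \<subseteq> proj_space 2"
    by (auto simp: A_def B_def proj_space_def plane_point_def intro: exI[of _ 0] exI[of _ 1])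
  then have closed: "proj_closed 2 (point_of p)" if "p \<in> insert infinity (A \<union> B)" for p
    using that infinity_in_curve by (auto intro!: proj_closed_point)
  show ?thesis
    using projective_variety_subset_Union[OF Z(1), of "point_of ` insert infinity (A \<union> B)"]
      fin closed cover by blast
qed

lemma has_dimension_plane_curve:
  assumes "prime_elem f"
  shows "has_dimension 2 C 1"
  unfolding has_dimension_def
proof (intro conjI allI impI)
  have sub: "point_of infinity \<subseteq> C"
    using proj_closed_scale[OF proj_closed_plane_curve infinity_in_curve(2)]
    by (auto simp: point_of_def same_point_def)
  obtain v where v: "v \<in> C" "v 0 \<noteq> 0" using affine_point_in_curve by blast
  have "v \<notin> point_of infinity" using v by (auto simp: point_of_def same_point_def infinity_def)
  then have "point_of infinity \<subset> C" using sub v by blast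
  then show "variety_chain 2 C 1"
    unfolding variety_chain_def
    using projective_variety_plane_curve[OF assms] projective_variety_point[OF infinity_in_curve(1)]
    by (intro exI[of _ "\<lambda>i. if i = 0 then point_of infinity else C"]) auto
next
  fix e assume "variety_chain 2 C e"
  then obtain Z where Z: "\<And>i. i \<le> e \<Longrightarrow> projective_variety 2 (Z i) \<and> Z i \<subseteq> C"
      "\<And>i. i < e \<Longrightarrow> Z i \<subset> Z (Suc i)"
    unfolding variety_chain_def by blast
  show "e \<le> 1"
  proof (rule ccontr)
    assume "\<not> e \<le> 1"
    then have Z012: "projective_variety 2 (Z 0)" "projective_variety 2 (Z 1)" "Z 2 \<subseteq> C"
        "Z 0 \<subset> Z 1" "Z 1 \<subset> Z 2"
      using Z(1)[of 0] Z(1)[of 1] Z(1)[of 2] Z(2)[of 0] Z(2)[of 1] by (simp_all add: numeral_2_eq_2)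
    \<comment> \<open>\<open>Z 1\<close> is a proper subvariety, hence inside a point, which leaves
      no room for \<open>Z 0\<close> strictly below it.\<close>
    then obtain p where p: "Z 1 \<subseteq> point_of p"
      using proper_subvariety_is_point[OF assms, of "Z 1"] by blast
    have "point_of p \<subseteq> Z 0"
      using Z012 p by (intro point_of_subset_closed[of 2]) (auto simp: projective_variety_def)
    then show False using p Z012 by blast
  qed
qed

lemma singular_plane_curve:
  assumes "prime_elem f"
  shows "singular_curve 2 C"
  unfolding singular_curve_def projective_curve_def
  using projective_variety_plane_curve[OF assms] has_dimension_plane_curve[OF assms]
    singular_at_infinity infinity_in_curve by blast

end

section \<open>Composition of birational maps\<close>

lemma same_point_scale: "c \<noteq> 0 \<Longrightarrow> same_point v (\<lambda>i. c * v i)"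
  unfolding same_point_def by blast

lemma same_point_sym: "same_point v w \<Longrightarrow> same_point w v"
  unfolding same_point_def
proof (elim exE conjE)
  fix c assume "c \<noteq> 0" "w = (\<lambda>i. c * v i)"
  then show "\<exists>c. c \<noteq> 0 \<and> v = (\<lambda>i. c * w i)"
    by (intro exI[of _ "1 / c"]) auto
qed

lemma same_point_trans:
  assumes "same_point u v" "same_point v w"
  shows "same_point u w"
proof -
  obtain b c where "b \<noteq> 0" "v = (\<lambda>i. b * u i)" "c \<noteq> 0" "w = (\<lambda>i. c * v i)"
    using assms unfolding same_point_def by blast
  then show ?thesis unfolding same_point_def by (intro exI[of _ "c * b"]) auto
qed

lemma same_point_proj_space: "same_point v w \<Longrightarrow> v \<in> proj_space n \<longleftrightarrow> w \<in> proj_space n"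
  by (auto simp: same_point_def proj_space_def)

lemma same_point_closed:
  assumes "proj_closed n V" "same_point v w"
  shows "v \<in> V \<longleftrightarrow> w \<in> V"
proof -
  have "w \<in> V" if "v \<in> V" "same_point v w" for v w
    using that proj_closed_scale[OF assms(1) that(1)] unfolding same_point_def by auto
  then show ?thesis using assms(2) same_point_sym by blast
qed

lemma same_point_form:
  assumes "form_function n d \<phi>" "same_point v w"
  shows "\<phi> v = 0 \<longleftrightarrow> \<phi> w = 0"
  using assms(2) form_function_scale[OF assms(1)] by (auto simp: same_point_def)

lemma same_point_tuple_eval:
  assumes "form_tuple n m F" "same_point v w"
  shows "same_point (tuple_eval m F v) (tuple_eval m F w)"
proof -
  obtain d where d: "\<And>i. i \<le> m \<Longrightarrow> form_function n d (peval (F i))"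
    using assms(1) form_functionI unfolding form_tuple_def by blast
  obtain c where c: "c \<noteq> 0" "w = (\<lambda>i. c * v i)"
    using assms(2) unfolding same_point_def by blast
  show ?thesis
    unfolding same_point_def
  proof (intro exI[of _ "c ^ d"] conjI ext)
    fix i show "tuple_eval m F w i = c ^ d * tuple_eval m F v i"
      using form_function_scale[OF d] unfolding tuple_eval_def c by auto
  qed (use c in auto)
qed

lemma tuple_eval_in_proj_space:
  "tuple_eval m F v \<in> proj_space m \<longleftrightarrow> (\<exists>i\<le>m. peval (F i) v \<noteq> 0)"
  by (auto simp: tuple_eval_def proj_space_def)

text \<open>Passes from coordinate functions, for which the \<open>form_function\<close> rules
  apply, back to the tuples of forms that \<open>rational_map\<close> demands.\<close>

lemma form_tuple_choice:
  assumes "\<And>i. i \<le> m \<Longrightarrow> form_function n d (\<lambda>v. T v i)"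
  shows "\<exists>F. form_tuple n m F \<and> (\<forall>v. tuple_eval m F v = (\<lambda>i. if i \<le> m then T v i else 0))"
proof -
  obtain F where F: "\<And>i. i \<le> m \<Longrightarrow> is_form n d (F i) \<and> (\<lambda>v. T v i) = peval (F i)"
    using assms unfolding form_function_def by metis
  have "peval (F i) v = T v i" if "i \<le> m" for i v
    using F[OF that] by metis
  then have "tuple_eval m F v = (\<lambda>i. if i \<le> m then T v i else 0)" for v
    by (auto simp: tuple_eval_def)
  moreover have "form_tuple n m F"
    unfolding form_tuple_def using F by blast
  ultimately show ?thesis by blast
qed

text \<open>The composite of \<open>F\<close> and \<open>S\<close> is multiplied by a component of \<open>F\<close>, so that it vanishes where
  \<open>F\<close> vanishes even if \<open>S\<close> is a tuple of constants.\<close>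

lemma composite_exists:
  assumes F: "form_tuple n m F" and S: "form_tuple m k S" and b: "b \<le> m"
  obtains K where "form_tuple n k K"
    "\<And>v. tuple_eval k K v = (\<lambda>i. peval (F b) v * tuple_eval k S (tuple_eval m F v) i)"
proof -
  obtain d where d: "\<And>i. i \<le> m \<Longrightarrow> form_function n d (peval (F i))"
    using F form_functionI unfolding form_tuple_def by blast
  obtain e where e: "\<And>i. i \<le> k \<Longrightarrow> form_function m e (peval (S i))"
    using S form_functionI unfolding form_tuple_def by blast
  have "form_function n (d + e * d) (\<lambda>v. peval (F b) v * peval (S i) (tuple_eval m F v))" if "i \<le> k" for i
    by (intro form_function_mult d b form_function_compose[OF e[OF that]])
       (use d in \<open>simp add: tuple_eval_def\<close>)
  then obtain K where K: "form_tuple n k K"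
      "\<And>v. tuple_eval k K v = (\<lambda>i. if i \<le> k then peval (F b) v * peval (S i) (tuple_eval m F v) else 0)"
    using form_tuple_choice[of k n "d + e * d" "\<lambda>v i. peval (F b) v * peval (S i) (tuple_eval m F v)"] by blast
  then show ?thesis
    by (intro that[of K]) (auto simp: tuple_eval_def[of k S])
qed

lemma rational_map_composite:
  assumes F: "rational_map n V m W F" and S: "rational_map m W k U S"
    and K: "form_tuple n k K"
      "\<And>v. tuple_eval k K v = (\<lambda>i. peval (F b) v * tuple_eval k S (tuple_eval m F v) i)" and b: "b \<le> m"
    and v: "v \<in> V" "peval (F b) v \<noteq> 0" "tuple_eval k S (tuple_eval m F v) \<in> proj_space k"
  shows "rational_map n V k U K"
proof -
  have scale: "same_point (tuple_eval k S (tuple_eval m F w)) (tuple_eval k K w)" if "peval (F b) w \<noteq> 0" for w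
    unfolding K using that by (rule same_point_scale)
  have U: "projective_variety k U" using S by (simp add: rational_map_def)
  have "tuple_eval k K w \<in> U" if w: "w \<in> V" "tuple_eval k K w \<in> proj_space k" for w
  proof -
    have Fw: "peval (F b) w \<noteq> 0" using w(2) by (auto simp: K proj_space_def)
    then have "tuple_eval m F w \<in> W"
      using F w(1) b by (auto simp: rational_map_def tuple_eval_in_proj_space)
    moreover have "tuple_eval k S (tuple_eval m F w) \<in> proj_space k"
      using w(2) same_point_proj_space[OF scale[OF Fw]] by blast
    ultimately have "tuple_eval k S (tuple_eval m F w) \<in> U"
      using S by (auto simp: rational_map_def)
    then show ?thesis
      using same_point_closed[OF projective_variety_closed[OF U] scale[OF Fw]] by blast
  qed
  moreover have "tuple_eval k K v \<in> proj_space k"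
    using v same_point_proj_space[OF scale] by blast
  ultimately show ?thesis
    using F S K(1) v unfolding rational_map_def by blast
qed

lemma rational_left_inverseD:
  assumes "rational_left_inverse n V m F G" "v \<in> V" "tuple_eval m F v \<in> proj_space m"
    "tuple_eval n G (tuple_eval m F v) \<in> proj_space n"
  shows "same_point v (tuple_eval n G (tuple_eval m F v))"
  using assms unfolding rational_left_inverse_def Let_def by blast

text \<open>Up to scaling, \<open>w\<close> is \<open>G (F w)\<close>, which is
  \<open>G (T (S (F w)))\<close> because \<open>T\<close> undoes \<open>S\<close> at
  \<open>F w\<close>, which is \<open>L (K w)\<close>. That \<open>L (K w)\<close> is nonzero is
  propagated backwards to make the intermediate maps defined; \<open>v\<close> witnesses a nonempty
  domain.\<close>

lemma rational_left_inverse_composite: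
  assumes F: "rational_map n V m W F" and S: "form_tuple m k S"
    and T: "form_tuple k m T" and G: "form_tuple m n G"
    and FG: "rational_left_inverse n V m F G" and ST: "rational_left_inverse m W k S T"
    and K: "\<And>v. tuple_eval k K v = (\<lambda>i. peval (F b) v * tuple_eval k S (tuple_eval m F v) i)"
    and L: "form_tuple k n L"
      "\<And>u. tuple_eval n L u = (\<lambda>i. peval (T d) u * tuple_eval n G (tuple_eval m T u) i)"
    and b: "b \<le> m" and d: "d \<le> m"
    and v: "v \<in> V" "peval (F b) v \<noteq> 0" "tuple_eval k S (tuple_eval m F v) \<in> proj_space k"
      "peval (T d) (tuple_eval k S (tuple_eval m F v)) \<noteq> 0"
      "tuple_eval n G (tuple_eval m T (tuple_eval k S (tuple_eval m F v))) \<in> proj_space n"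
  shows "rational_left_inverse n V k K L"
proof -
  let ?F = "tuple_eval m F" and ?S = "tuple_eval k S" and ?T = "tuple_eval m T" and ?G = "tuple_eval n G"
  have K_scale: "same_point (?S (?F w)) (tuple_eval k K w)" if "peval (F b) w \<noteq> 0" for w
    unfolding K using that by (rule same_point_scale)
  have L_scale: "same_point (?G (?T u)) (tuple_eval n L u)" if "peval (T d) u \<noteq> 0" for u
    unfolding L using that by (rule same_point_scale)
  obtain e where e: "form_function k e (peval (T d))"
    using T d form_functionI unfolding form_tuple_def by blast
  have "same_point w (tuple_eval n L (tuple_eval k K w))"
    if w: "w \<in> V" "tuple_eval k K w \<in> proj_space k" "tuple_eval n L (tuple_eval k K w) \<in> proj_space n" for w
  proof -
    have Fw: "peval (F b) w \<noteq> 0" using w(2) by (auto simp: K proj_space_def)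
    then have FwW: "?F w \<in> proj_space m" "?F w \<in> W"
      using F w(1) b by (auto simp: rational_map_def tuple_eval_in_proj_space)
    have SFw: "?S (?F w) \<in> proj_space k"
      using w(2) same_point_proj_space[OF K_scale[OF Fw]] by blast
    have LK: "same_point (tuple_eval n L (?S (?F w))) (tuple_eval n L (tuple_eval k K w))"
      by (rule same_point_tuple_eval[OF L(1) K_scale[OF Fw]])
    then have L_nz: "tuple_eval n L (?S (?F w)) \<in> proj_space n"
      using w(3) same_point_proj_space by blast
    then have Td: "peval (T d) (?S (?F w)) \<noteq> 0" by (auto simp: L(2) proj_space_def)
    then have "?T (?S (?F w)) \<in> proj_space m"
      using d by (auto simp: tuple_eval_in_proj_space)
    then have "same_point (?F w) (?T (?S (?F w)))"
      using rational_left_inverseD[OF ST FwW(2) SFw] by blast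
    then have GT: "same_point (?G (?F w)) (?G (?T (?S (?F w))))"
      by (rule same_point_tuple_eval[OF G])
    have GL: "same_point (?G (?T (?S (?F w)))) (tuple_eval n L (?S (?F w)))"
      using Td by (rule L_scale)
    have GF: "same_point (?G (?F w)) (tuple_eval n L (tuple_eval k K w))"
      by (rule same_point_trans[OF GT same_point_trans[OF GL LK]])
    then have "?G (?F w) \<in> proj_space n" using w(3) same_point_proj_space by blast
    then have "same_point w (?G (?F w))"
      using rational_left_inverseD[OF FG w(1) FwW(1)] by blast
    then show ?thesis using GF by (rule same_point_trans)
  qed
  moreover have "tuple_eval k K v \<in> proj_space k"
    using v same_point_proj_space[OF K_scale] by blast
  moreover have "tuple_eval n L (tuple_eval k K v) \<in> proj_space n"
  proof -
    have "same_point (tuple_eval n L (?S (?F v))) (tuple_eval n L (tuple_eval k K v))"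
      by (rule same_point_tuple_eval[OF L(1) K_scale[OF v(2)]])
    moreover have "tuple_eval n L (?S (?F v)) \<in> proj_space n"
      using v(5) same_point_proj_space[OF L_scale[OF v(4)]] by blast
    ultimately show ?thesis using same_point_proj_space by blast
  qed
  ultimately show ?thesis
    unfolding rational_left_inverse_def Let_def using v(1) by blast
qed

text \<open>On the middle variety \<open>W\<close>, \<open>F\<close> after \<open>G\<close> and
  \<open>T\<close> after \<open>S\<close> are each defined on a nonempty open set. Irreducibility
  supplies a common point \<open>w\<close>, and \<open>?G w\<close> and \<open>?S w\<close> then
  witness the domains of the composites in the two directions.\<close>

lemma birational_trans:
  assumes "birational n V m W" "birational m W k U"
  shows "birational n V k U"
proof -
  obtain F G where FG: "rational_map n V m W F" "rational_map m W n V G"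
      "rational_left_inverse n V m F G" "rational_left_inverse m W n G F"
    using assms(1) unfolding birational_def birational_pair_def by blast
  obtain S T where ST: "rational_map m W k U S" "rational_map k U m W T"
      "rational_left_inverse m W k S T" "rational_left_inverse k U m T S"
    using assms(2) unfolding birational_def birational_pair_def by blast
  let ?F = "tuple_eval m F" and ?S = "tuple_eval k S" and ?T = "tuple_eval m T" and ?G = "tuple_eval n G"
  note tuples = FG(1,2)[unfolded rational_map_def] ST(1,2)[unfolded rational_map_def]
  have forms: "form_tuple n m F" "form_tuple m n G" "form_tuple m k S" "form_tuple k m T"
    using tuples by blast+
  have W: "projective_variety m W" using tuples by blast
  obtain w1 where w1: "w1 \<in> W" "?G w1 \<in> proj_space n" "?F (?G w1) \<in> proj_space m"
    using FG(4) unfolding rational_left_inverse_def Let_def by blast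
  obtain w2 where w2: "w2 \<in> W" "?S w2 \<in> proj_space k" "?T (?S w2) \<in> proj_space m"
    using ST(3) unfolding rational_left_inverse_def Let_def by blast
  obtain a b where ab: "a \<le> n" "peval (G a) w1 \<noteq> 0" "b \<le> m" "peval (F b) (?G w1) \<noteq> 0"
    using w1 by (auto simp: tuple_eval_in_proj_space)
  obtain c d where cd: "c \<le> k" "peval (S c) w2 \<noteq> 0" "d \<le> m" "peval (T d) (?S w2) \<noteq> 0"
    using w2 by (auto simp: tuple_eval_in_proj_space)
  obtain dF where dF: "\<And>i. i \<le> m \<Longrightarrow> form_function n dF (peval (F i))"
    using forms(1) form_functionI unfolding form_tuple_def by blast
  obtain dG where dG: "\<And>i. i \<le> n \<Longrightarrow> form_function m dG (peval (G i))"
    using forms(2) form_functionI unfolding form_tuple_def by blast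
  obtain dS where dS: "\<And>i. i \<le> k \<Longrightarrow> form_function m dS (peval (S i))"
    using forms(3) form_functionI unfolding form_tuple_def by blast
  obtain dT where dT: "\<And>i. i \<le> m \<Longrightarrow> form_function k dT (peval (T i))"
    using forms(4) form_functionI unfolding form_tuple_def by blast
  \<comment> \<open>Where these two forms are nonzero, \<open>G\<close> and then \<open>F\<close>,
    respectively \<open>S\<close> and then \<open>T\<close>, are defined.\<close>
  have open1: "form_function m (dG + dF * dG) (\<lambda>w. peval (G a) w * peval (F b) (?G w))"
    by (intro form_function_mult dG ab form_function_compose[OF dF[OF ab(3)]])
       (use dG in \<open>simp add: tuple_eval_def\<close>)
  have open2: "form_function m (dS + dT * dS) (\<lambda>w. peval (S c) w * peval (T d) (?S w))"
    by (intro form_function_mult dS cd form_function_compose[OF dT[OF cd(3)]])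
       (use dS in \<open>simp add: tuple_eval_def\<close>)
  obtain w where w: "w \<in> W" "peval (G a) w \<noteq> 0" "peval (F b) (?G w) \<noteq> 0"
      "peval (S c) w \<noteq> 0" "peval (T d) (?S w) \<noteq> 0"
    using projective_variety_nonzero[OF W open1 open2 w1(1) _ w2(1)] ab cd by auto
  have Gw: "?G w \<in> proj_space n" "?G w \<in> V" and FGw: "?F (?G w) \<in> proj_space m"
    using w ab tuples by (auto simp: tuple_eval_in_proj_space)
  have Sw: "?S w \<in> proj_space k" "?S w \<in> U" and TSw: "?T (?S w) \<in> proj_space m"
    using w cd tuples by (auto simp: tuple_eval_in_proj_space)
  have wF: "same_point w (?F (?G w))"
    by (rule rational_left_inverseD[OF FG(4) w(1) Gw(1) FGw])
  have wT: "same_point w (?T (?S w))"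
    by (rule rational_left_inverseD[OF ST(3) w(1) Sw(1) TSw])
  have SF: "same_point (?S w) (?S (?F (?G w)))" by (rule same_point_tuple_eval[OF forms(3) wF])
  have GT: "same_point (?G w) (?G (?T (?S w)))" by (rule same_point_tuple_eval[OF forms(2) wT])
  have TSF: "same_point w (?T (?S (?F (?G w))))"
    by (rule same_point_trans[OF wT same_point_tuple_eval[OF forms(4) SF]])
  have FGT: "same_point w (?F (?G (?T (?S w))))"
    by (rule same_point_trans[OF wF same_point_tuple_eval[OF forms(1) GT]])
  have GTSF: "?G (?T (?S (?F (?G w)))) \<in> proj_space n"
    using same_point_proj_space[OF same_point_tuple_eval[OF forms(2) TSF]] Gw by blast
  have SFGT: "?S (?F (?G (?T (?S w)))) \<in> proj_space k"
    using same_point_proj_space[OF same_point_tuple_eval[OF forms(3) FGT]] Sw by blast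
  have SF_nz: "?S (?F (?G w)) \<in> proj_space k" "peval (T d) (?S (?F (?G w))) \<noteq> 0"
    using same_point_proj_space[OF SF] same_point_form[OF dT[OF cd(3)] SF] Sw w by auto
  have GT_nz: "?G (?T (?S w)) \<in> proj_space n" "peval (F b) (?G (?T (?S w))) \<noteq> 0"
    using same_point_proj_space[OF GT] same_point_form[OF dF[OF ab(3)] GT] Gw w by auto
  obtain K where K: "form_tuple n k K"
      "\<And>v. tuple_eval k K v = (\<lambda>i. peval (F b) v * ?S (?F v) i)"
    using composite_exists[OF forms(1,3) ab(3)] by blast
  obtain L where L: "form_tuple k n L"
      "\<And>u. tuple_eval n L u = (\<lambda>i. peval (T d) u * ?G (?T u) i)"
    using composite_exists[OF forms(4,2) cd(3)] by blast
  have "rational_map n V k U K"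
    by (rule rational_map_composite[OF FG(1) ST(1) K ab(3) Gw(2) w(3) SF_nz(1)])
  moreover have "rational_map k U n V L"
    by (rule rational_map_composite[OF ST(2) FG(2) L cd(3) Sw(2) w(5) GT_nz(1)])
  moreover have "rational_left_inverse n V k K L"
    by (rule rational_left_inverse_composite[OF FG(1) forms(3,4,2) FG(3) ST(3) K(2) L ab(3) cd(3)
          Gw(2) w(3) SF_nz GTSF])
  moreover have "rational_left_inverse k U n L K"
    by (rule rational_left_inverse_composite[OF ST(2) forms(2,1,3) ST(4) FG(4) L(2) K cd(3) ab(3)
          Sw(2) w(5) GT_nz SFGT])
  ultimately show ?thesis
    unfolding birational_def birational_pair_def by blast
qed

section \<open>The fiber product\<close>

definition quartic_point :: "'k::field \<Rightarrow> 'k \<Rightarrow> (nat \<Rightarrow> 'k)" where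
  "quartic_point x a = (\<lambda>i. if i = 0 then 1 else if i = 1 then x else if i = 2 then x ^ 2 else if i = 3 then a else 0)"

definition fiber_point :: "'k::field \<Rightarrow> 'k \<Rightarrow> 'k \<Rightarrow> (nat \<Rightarrow> 'k)" where
  "fiber_point x a b = segre 3 3 (quartic_point x a) (quartic_point x b)"

text \<open>The product \<open>P i * Q j\<close> has Segre index \<open>4 * i + j\<close>, which
  explains the indices 4, 3 and 12.\<close>

lemma fiber_point_coords:
  "fiber_point x a b 0 = 1" "fiber_point x a b 4 = x" "fiber_point x a b 3 = b" "fiber_point x a b 12 = a"
  by (simp_all add: fiber_point_def segre_def quartic_point_def)

lemma poly_quartic_esym:
  "poly (quartic \<gamma>) x = x ^ 4 - esym \<gamma> 1 * x ^ 3 + esym \<gamma> 2 * x ^ 2 - esym \<gamma> 3 * x + esym \<gamma> 4"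
proof -
  have A: "{1..4} = {1, 2, 3, 4 :: nat}" by auto
  show ?thesis
    unfolding poly_quartic A esym_4 by (simp add: algebra_simps power_numeral_reduce)
qed

lemma quartic_point_in_curve:
  assumes "a ^ 2 = poly (quartic \<gamma>) x" "c \<noteq> 0"
  shows "(\<lambda>i. c * quartic_point x a i) \<in> quartic_curve \<gamma>"
proof -
  have "(\<lambda>i. c * quartic_point x a i) \<in> proj_space 3"
    using assms(2) by (auto simp: proj_space_def quartic_point_def intro: exI[of _ 0])
  moreover have "(c * a) ^ 2 = c ^ 2 * poly (quartic \<gamma>) x"
    by (simp add: power_mult_distrib assms)
  ultimately show ?thesis
    unfolding quartic_curve_def
    by (simp add: quartic_point_def poly_quartic_esym algebra_simps power_numeral_reduce)
qed

lemma quartic_curve_affineD: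
  assumes P: "P \<in> quartic_curve \<gamma>" "P 0 \<noteq> 0"
  obtains a where "a ^ 2 = poly (quartic \<gamma>) (P 1 / P 0)" "P = (\<lambda>i. P 0 * quartic_point (P 1 / P 0) a i)"
proof (rule that[of "P 3 / P 0"])
  have eq: "P 0 * P 2 = P 1 ^ 2" "P 3 ^ 2 = P 2 ^ 2 - esym \<gamma> 1 * (P 1 * P 2) + esym \<gamma> 2 * P 1 ^ 2
               - esym \<gamma> 3 * (P 0 * P 1) + esym \<gamma> 4 * P 0 ^ 2" and P3: "P \<in> proj_space 3"
    using P by (auto simp: quartic_curve_def)
  define x where "x = P 1 / P 0"
  have P1: "P 1 = P 0 * x" using P(2) by (simp add: x_def)
  have "P 0 * P 2 = P 0 * (P 0 * x ^ 2)" unfolding eq(1) P1 by (simp add: power2_eq_square)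
  then have P2: "P 2 = P 0 * x ^ 2" using P(2) by simp
  have "P 3 ^ 2 = P 0 ^ 2 * poly (quartic \<gamma>) x"
    unfolding eq(2) P1 P2 poly_quartic_esym by (simp add: algebra_simps power_numeral_reduce)
  then show "(P 3 / P 0) ^ 2 = poly (quartic \<gamma>) (P 1 / P 0)"
    using P(2) by (simp add: power_divide x_def)
  show "P = (\<lambda>i. P 0 * quartic_point (P 1 / P 0) (P 3 / P 0) i)"
  proof
    fix i :: nat
    consider "i = 0" | "i = 1" | "i = 2" | "i = 3" | "i > 3" by linarith
    then show "P i = P 0 * quartic_point (P 1 / P 0) (P 3 / P 0) i"
      unfolding x_def[symmetric] using P(2) P3 by cases (auto simp: quartic_point_def P1[unfolded One_nat_def] P2 proj_space_def)
  qed
qed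

text \<open>At \<open>P 0 = 0\<close> the equations reduce to \<open>P 1 = 0\<close> and
  \<open>P 3 ^ 2 = P 2 ^ 2\<close>, so \<open>P 2 = 0\<close> would make all coordinates
  vanish.\<close>

lemma quartic_curve_infinityD:
  assumes "P \<in> quartic_curve \<gamma>" "P 0 = 0"
  shows "P 1 = 0" "P 2 \<noteq> 0"
proof -
  have eq: "P 1 ^ 2 = 0" "P 3 ^ 2 = P 2 ^ 2 - esym \<gamma> 1 * (P 1 * P 2) + esym \<gamma> 2 * P 1 ^ 2"
    and P: "P \<in> proj_space 3"
    using assms by (auto simp: quartic_curve_def)
  then show "P 1 = 0" by simp
  show "P 2 \<noteq> 0"
  proof
    assume "P 2 = 0"
    then have "P 3 = 0" using eq by simp
    have "P i = 0" for i
    proof -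
      consider "i = 0" | "i = 1" | "i = 2" | "i = 3" | "i > 3" by linarith
      then show ?thesis
        using \<open>P 2 = 0\<close> \<open>P 1 = 0\<close> \<open>P 3 = 0\<close> assms(2) P by cases (auto simp: proj_space_def)
    qed
    then show False using P by (auto simp: proj_space_def)
  qed
qed

section \<open>Values of the x-coordinate map\<close>

lemma tuple_eval_x_map: "tuple_eval 1 x_map P = (\<lambda>i. if i \<le> 1 then P i else 0)"
  by (auto simp: tuple_eval_def x_map_def)

lemma is_form_x_map: "i \<le> 3 \<Longrightarrow> is_form 3 1 (x_map i)"
  by (auto simp: is_form_def x_map_def mvar_def split: if_splits)

lemma map_value_x_mapI:
  assumes "P 0 \<noteq> 0"
  shows "map_value 3 V 1 x_map P (\<lambda>i. if i \<le> 1 then P i else 0)"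
  unfolding map_value_def
proof (intro exI[of _ x_map] conjI ballI allI impI)
  show "form_tuple 3 1 (x_map :: nat \<Rightarrow> 'a mpoly)"
    unfolding form_tuple_def by (intro exI[of _ 1]) (simp add: is_form_x_map del: One_nat_def)
  show "(\<lambda>i. if i \<le> 1 then P i else 0) \<in> proj_space 1"
    using assms by (auto simp: proj_space_def intro: exI[of _ 0])
qed (auto simp: tuple_eval_x_map[unfolded One_nat_def])

lemma map_value_x_map_affine:
  assumes u: "map_value 3 V 1 x_map P u" and P: "P \<in> V" "P 0 \<noteq> 0"
  shows "u 0 \<noteq> 0" "u 1 / u 0 = P 1 / P 0"
proof -
  obtain F where F: "\<forall>w\<in>V. \<forall>i\<le>1. \<forall>j\<le>1. peval (x_map i) w * peval (F j) w = peval (x_map j) w * peval (F i) w"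
      "u = tuple_eval 1 F P" "u \<in> proj_space 1"
    using u unfolding map_value_def by blast
  have eq: "P 0 * u 1 = P 1 * u 0"
    using F(1)[rule_format, OF P(1), of 0 1] by (simp add: F(2) tuple_eval_def x_map_def)
  show "u 0 \<noteq> 0"
  proof
    assume "u 0 = 0"
    then have "u 1 = 0" using eq P by simp
    have "u i = 0" for i
      using \<open>u 0 = 0\<close> \<open>u 1 = 0\<close> F(3) by (cases "i \<le> 1") (auto simp: proj_space_def le_Suc_eq)
    then show False using F(3) by (auto simp: proj_space_def)
  qed
  then show "u 1 / u 0 = P 1 / P 0"
    using eq P by (simp add: field_simps)
qed

text \<open>On the whole curve \<open>(v 0 : v 1) = (v 1 : v 2)\<close>, hence \<open>\<infinity>\<close> is the only value at infinity.\<close>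

lemma map_value_x_map_infinity:
  assumes C: "projective_variety 3 (quartic_curve \<gamma>)"
    and Q: "Q \<in> quartic_curve \<gamma>" "Q 0 \<noteq> 0"
    and u: "map_value 3 (quartic_curve \<gamma>) 1 x_map P u" and P: "P \<in> quartic_curve \<gamma>" "P 0 = 0"
  shows "u 0 = 0"
proof -
  obtain F where F: "form_tuple 3 1 F"
      "\<forall>w\<in>quartic_curve \<gamma>. \<forall>i\<le>1. \<forall>j\<le>1. peval (x_map i) w * peval (F j) w = peval (x_map j) w * peval (F i) w"
      "u = tuple_eval 1 F P" "u \<in> proj_space 1"
    using u unfolding map_value_def by blast
  obtain d where d: "\<And>i. i \<le> 1 \<Longrightarrow> form_function 3 d (peval (F i))"
    using F(1) form_functionI unfolding form_tuple_def by blast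
  \<comment> \<open>On the curve this form vanishes after multiplication by \<open>w 0\<close>. As
    \<open>w 0\<close> is nonzero at \<open>Q\<close>, irreducibility allows the factor to be
    cancelled, and the form can be evaluated at infinity.\<close>
  have form: "form_function 3 (1 + d) (\<lambda>w. w 2 * peval (F 0) w - w 1 * peval (F 1) w)"
    by (intro form_function_diff form_function_mult form_function_var d) auto
  have zero: "w 0 * (w 2 * peval (F 0) w - w 1 * peval (F 1) w) = 0" if w: "w \<in> quartic_curve \<gamma>" for w
  proof -
    have "w 0 * peval (F 1) w = w 1 * peval (F 0) w"
      using F(2)[rule_format, OF w, of 0 1] by (simp add: x_map_def)
    moreover have "w 0 * w 2 = w 1 * w 1"
      using w by (simp add: quartic_curve_def power2_eq_square)
    moreover have "w 0 * (w 2 * peval (F 0) w - w 1 * peval (F 1) w) =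
        w 0 * w 2 * peval (F 0) w - w 1 * (w 0 * peval (F 1) w)"
      by (simp add: algebra_simps)
    ultimately show ?thesis by simp
  qed
  have "P 2 * peval (F 0) P - P 1 * peval (F 1) P = 0"
    using projective_variety_mult_eq_0[OF C form_function_var[of 0 3] form zero] Q P by auto
  then show ?thesis
    using quartic_curve_infinityD[OF P] by (simp add: F(3) tuple_eval_def)
qed

text \<open>The map from \<open>(x, a, b)\<close> to \<open>(1 : x : a + b)\<close>, which is linear
  in Segre coordinates. Over infinity it is undefined, as the four coordinates involved vanish
  there.\<close>

definition plane_projection :: "(nat \<Rightarrow> 'k::field) \<Rightarrow> (nat \<Rightarrow> 'k)" where
  "plane_projection z = plane_point (z 0) (z 4) (z 3 + z 12)"

lemma form_function_plane_projection: "form_function 15 1 (\<lambda>z. plane_projection z i)"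
proof -
  consider "i = 0" | "i = 1" | "i = 2" | "i > 2" by linarith
  then show ?thesis
    by cases (auto simp: plane_projection_def plane_point_def form_function_zero
        intro!: form_function_add form_function_var simp del: One_nat_def)
qed

lemma plane_projection_scale: "plane_projection (\<lambda>i. c * z i) = (\<lambda>i. c * plane_projection z i)"
  by (auto simp: plane_projection_def plane_point_def algebra_simps)

lemma plane_projection_fiber_point: "plane_projection (fiber_point x a b) = plane_point 1 x (a + b)"
  unfolding plane_projection_def fiber_point_coords by (simp add: add.commute)

text \<open>Irreducibility of the two factors determines the x-coordinate at infinity; that of the
  fiber product separates the quartics and makes \<open>f\<close> prime.\<close>

locale quartic_pair =
  fixes \<alpha> \<beta> :: "nat \<Rightarrow> 'k::alg_closed_field"
  assumes two_nonzero: "(2::'k) \<noteq> 0"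
    and C1: "projective_variety 3 (quartic_curve \<alpha>)"
    and C2: "projective_variety 3 (quartic_curve \<beta>)"
    and X_variety: "projective_variety 15 (fiber_product 3 (quartic_curve \<alpha>) x_map 3 (quartic_curve \<beta>) x_map)"
begin

abbreviation "X \<equiv> fiber_product 3 (quartic_curve \<alpha>) x_map 3 (quartic_curve \<beta>) x_map"

lemma fiber_point_in_X:
  assumes "a ^ 2 = poly (quartic \<alpha>) x" "b ^ 2 = poly (quartic \<beta>) x" "c \<noteq> 0"
  shows "(\<lambda>i. c * fiber_point x a b i) \<in> X"
proof -
  let ?P = "\<lambda>i. c * quartic_point x a i" and ?Q = "\<lambda>i. 1 * quartic_point x b i"
  let ?u = "\<lambda>P i. if i \<le> 1 then P i else (0::'k)"
  have mem: "?P \<in> quartic_curve \<alpha>" "?Q \<in> quartic_curve \<beta>"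
    using assms by (auto intro!: quartic_point_in_curve simp del: mult_1)
  have val: "map_value 3 (quartic_curve \<alpha>) 1 x_map ?P (?u ?P)"
    "map_value 3 (quartic_curve \<beta>) 1 x_map ?Q (?u ?Q)"
    using assms by (intro map_value_x_mapI; simp add: quartic_point_def)+
  have same: "same_point (?u ?P) (?u ?Q)"
    unfolding same_point_def
    using assms by (intro exI[of _ "1 / c"]) (auto simp: quartic_point_def le_Suc_eq)
  have eq: "(\<lambda>i. c * fiber_point x a b i) = segre 3 3 ?P ?Q"
    by (auto simp: fiber_point_def segre_def)
  show ?thesis
    unfolding fiber_product_def eq using mem val same by blast
qed

text \<open>Equality of the x-values excludes pairs with one point at infinity and the other affine.
  In the second case just the coordinates that enter \<open>plane_projection\<close> are
  recorded.\<close>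

lemma X_cases:
  assumes "z \<in> X"
  obtains (affine) x a b where "z 0 \<noteq> 0" "a ^ 2 = poly (quartic \<alpha>) x" "b ^ 2 = poly (quartic \<beta>) x"
      "z = (\<lambda>i. z 0 * fiber_point x a b i)"
    | (infinity) "z 0 = 0" "z 3 = 0" "z 4 = 0" "z 12 = 0"
proof -
  obtain P Q u w where z: "z = segre 3 3 P Q" and P: "P \<in> quartic_curve \<alpha>" and Q: "Q \<in> quartic_curve \<beta>"
    and u: "map_value 3 (quartic_curve \<alpha>) 1 x_map P u" and w: "map_value 3 (quartic_curve \<beta>) 1 x_map Q w"
    and uw: "same_point u w"
    using assms unfolding fiber_product_def by blast
  have uw0: "u 0 = 0 \<longleftrightarrow> w 0 = 0" "u 0 \<noteq> 0 \<Longrightarrow> u 1 / u 0 = w 1 / w 0"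
    using uw by (auto simp: same_point_def)
  have z0: "z 0 = P 0 * Q 0" by (simp add: z segre_def)
  \<comment> \<open>\<open>map_value_x_map_infinity\<close> asks for an affine point on the curve;
    the one over x = 0 will do.\<close>
  obtain a0 where a0: "a0 ^ 2 = poly (quartic \<alpha>) 0" using nth_root_exists[of 2] by auto
  obtain b0 where b0: "b0 ^ 2 = poly (quartic \<beta>) 0" using nth_root_exists[of 2] by auto
  have u0: "u 0 = 0 \<longleftrightarrow> P 0 = 0"
    using map_value_x_map_affine(1)[OF u P]
      map_value_x_map_infinity[OF C1 quartic_point_in_curve[OF a0, of 1] _ u P]
    by (auto simp: quartic_point_def)
  have w0: "w 0 = 0 \<longleftrightarrow> Q 0 = 0"
    using map_value_x_map_affine(1)[OF w Q]
      map_value_x_map_infinity[OF C2 quartic_point_in_curve[OF b0, of 1] _ w Q]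
    by (auto simp: quartic_point_def)
  show ?thesis
  proof (cases "P 0 = 0")
    case True
    then have "Q 0 = 0" using u0 w0 uw0 by simp
    then have "P 1 = 0" "Q 1 = 0"
      using True P Q quartic_curve_infinityD by blast+
    then show ?thesis
      using True \<open>Q 0 = 0\<close> by (intro infinity) (simp_all add: z segre_def)
  next
    case False
    then have Q0: "Q 0 \<noteq> 0" using u0 w0 uw0 by simp
    let ?x = "P 1 / P 0"
    have x: "Q 1 / Q 0 = ?x"
      using map_value_x_map_affine(2)[OF u P False] map_value_x_map_affine(2)[OF w Q Q0] uw0 u0 False by simp
    obtain a where a: "a ^ 2 = poly (quartic \<alpha>) ?x" "P = (\<lambda>i. P 0 * quartic_point ?x a i)"
      using quartic_curve_affineD[OF P False] by blast
    obtain b where b: "b ^ 2 = poly (quartic \<beta>) ?x" "Q = (\<lambda>i. Q 0 * quartic_point ?x b i)"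
      using quartic_curve_affineD[OF Q Q0] unfolding x by blast
    have "z = (\<lambda>i. z 0 * fiber_point ?x a b i)"
    proof
      fix i
      have "P (i div 4) * Q (i mod 4) = (P 0 * quartic_point ?x a (i div 4)) * (Q 0 * quartic_point ?x b (i mod 4))"
        using fun_cong[OF a(2), of "i div 4"] fun_cong[OF b(2), of "i mod 4"] by simp
      then show "z i = z 0 * fiber_point ?x a b i"
        by (simp add: z0) (simp add: z fiber_point_def segre_def)
    qed
    then show ?thesis
      using affine a b False Q0 z0 by simp
  qed
qed

text \<open>If the quartics agreed, \<open>b = \<plusminus>a\<close> would hold on the fiber product
  and irreducibility would fix the sign. But over an x where the quartic is nonzero both signs
  occur.\<close>

lemma quartics_differ: "quartic \<alpha> \<noteq> quartic \<beta>"
proof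
  assume eq: "quartic \<alpha> = quartic \<beta>"
  obtain x where x: "poly (quartic \<alpha>) x \<noteq> 0"
    using poly_eq_0_if_zero_everywhere quartic_nonzero by blast
  obtain a where a: "a ^ 2 = poly (quartic \<alpha>) x" using nth_root_exists[of 2] by auto
  have "a \<noteq> 0" using a x by auto
  then have aa: "a + a \<noteq> 0" using two_nonzero by (metis mult_2 mult_eq_0_iff)
  have zero: "(z 3 - z 12) * (z 3 + z 12) = 0" if "z \<in> X" for z
    using that
  proof (cases rule: X_cases)
    case (affine y c d)
    have "z 3 = z 0 * d" "z 12 = z 0 * c"
      by (subst affine(4), simp add: fiber_point_coords)+
    then have "(z 3 - z 12) * (z 3 + z 12) = z 0 ^ 2 * (d ^ 2 - c ^ 2)"
      by (simp add: algebra_simps power2_eq_square)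
    then show ?thesis using affine eq by simp
  qed simp
  have forms: "form_function 15 1 (\<lambda>z. z 3 - z 12)" "form_function 15 1 (\<lambda>z. z 3 + z 12)"
    by (intro form_function_diff form_function_add form_function_var; simp)+
  let ?p = "\<lambda>i. 1 * fiber_point x a a i" and ?q = "\<lambda>i. 1 * fiber_point x a (- a) i"
  have mem: "?p \<in> X" "?q \<in> X"
    using a eq by (intro fiber_point_in_X; simp)+
  have "(\<forall>z\<in>X. z 3 - z 12 = 0) \<or> (\<forall>z\<in>X. z 3 + z 12 = 0)"
    by (rule projective_variety_mult_eq_0[OF X_variety forms]) (rule zero)
  then have "?q 3 - ?q 12 = 0 \<or> ?p 3 + ?p 12 = 0"
    using bspec[OF _ mem(1), of "\<lambda>z. z 3 + z 12 = 0"] bspec[OF _ mem(2), of "\<lambda>z. z 3 - z 12 = 0"]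
    by argo
  then have "- a - a = 0 \<or> a + a = 0" by (simp only: fiber_point_coords mult_1)
  then have "a + a = 0" by (simp add: neg_eq_iff_add_eq_0)
  then show False using aa by blast
qed

sublocale howe_pair \<alpha> \<beta>
  using two_nonzero quartics_differ by unfold_locales

text \<open>The root y is one of the four signed sums, and signs can be absorbed into the choice of
  the square roots. Thus the projection hits every affine point of the sextic.\<close>

lemma affine_curve_point:
  assumes "bipoly f x y = 0"
  obtains a b where "a ^ 2 = poly (quartic \<alpha>) x" "b ^ 2 = poly (quartic \<beta>) x" "a + b = y"
proof -
  obtain a where a: "a ^ 2 = poly (quartic \<alpha>) x" using nth_root_exists[of 2] by auto
  obtain b where b: "b ^ 2 = poly (quartic \<beta>) x" using nth_root_exists[of 2] by auto
  have "y = a + b \<or> y = a + (- b) \<or> y = (- a) + b \<or> y = (- a) + (- b)"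
  proof -
    have "y - (a + b) = 0 \<or> y - (a - b) = 0 \<or> y + (a - b) = 0 \<or> y + (a + b) = 0"
      using assms unfolding bipoly_howe_sextic_factor[OF a b] by (simp only: mult_eq_0_iff disj_assoc)
    then show ?thesis
      by (elim disjE) (auto simp: algebra_simps eq_neg_iff_add_eq_0)
  qed
  then show ?thesis
    using that[of a b] that[of a "- b"] that[of "- a" b] that[of "- a" "- b"] a b by auto
qed

lemma homog_plane_projection:
  assumes "total_degree_le d g" "z 0 \<noteq> 0" "z = (\<lambda>i. z 0 * fiber_point x a b i)"
  shows "homog d g (plane_projection z) = z 0 ^ d * bipoly g x (a + b)"
proof -
  have "plane_projection z = (\<lambda>i. z 0 * plane_point 1 x (a + b) i)"
    by (subst assms(3)) (simp add: plane_projection_scale plane_projection_fiber_point)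
  then show ?thesis
    using assms(1,2) by (subst homog_affine) (simp_all add: plane_point_def)
qed

lemma prime_elem_howe_sextic: "prime_elem f"
proof (rule prime_elemI)
  show "f \<noteq> 0" by (simp add: howe_sextic_eq)
  show "\<not> f dvd 1"
    using howe_sextic_degree(1)[of \<alpha> \<beta>] dvd_imp_degree_le[of f 1] by auto
next
  fix g h assume gh: "f dvd g * h"
  obtain d where d: "total_degree_le d g" using total_degree_le_exists by blast
  obtain e where e: "total_degree_le e h" using total_degree_le_exists by blast
  \<comment> \<open>The factor \<open>z 0\<close> disposes of the points over infinity at
    once.\<close>
  have forms: "form_function 15 (1 + d * 1) (\<lambda>z. z 0 * homog d g (plane_projection z))"
     "form_function 15 (1 + e * 1) (\<lambda>z. z 0 * homog e h (plane_projection z))"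
    by (intro form_function_mult form_function_var form_function_compose[OF form_function_homog]
        form_function_plane_projection; simp)+
  have zero: "z 0 * homog d g (plane_projection z) * (z 0 * homog e h (plane_projection z)) = 0"
    if "z \<in> X" for z
    using that
  proof (cases rule: X_cases)
    case (affine x a b)
    have "bipoly f x (a + b) = 0"
      using affine by (simp add: bipoly_howe_sextic_factor)
    moreover obtain k where "g * h = f * k" using gh by blast
    ultimately have "bipoly (g * h) x (a + b) = 0" by (simp add: bipoly_mult)
    then show ?thesis
      using homog_plane_projection[OF d affine(1,4)] homog_plane_projection[OF e affine(1,4)]
      by (auto simp: bipoly_mult)
  qed simp
  have "f dvd g'" if d': "total_degree_le d' g'"
    and X: "\<forall>z\<in>X. z 0 * homog d' g' (plane_projection z) = 0" for d' g'
  proof (rule dvd_if_vanishes)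
    fix x y assume "bipoly f x y = 0"
    then obtain a b where ab: "a ^ 2 = poly (quartic \<alpha>) x" "b ^ 2 = poly (quartic \<beta>) x" "a + b = y"
      by (rule affine_curve_point)
    let ?z = "\<lambda>i. 1 * fiber_point x a b i"
    have "?z \<in> X" using ab by (intro fiber_point_in_X) auto
    then have "homog d' g' (plane_projection ?z) = 0"
      using X by (fastforce simp: fiber_point_coords)
    then show "bipoly g' x y = 0"
      using homog_plane_projection[OF d', of ?z x a b] ab by (simp add: fiber_point_coords)
  qed
  then show "f dvd g \<or> f dvd h"
    using projective_variety_mult_eq_0[OF X_variety forms zero] d e by blast
qed

text \<open>If \<open>y = a + b\<close> with \<open>a\<^sup>2 = \<phi>\<^sub>1(x)\<close>, \<open>b\<^sup>2 = \<phi>\<^sub>2(x)\<close>, then \<open>2 y a = y\<^sup>2 + \<phi>\<^sub>1 - \<phi>\<^sub>2\<close> and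
  \<open>2 y b = y\<^sup>2 - \<phi>\<^sub>1 + \<phi>\<^sub>2\<close>. This gives the inverse of the projection, homogenized here with \<open>v 0\<close>;
  the sign \<open>s\<close> distinguishes the two factors.\<close>

definition lift_factor :: "'k \<Rightarrow> (nat \<Rightarrow> 'k) \<Rightarrow> (nat \<Rightarrow> 'k)" where
  "lift_factor s v = (\<lambda>i.
     if i = 0 then 2 * (v 2 * v 0 ^ 3) else if i = 1 then 2 * (v 2 * (v 1 * v 0 ^ 2))
     else if i = 2 then 2 * (v 2 * (v 1 ^ 2 * v 0))
     else if i = 3 then v 2 ^ 2 * v 0 ^ 2 + s * (v 0 * homog 3 [:quartic \<alpha> - quartic \<beta>:] v) else 0)"

definition lift :: "(nat \<Rightarrow> 'k) \<Rightarrow> (nat \<Rightarrow> 'k)" where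
  "lift v = segre 3 3 (lift_factor 1 v) (lift_factor (- 1) v)"

lemma form_function_lift_factor: "form_function 2 4 (\<lambda>v. lift_factor s v i)"
proof -
  have deg: "1 + 3 * 1 = (4::nat)" "1 + (1 + 2 * 1) = (4::nat)" "1 + (2 * 1 + 1) = (4::nat)"
    "2 * 1 + 2 * 1 = (4::nat)" "1 + 3 = (4::nat)" by simp_all
  consider "i = 0" | "i = 1" | "i = 2" | "i = 3" | "i > 3" by linarith
  then show ?thesis
  proof cases
    case 1
    have "form_function 2 (1 + 3 * 1) (\<lambda>v. 2 * (v 2 * v 0 ^ 3) :: 'k)"
      by (intro form_function_cmult form_function_mult form_function_power form_function_var) auto
    then show ?thesis unfolding deg by (simp add: lift_factor_def 1)
  next
    case 2
    have "form_function 2 (1 + (1 + 2 * 1)) (\<lambda>v. 2 * (v 2 * (v 1 * v 0 ^ 2)) :: 'k)"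
      by (intro form_function_cmult form_function_mult form_function_power form_function_var) auto
    then show ?thesis unfolding deg by (simp add: lift_factor_def 2)
  next
    case 3
    have "form_function 2 (1 + (2 * 1 + 1)) (\<lambda>v. 2 * (v 2 * (v 1 ^ 2 * v 0)) :: 'k)"
      by (intro form_function_cmult form_function_mult form_function_power form_function_var) auto
    then show ?thesis unfolding deg by (simp add: lift_factor_def 3)
  next
    case 4
    have "form_function 2 (2 * 1 + 2 * 1) (\<lambda>v. v 2 ^ 2 * v 0 ^ 2 :: 'k)"
      by (intro form_function_mult form_function_power form_function_var) auto
    moreover have "form_function 2 (1 + 3) (\<lambda>v. s * (v 0 * homog 3 [:quartic \<alpha> - quartic \<beta>:] v) :: 'k)"
      by (intro form_function_cmult form_function_mult form_function_homog form_function_var) auto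
    ultimately show ?thesis
      unfolding deg by (simp add: lift_factor_def 4 form_function_add)
  next
    case 5
    then show ?thesis by (simp add: lift_factor_def form_function_zero)
  qed
qed

lemma form_function_lift: "form_function 2 8 (\<lambda>v. lift v i)"
proof (cases "i < 16")
  case True
  have "form_function 2 (4 + 4) (\<lambda>v. lift_factor 1 v (i div 4) * lift_factor (- 1) v (i mod 4))"
    by (intro form_function_mult form_function_lift_factor)
  then show ?thesis using True by (simp add: lift_def segre_def)
qed (simp add: lift_def segre_def form_function_zero)

lemma homog_quartic_diff:
  assumes "v 0 \<noteq> 0"
  shows "homog 3 [:quartic \<alpha> - quartic \<beta>:] v =
    v 0 ^ 3 * (poly (quartic \<alpha>) (v 1 / v 0) - poly (quartic \<beta>) (v 1 / v 0))"
proof -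
  have "total_degree_le 3 [:quartic \<alpha> - quartic \<beta>:]"
    unfolding total_degree_le_def using degree_quartic_diff[of \<alpha> \<beta>]
    by (fastforce simp: coeff_pCons simp del: coeff_diff split: nat.splits dest: le_degree)
  then show ?thesis using assms by (simp add: homog_affine bipoly_def)
qed

lemma lift_affine:
  assumes v: "v 0 \<noteq> 0" "v 2 \<noteq> 0"
    and ab: "a ^ 2 = poly (quartic \<alpha>) (v 1 / v 0)" "b ^ 2 = poly (quartic \<beta>) (v 1 / v 0)" "a + b = v 2 / v 0"
  shows "lift v = (\<lambda>i. (2 * v 2 * v 0 ^ 3) ^ 2 * fiber_point (v 1 / v 0) a b i)"
proof -
  define x y where "x = v 1 / v 0" and "y = v 2 / v 0"
  have v12: "v 1 = v 0 * x" "v 2 = v 0 * y" using v by (auto simp: x_def y_def)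
  have y: "y = a + b" using ab by (simp add: y_def)
  have diff: "homog 3 [:quartic \<alpha> - quartic \<beta>:] v = v 0 ^ 3 * (a ^ 2 - b ^ 2)"
    using homog_quartic_diff[of v] v(1) ab by simp
  have P: "lift_factor 1 v i = 2 * v 2 * v 0 ^ 3 * quartic_point x a i" for i
    unfolding lift_factor_def quartic_point_def diff unfolding v12 y
    by (simp add: algebra_simps power_numeral_reduce)
  have Q: "lift_factor (- 1) v i = 2 * v 2 * v 0 ^ 3 * quartic_point x b i" for i
    unfolding lift_factor_def quartic_point_def diff unfolding v12 y
    by (simp add: algebra_simps power_numeral_reduce)
  show ?thesis
    unfolding lift_def fiber_point_def x_def[symmetric]
    by (auto simp: segre_def P Q power2_eq_square)
qed

text \<open>All components of \<open>lift_factor\<close> share a factor \<open>v 0\<close>, so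
  \<open>lift\<close> has to be understood at affine points only. At an affine point with y = 0 the
  equation \<open>f(x, 0) = 0\<close> says that the quartics agree at x, and the last component
  vanishes as well.\<close>

lemma lift_undefined:
  assumes "v \<in> C" "v 0 = 0 \<or> v 2 = 0"
  shows "lift v i = 0"
proof -
  have "lift_factor s v i = 0" for s i
  proof (cases "v 0 = 0")
    case True
    then show ?thesis by (simp add: lift_factor_def)
  next
    case False
    then have v2: "v 2 = 0" using assms by simp
    have "bipoly f (v 1 / v 0) 0 = 0"
      using assms(1) False v2 False homog_affine[OF total_degree_le_howe_sextic, of v \<alpha> \<beta>]
      by (simp add: plane_curve_eq)
    then show ?thesis
      using homog_quartic_diff[of v] False by (simp add: bipoly_howe_sextic lift_factor_def v2)
  qed
  then show ?thesis by (simp add: lift_def segre_def)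
qed

lemma curve_point_cases:
  assumes "v \<in> C" "v 0 \<noteq> 0"
  obtains a b where "a ^ 2 = poly (quartic \<alpha>) (v 1 / v 0)" "b ^ 2 = poly (quartic \<beta>) (v 1 / v 0)" "a + b = v 2 / v 0"
proof -
  have "bipoly f (v 1 / v 0) (v 2 / v 0) = 0"
    using assms homog_affine[OF total_degree_le_howe_sextic, of v \<alpha> \<beta>] by (simp add: plane_curve_eq)
  then show ?thesis using that affine_curve_point by blast
qed

lemma plane_point_eq: "v \<in> proj_space 2 \<Longrightarrow> plane_point (v 0) (v 1) (v 2) = v"
proof
  fix i :: nat assume "v \<in> proj_space 2"
  consider "i = 0" | "i = 1" | "i = 2" | "i > 2" by linarith
  then show "plane_point (v 0) (v 1) (v 2) i = v i"
    using \<open>v \<in> proj_space 2\<close> by cases (auto simp: plane_point_def proj_space_def)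
qed

lemma lift_in_X:
  assumes "v \<in> C" "lift v \<in> proj_space 15"
  shows "v 0 \<noteq> 0" "v 2 \<noteq> 0" "lift v \<in> X" "same_point v (plane_projection (lift v))"
proof -
  show v: "v 0 \<noteq> 0" "v 2 \<noteq> 0"
    using assms lift_undefined by (auto simp: proj_space_def)
  obtain a b where ab: "a ^ 2 = poly (quartic \<alpha>) (v 1 / v 0)" "b ^ 2 = poly (quartic \<beta>) (v 1 / v 0)" "a + b = v 2 / v 0"
    using curve_point_cases[OF assms(1) v(1)] by blast
  let ?c = "(2 * v 2 * v 0 ^ 3) ^ 2"
  have c: "?c \<noteq> 0" using v two by simp
  show "lift v \<in> X"
    unfolding lift_affine[OF v ab] using ab c by (intro fiber_point_in_X)
  have "plane_projection (lift v) = (\<lambda>i. ?c * plane_point 1 (v 1 / v 0) (v 2 / v 0) i)"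
    unfolding lift_affine[OF v ab] plane_projection_scale plane_projection_fiber_point ab ..
  also have "plane_point 1 (v 1 / v 0) (v 2 / v 0) = (\<lambda>i. 1 / v 0 * plane_point (v 0) (v 1) (v 2) i)"
    using v by (auto simp: plane_point_def)
  also have "plane_point (v 0) (v 1) (v 2) = v"
    using assms(1) by (intro plane_point_eq) (simp add: plane_curve_eq)
  finally have "plane_projection (lift v) = (\<lambda>i. (?c / v 0) * v i)"
    by simp
  then show "same_point v (plane_projection (lift v))"
    unfolding same_point_def using c v by (intro exI[of _ "?c / v 0"]) auto
qed

lemma plane_projection_in_curve:
  assumes "z \<in> X" "plane_projection z \<in> proj_space 2"
  shows "plane_projection z \<in> C" "z 0 \<noteq> 0"
    and "lift (plane_projection z) \<in> proj_space 15 \<Longrightarrow> same_point z (lift (plane_projection z))"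
proof -
  from assms(1) have *: "plane_projection z \<in> C \<and> z 0 \<noteq> 0 \<and>
     (lift (plane_projection z) \<in> proj_space 15 \<longrightarrow> same_point z (lift (plane_projection z)))"
  proof (cases rule: X_cases)
    case (affine x a b)
    have "bipoly f x (a + b) = 0"
      using affine by (simp add: bipoly_howe_sextic_factor)
    then have C: "plane_projection z \<in> C"
      using assms(2) affine(1) homog_plane_projection[OF total_degree_le_howe_sextic affine(1,4)]
      by (simp add: plane_curve_eq)
    let ?v = "plane_projection z"
    have v: "?v = (\<lambda>i. z 0 * plane_point 1 x (a + b) i)"
      by (subst affine(4)) (simp add: plane_projection_scale plane_projection_fiber_point)
    have coords: "?v 0 = z 0" "?v 1 / ?v 0 = x" "?v 2 / ?v 0 = a + b"
      unfolding v using affine(1) by (simp_all add: plane_point_def)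
    have "same_point z (lift ?v)" if "lift ?v \<in> proj_space 15"
    proof -
      have nz: "?v 0 \<noteq> 0" "?v 2 \<noteq> 0" using lift_in_X(1,2)[OF C that] by auto
      have eq: "lift ?v = (\<lambda>i. (2 * ?v 2 * ?v 0 ^ 3) ^ 2 * fiber_point x a b i)"
        using lift_affine[OF nz, of a b] affine coords by simp
      let ?c = "(2 * ?v 2 * ?v 0 ^ 3) ^ 2"
      have "?c \<noteq> 0" using nz two by simp
      then have "same_point (fiber_point x a b) (lift ?v)" unfolding eq by (rule same_point_scale)
      moreover have "same_point (fiber_point x a b) z"
        by (subst affine(4)) (rule same_point_scale[OF affine(1)])
      ultimately show ?thesis using same_point_sym same_point_trans by blast
    qed
    then show ?thesis using C affine(1) by blast
  next
    case infinity
    then have "plane_projection z = (\<lambda>i. 0)" by (auto simp: plane_projection_def plane_point_def)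
    then show ?thesis using assms(2) by (simp add: proj_space_def)
  qed
  then show "plane_projection z \<in> C" "z 0 \<noteq> 0"
    "lift (plane_projection z) \<in> proj_space 15 \<Longrightarrow> same_point z (lift (plane_projection z))" by blast+
qed

text \<open>Where the quartics differ, \<open>a^2 \<noteq> b^2\<close>, so \<open>y = a + b\<close>
  is nonzero and the affine point can be lifted.\<close>

lemma good_point:
  obtains z where "z \<in> X" "plane_projection z \<in> proj_space 2" "lift (plane_projection z) \<in> proj_space 15"
proof -
  obtain x where x: "poly (quartic \<alpha> - quartic \<beta>) x \<noteq> 0"
    using poly_eq_0_if_zero_everywhere[of "quartic \<alpha> - quartic \<beta>"] quartics_distinct by auto
  obtain a where a: "a ^ 2 = poly (quartic \<alpha>) x" using nth_root_exists[of 2] by auto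
  obtain b where b: "b ^ 2 = poly (quartic \<beta>) x" using nth_root_exists[of 2] by auto
  have "a + b \<noteq> 0"
  proof
    assume "a + b = 0"
    then have "a = - b" by (simp add: eq_neg_iff_add_eq_0)
    then show False using x by (simp flip: a b)
  qed
  let ?z = "\<lambda>i. 1 * fiber_point x a b i" and ?v = "plane_point 1 x (a + b)"
  have z: "?z \<in> X" using a b by (intro fiber_point_in_X) auto
  have proj: "plane_projection ?z = ?v" by (simp add: plane_projection_fiber_point)
  have "?v \<in> proj_space 2" by (auto simp: proj_space_def plane_point_def intro: exI[of _ 0])
  moreover have "lift ?v \<in> proj_space 15"
  proof -
    have v: "?v 0 = 1" "?v 1 = x" "?v 2 = a + b" by (simp_all add: plane_point_def)
    have "lift ?v = (\<lambda>i. (2 * ?v 2 * ?v 0 ^ 3) ^ 2 * fiber_point (?v 1 / ?v 0) a b i)"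
      using a b \<open>a + b \<noteq> 0\<close> by (intro lift_affine) (simp_all add: plane_point_def)
    then have "lift ?v 0 = (2 * (a + b)) ^ 2"
      by (simp only: v fiber_point_coords) simp
    then have "lift ?v 0 \<noteq> 0"
      using \<open>a + b \<noteq> 0\<close> four by (simp del: distrib_left_numeral)
    moreover have "lift ?v i = 0" if "i > 15" for i
      using that by (simp add: lift_def segre_def)
    ultimately show ?thesis by (auto simp: proj_space_def)
  qed
  ultimately show ?thesis using that[of ?z] z proj by simp
qed

lemma birational_fiber_product: "birational 15 X 2 C"
proof -
  obtain F :: "nat \<Rightarrow> 'k mpoly" where F: "form_tuple 15 2 F" "\<And>z. tuple_eval 2 F z = (\<lambda>i. if i \<le> 2 then plane_projection z i else 0)"
    using form_tuple_choice[where m = 2 and T = plane_projection, OF form_function_plane_projection] by blast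
  obtain G :: "nat \<Rightarrow> 'k mpoly" where G: "form_tuple 2 15 G" "\<And>v. tuple_eval 15 G v = (\<lambda>i. if i \<le> 15 then lift v i else 0)"
    using form_tuple_choice[where m = 15 and T = lift, OF form_function_lift] by blast
  have F_eq: "tuple_eval 2 F z = plane_projection z" for z
    unfolding F by (auto simp: plane_projection_def plane_point_def)
  have G_eq: "tuple_eval 15 G v = lift v" for v
    unfolding G by (auto simp: lift_def segre_def)
  obtain z where z: "z \<in> X" "plane_projection z \<in> proj_space 2" "lift (plane_projection z) \<in> proj_space 15"
    by (rule good_point)
  let ?v = "plane_projection z"
  have v: "?v \<in> C" using plane_projection_in_curve[OF z(1,2)] by blast
  have "same_point ?v (plane_projection (lift ?v))" using lift_in_X(4)[OF v z(3)] .
  then have return_nz: "plane_projection (lift ?v) \<in> proj_space 2"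
    using z(2) same_point_proj_space by blast
  have C: "projective_variety 2 C"
    by (rule projective_variety_plane_curve[OF prime_elem_howe_sextic])
  have "rational_map 15 X 2 C F"
    unfolding rational_map_def F_eq using X_variety C F(1) z plane_projection_in_curve(1) by auto
  moreover have "rational_map 2 C 15 X G"
    unfolding rational_map_def G_eq using X_variety C G(1) z v lift_in_X(3) by auto
  moreover have "rational_left_inverse 15 X 2 F G"
    unfolding rational_left_inverse_def Let_def F_eq G_eq using z plane_projection_in_curve(3) by auto
  moreover have "rational_left_inverse 2 C 15 G F"
    unfolding rational_left_inverse_def Let_def F_eq G_eq using v z(3) return_nz lift_in_X(4) by auto
  ultimately have "birational_pair 15 X 2 C F G"
    unfolding birational_pair_def by blast
  then show ?thesis unfolding birational_def by blast
qed

end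

section \<open>Computing the coefficients\<close>

text \<open>Registers 0 to 7 hold the roots, and each instruction fills the next one. The roots are
  taken in pairs: with sums s, s' and products p, p' of the two pairs, the symmetric functions are s
  + s', s s' + p + p', p s' + p' s and p p'.\<close>

definition esym_program :: "arith_instr list" where
  "esym_program =
    [Add 0 1, Mul 0 1, Add 2 3, Mul 2 3, Add 8 10, Mul 8 10, Add 9 11, Add 14 13, Mul 9 10, Mul 11 8,
     Add 16 17, Mul 9 11, Add 4 5, Mul 4 5, Add 6 7, Mul 6 7, Add 20 22, Mul 20 22, Add 21 23, Add 26 25,
     Mul 21 22, Mul 23 20, Add 28 29, Mul 21 23]"

text \<open>Registers 32 to 35 receive the differences of the symmetric functions, 36 to 39 their
  sums, 40 to 44 the constants 0, 1, 2, -2, -4. There is no division, so no values of the roots make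
  execution fail.\<close>

definition coeff_program :: "arith_instr list" where
  "coeff_program =
    [Sub 12 24, Sub 15 27, Sub 18 30, Sub 19 31, Add 12 24, Add 15 27, Add 18 30, Add 19 31, Zero, One,
     Add 41 41, Sub 40 42, Add 43 43, Mul 43 32, Mul 43 35, Mul 42 32, Mul 32 32, Mul 45 33, Mul 42 36,
     Mul 47 34, Mul 33 33, Add 51 52, Mul 43 37, Mul 45 35, Mul 42 33, Mul 56 34, Sub 55 57, Mul 42 38,
     Mul 34 34, Mul 42 35, Mul 61 33, Add 60 62, Mul 43 39, Mul 46 34, Mul 35 35]"

lemma exec_program_append:
  "exec_program (p @ q) rs = (case exec_program p rs of None \<Rightarrow> None | Some rs' \<Rightarrow> exec_program q rs')"
  by (induction p arbitrary: rs) (auto split: option.splits)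

text \<open>\<open>computes_in\<close> also constrains the intermediate values; they stay in
  \<open>F\<close> because each instruction is a field operation.\<close>

lemma exec_program_subset:
  assumes "is_subfield F" "set rs \<subseteq> F" "exec_program p rs = Some rs'"
  shows "set rs' \<subseteq> F"
  using assms(2,3)
proof (induction p arbitrary: rs)
  case (Cons a p)
  then obtain r where r: "exec_instr a rs = Some r" "exec_program p (rs @ [r]) = Some rs'"
    by (auto split: option.splits)
  have "r \<in> F"
    using r(1) assms(1) Cons.prems(1)
    by (cases a) (auto simp: is_subfield_def subset_iff split: if_splits)
  then show ?case using Cons.IH[OF _ r(2)] Cons.prems by simp
qed simp

lemma exec_esym_program:
  fixes a b :: "nat \<Rightarrow> 'k::field"
  obtains rs where "exec_program esym_program (map a [1..<5] @ map b [1..<5]) = Some rs" "length rs = 32"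
    "rs ! 12 = esym a 1" "rs ! 15 = esym a 2" "rs ! 18 = esym a 3" "rs ! 19 = esym a 4"
    "rs ! 24 = esym b 1" "rs ! 27 = esym b 2" "rs ! 30 = esym b 3" "rs ! 31 = esym b 4"
proof -
  have inputs: "map a [1..<5] @ map b [1..<5] = [a 1, a 2, a 3, a 4, b 1, b 2, b 3, b 4]"
    by (simp add: upt_conv_Cons eval_nat_numeral)
  have "\<exists>rs. exec_program esym_program [a 1, a 2, a 3, a 4, b 1, b 2, b 3, b 4] = Some rs \<and> length rs = 32 \<and>
    rs ! 12 = esym a 1 \<and> rs ! 15 = esym a 2 \<and> rs ! 18 = esym a 3 \<and> rs ! 19 = esym a 4 \<and>
    rs ! 24 = esym b 1 \<and> rs ! 27 = esym b 2 \<and> rs ! 30 = esym b 3 \<and> rs ! 31 = esym b 4"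
    unfolding esym_program_def esym_4 by (simp add: algebra_simps)
  then show ?thesis using that unfolding inputs by blast
qed

lemma exec_coeff_program:
  fixes rs :: "'k::field list"
  assumes "length rs = 32"
    and "rs ! 12 = esym a 1" "rs ! 15 = esym a 2" "rs ! 18 = esym a 3" "rs ! 19 = esym a 4"
    and "rs ! 24 = esym b 1" "rs ! 27 = esym b 2" "rs ! 30 = esym b 3" "rs ! 31 = esym b 4"
  shows "\<exists>rs'. exec_program coeff_program rs = Some rs' \<and> length rs' = 67 \<and>
    map (\<lambda>r. rs' ! r) [48, 44, 49, 50, 53, 54, 41, 58, 59, 63, 64, 65, 66] = map snd (howe_coeffs a b)"
proof -
  define s where "s = esym a"
  define t where "t = esym b"
  have coeffs: "map snd (howe_coeffs a b) =
    [(s 1 - t 1) ^ 2, - 4, - 2 * (s 1 - t 1) * (s 2 - t 2), 2 * (s 1 + t 1),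
     2 * (s 1 - t 1) * (s 3 - t 3) + (s 2 - t 2) ^ 2, - 2 * (s 2 + t 2), 1,
     - 2 * (s 1 - t 1) * (s 4 - t 4) - 2 * (s 2 - t 2) * (s 3 - t 3), 2 * (s 3 + t 3),
     (s 3 - t 3) ^ 2 + 2 * (s 4 - t 4) * (s 2 - t 2), - 2 * (s 4 + t 4),
     - 2 * (s 4 - t 4) * (s 3 - t 3), (s 4 - t 4) ^ 2]"
    by (simp add: howe_coeffs_def Let_def s_def t_def)
  note regs = assms[folded s_def t_def]
  show ?thesis
    unfolding coeffs coeff_program_def
    by (simp add: regs nth_append power2_eq_square)
qed

text \<open>Program and output registers are chosen before the field elements; the 24 + 35 = 59
  instructions contain no data of the field.\<close>

lemma howe_coeffs_program:
  "\<exists>prog outs. length prog \<le> 100 \<and>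
     (\<forall>(a :: nat \<Rightarrow> 'k::field) b F. is_subfield F \<and> a ` {1..4} \<subseteq> F \<and> b ` {1..4} \<subseteq> F \<longrightarrow>
        computes_in F prog (map a [1..<5] @ map b [1..<5]) outs (map snd (howe_coeffs a b)))"
proof (intro exI conjI allI impI)
  show "length (esym_program @ coeff_program) \<le> 100"
    by (simp add: esym_program_def coeff_program_def)
next
  fix a b :: "nat \<Rightarrow> 'k" and F
  assume F: "is_subfield F \<and> a ` {1..4} \<subseteq> F \<and> b ` {1..4} \<subseteq> F"
  obtain rs where rs: "exec_program esym_program (map a [1..<5] @ map b [1..<5]) = Some rs" "length rs = 32"
    "rs ! 12 = esym a 1" "rs ! 15 = esym a 2" "rs ! 18 = esym a 3" "rs ! 19 = esym a 4"
    "rs ! 24 = esym b 1" "rs ! 27 = esym b 2" "rs ! 30 = esym b 3" "rs ! 31 = esym b 4"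
    by (rule exec_esym_program)
  \<comment> \<open>The output registers follow the order of \<open>howe_coeffs\<close>; register
    41, the constant 1, is \<open>c04\<close>.\<close>
  obtain rs' where rs': "exec_program coeff_program rs = Some rs'" "length rs' = 67"
    "map (\<lambda>r. rs' ! r) [48, 44, 49, 50, 53, 54, 41, 58, 59, 63, 64, 65, 66] = map snd (howe_coeffs a b)"
    using exec_coeff_program[OF rs(2-)] by blast
  have exec: "exec_program (esym_program @ coeff_program) (map a [1..<5] @ map b [1..<5]) = Some rs'"
    by (simp only: exec_program_append rs(1) rs'(1) option.case)
  have "set (map a [1..<5] @ map b [1..<5]) = a ` {1..4} \<union> b ` {1..4}"
  proof -
    have "set [1..<5] = {1..4 :: nat}" by auto
    then show ?thesis by (simp only: set_append set_map)
  qed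
  then have "set (map a [1..<5] @ map b [1..<5]) \<subseteq> F" using F by auto
  then have "set rs' \<subseteq> F"
    using exec_program_subset[OF _ _ exec] F by blast
  then show "computes_in F (esym_program @ coeff_program) (map a [1..<5] @ map b [1..<5])
      [48, 44, 49, 50, 53, 54, 41, 58, 59, 63, 64, 65, 66] (map snd (howe_coeffs a b))"
    unfolding computes_in_def
    by (intro exI[of _ rs'] conjI exec rs'(3)) (auto simp: rs'(2))
qed

theorem theorem1:
  fixes \<alpha> \<beta> :: "nat \<Rightarrow> 'k::alg_closed_field"
    and n :: nat and H :: "(nat \<Rightarrow> 'k) set"
  assumes "CHAR('k) = 0 \<or> CHAR('k) \<ge> 5"
    and "howe_curve n H 3 (quartic_curve \<alpha>) x_map 1 3 (quartic_curve \<beta>) x_map 1"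
    and "has_genus n H 5"
    and "\<not> is_hyperelliptic n H"
  shows "(irreducible (howe_sextic \<alpha> \<beta>) \<and> total_degree (howe_sextic \<alpha> \<beta>) = 6 \<and>
          singular_curve 2 (plane_curve (howe_sextic \<alpha> \<beta>)) \<and>
          birational n H 2 (plane_curve (howe_sextic \<alpha> \<beta>))) \<and>
         (\<exists>prog outs. length prog \<le> 100 \<and>
           (\<forall>(a :: nat \<Rightarrow> 'k) b F. is_subfield F \<and> a ` {1..4} \<subseteq> F \<and> b ` {1..4} \<subseteq> F \<longrightarrow>
              computes_in F prog (map a [1..<5] @ map b [1..<5]) outs (map snd (howe_coeffs a b))))"
proof (rule conjI)
  let ?X = "fiber_product 3 (quartic_curve \<alpha>) x_map 3 (quartic_curve \<beta>) x_map"
  have two: "(2::'k) \<noteq> 0"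
  proof
    assume "(2::'k) = 0"
    then have "of_nat 2 = (0::'k)" by simp
    then have "CHAR('k) dvd 2" by (simp only: of_nat_eq_0_iff_char_dvd)
    moreover from this have "CHAR('k) \<noteq> 0" by (metis dvd_0_left_iff zero_neq_numeral)
    ultimately have "CHAR('k) \<le> 2" "CHAR('k) \<noteq> 0" by (simp_all add: dvd_imp_le)
    then show False using assms(1) by linarith
  qed
  have curves: "projective_variety 3 (quartic_curve \<alpha>)" "projective_variety 3 (quartic_curve \<beta>)"
    and desing: "desingularization n H (3 * 3 + 3 + 3) ?X"
    using assms(2) unfolding howe_curve_def hyperelliptic_curve_def nonsingular_curve_def projective_curve_def
    by blast+
  have H: "birational n H 15 ?X"
    using desing unfolding desingularization_def birational_def by auto
  \<comment> \<open>A \<open>rational_map\<close> requires its target to be a variety, so the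
    birationality contained in \<open>desingularization\<close> supplies the irreducibility of the
    fiber product.\<close>
  then have X: "projective_variety 15 ?X"
    unfolding birational_def birational_pair_def rational_map_def by blast
  interpret quartic_pair \<alpha> \<beta>
    by unfold_locales (fact two curves X)+
  show "irreducible (howe_sextic \<alpha> \<beta>) \<and> total_degree (howe_sextic \<alpha> \<beta>) = 6 \<and>
          singular_curve 2 (plane_curve (howe_sextic \<alpha> \<beta>)) \<and>
          birational n H 2 (plane_curve (howe_sextic \<alpha> \<beta>))"
    using prime_elem_imp_irreducible[OF prime_elem_howe_sextic] total_degree_howe_sextic
      singular_plane_curve[OF prime_elem_howe_sextic] birational_trans[OF H birational_fiber_product]
    by blast
qed (rule howe_coeffs_program)

end
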